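(* Let $P$ be a manifold, let $G$ be a Lie group acting smoothly, properly and freely on $P$, and let $X$ be a smooth $G$-invariant vector field on $P$. Then, for generic smooth $G$-invariant functions $F:P\to\mathbf{R}$ (that is, for all $F$ in some residual subset of $\mathcal{C}^G(P,\mathbf{R})$), the only solutions to $X$ along which $F$ is conserved (i.e. constant) are the relative equilibria.
   Context: All manifolds are $C^\infty$, paracompact, second countable, finite-dimensional and without boundary; smooth means $C^\infty$. A solution of a vector field $X$ is an integral curve of $X$. Since the action of $G$ is free, proper and smooth, $P/G$ is a smooth manifold, and $G$-invariant smooth vector fields on $P$ descend to smooth vector fields on $P/G$. A relative equilibrium of $X$ is a solution of $X$ whose projection to $P/G$ is an equilibrium (constant solution) of the induced vector field. $\mathcal{C}^G(P,\mathbf{R})$ is the set of smooth $G$-invariant real-valued functions on $P$; it is given the topology making the natural bijection $\mathcal{C}^G(P,\mathbf{R})\cong\mathcal{C}^\infty(P/G,\mathbf{R})$ a homeomorphism, where $\mathcal{C}^\infty(P/G,\mathbf{R})$ carries the strong (Whitney) $C^\infty$ topology. A subset is residual if it contains the intersection of a countable number of open dense subsets. *)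

theory Defs
  imports "HOL-Analysis.Analysis" "HOL-Algebra.Group_Action"
begin

section \<open>Smooth maps between open subsets of finite-dimensional vector spaces\<close>

text \<open>
  Manifolds are modelled on a linear subspace \<open>S\<close> of a Euclidean space, so that the dimension is
  the term \<open>dim S\<close>; it ranges over \<open>0, \<dots>, DIM('e)\<close>, zero included, and \<open>DIM('e)\<close> is arbitrary.
  If \<open>W\<close> is open in \<open>S\<close> and \<open>x \<in> W\<close>, a derivative at \<open>x\<close> within \<open>W\<close> is determined on \<open>S\<close>
  (although not off \<open>S\<close>), so derivatives are only ever evaluated on vectors of \<open>S\<close>.
\<close>

primrec iter_deriv ::
  "'e::euclidean_space set \<Rightarrow> 'e list \<Rightarrow> ('e \<Rightarrow> 'b::real_normed_vector) \<Rightarrow> 'e \<Rightarrow> 'b" where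
  "iter_deriv W [] f = f"
| "iter_deriv W (v # vs) f = iter_deriv W vs (\<lambda>x. frechet_derivative f (at x within W) v)"

definition smooth_on ::
  "'e::euclidean_space set \<Rightarrow> 'e set \<Rightarrow> ('e \<Rightarrow> 'b::real_normed_vector) \<Rightarrow> bool" where
  "smooth_on S W f \<longleftrightarrow> (\<forall>vs. set vs \<subseteq> S \<longrightarrow> iter_deriv W vs f differentiable_on W)"


section \<open>Manifolds\<close>

type_synonym ('p, 'e) chart = "'p set \<times> ('p \<Rightarrow> 'e)"

record ('p, 'e) manifold =
  mtop :: "'p topology"
  model :: "'e set"
  atlas :: "('p, 'e) chart set"

definition top_chart :: "'p topology \<Rightarrow> 'e::euclidean_space set \<Rightarrow> ('p, 'e) chart \<Rightarrow> bool" where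
  "top_chart T S = (\<lambda>(U, \<phi>). openin T U \<and> openin (top_of_set S) (\<phi> ` U) \<and>
     homeomorphic_map (subtopology T U) (top_of_set (\<phi> ` U)) \<phi>)"

definition smooth_transition ::
  "'e::euclidean_space set \<Rightarrow> ('p, 'e) chart \<Rightarrow> ('p, 'e) chart \<Rightarrow> bool" where
  "smooth_transition S = (\<lambda>(U, \<phi>) (V, \<psi>). smooth_on S (\<phi> ` (U \<inter> V)) (\<psi> \<circ> inv_into U \<phi>))"

definition paracompact_space :: "'p topology \<Rightarrow> bool" where
  "paracompact_space T \<longleftrightarrow>
     (\<forall>\<U>. (\<forall>U\<in>\<U>. openin T U) \<and> \<Union>\<U> = topspace T \<longrightarrow>
       (\<exists>\<V>. (\<forall>V\<in>\<V>. openin T V \<and> (\<exists>U\<in>\<U>. V \<subseteq> U)) \<and> \<Union>\<V> = topspace T \<and>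
            locally_finite_in T \<V>))"

definition smooth_manifold :: "('p, 'e::euclidean_space) manifold \<Rightarrow> bool" where
  "smooth_manifold M \<longleftrightarrow>
     Hausdorff_space (mtop M) \<and> second_countable (mtop M) \<and> paracompact_space (mtop M) \<and>
     subspace (model M) \<and>
     (\<forall>C\<in>atlas M. top_chart (mtop M) (model M) C) \<and>
     (\<Union>C\<in>atlas M. fst C) = topspace (mtop M) \<and>
     (\<forall>C\<in>atlas M. \<forall>D\<in>atlas M. smooth_transition (model M) C D)"

definition maximal_atlas :: "('p, 'e::euclidean_space) manifold \<Rightarrow> ('p, 'e) chart set" where
  "maximal_atlas M = {C. top_chart (mtop M) (model M) C \<and>
     (\<forall>D\<in>atlas M. smooth_transition (model M) C D \<and> smooth_transition (model M) D C)}"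

definition product_manifold ::
  "('p, 'e::euclidean_space) manifold \<Rightarrow> ('q, 'f::euclidean_space) manifold
     \<Rightarrow> ('p \<times> 'q, 'e \<times> 'f) manifold" where
  "product_manifold M N =
     \<lparr> mtop = prod_topology (mtop M) (mtop N),
       model = model M \<times> model N,
       atlas = {(U \<times> V, map_prod \<phi> \<psi>) | U \<phi> V \<psi>. (U, \<phi>) \<in> atlas M \<and> (V, \<psi>) \<in> atlas N} \<rparr>"

definition smooth_map ::
  "('p, 'e::euclidean_space) manifold \<Rightarrow> ('q, 'f::euclidean_space) manifold \<Rightarrow> ('p \<Rightarrow> 'q) \<Rightarrow> bool"
  where
  "smooth_map M N f \<longleftrightarrow> continuous_map (mtop M) (mtop N) f \<and>
     (\<forall>(U, \<phi>)\<in>atlas M. \<forall>(V, \<psi>)\<in>atlas N.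
        smooth_on (model M) (\<phi> ` {x \<in> U. f x \<in> V}) (\<psi> \<circ> f \<circ> inv_into U \<phi>))"

text \<open>
  The predicate \<open>smooth_fun\<close> ignores the values of \<open>f\<close> off the manifold.  The function space
  \<open>smooth_functions\<close> fixes them by extensionality, so that its elements are in bijection with the
  smooth functions defined on the manifold only.
\<close>

definition smooth_fun :: "('p, 'e::euclidean_space) manifold \<Rightarrow> ('p \<Rightarrow> real) \<Rightarrow> bool" where
  "smooth_fun M f \<longleftrightarrow> (\<forall>(U, \<phi>)\<in>atlas M. smooth_on (model M) (\<phi> ` U) (f \<circ> inv_into U \<phi>))"

definition smooth_functions :: "('p, 'e::euclidean_space) manifold \<Rightarrow> ('p \<Rightarrow> real) set" where
  "smooth_functions M = {f \<in> extensional (topspace (mtop M)). smooth_fun M f}"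


section \<open>Vector fields and their solutions\<close>

text \<open>
  Tangent vectors are derivations of the algebra of smooth functions; only the values of a
  derivation on smooth functions are meaningful.  A derivation does not see the values of
  a function off the manifold: if \<open>f\<close> vanishes on \<open>M\<close> and \<open>e\<close> is the indicator function of the
  complement of \<open>M\<close>, then \<open>f = f * e\<close> and the Leibniz rule gives \<open>D f = 0\<close>.
\<close>

definition derivation_at ::
  "('p, 'e::euclidean_space) manifold \<Rightarrow> 'p \<Rightarrow> (('p \<Rightarrow> real) \<Rightarrow> real) \<Rightarrow> bool" where
  "derivation_at M p D \<longleftrightarrow>
     (\<forall>f g. smooth_fun M f \<and> smooth_fun M g \<longrightarrow> D (\<lambda>x. f x + g x) = D f + D g) \<and>
     (\<forall>a f. smooth_fun M f \<longrightarrow> D (\<lambda>x. a * f x) = a * D f) \<and>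
     (\<forall>f g. smooth_fun M f \<and> smooth_fun M g \<longrightarrow> D (\<lambda>x. f x * g x) = f p * D g + g p * D f)"

type_synonym 'p vector_field = "'p \<Rightarrow> ('p \<Rightarrow> real) \<Rightarrow> real"

definition smooth_vector_field ::
  "('p, 'e::euclidean_space) manifold \<Rightarrow> 'p vector_field \<Rightarrow> bool" where
  "smooth_vector_field M X \<longleftrightarrow>
     (\<forall>p\<in>topspace (mtop M). derivation_at M p (X p)) \<and>
     (\<forall>f. smooth_fun M f \<longrightarrow> smooth_fun M (\<lambda>p. X p f))"

text \<open>
  The velocity of \<open>c\<close> at time \<open>t\<close> is the derivation \<open>f \<mapsto> (f \<circ> c)' t\<close>.  The interval \<open>J\<close> need not
  be maximal.
\<close>

definition integral_curve ::
  "('p, 'e::euclidean_space) manifold \<Rightarrow> 'p vector_field \<Rightarrow> real set \<Rightarrow> (real \<Rightarrow> 'p) \<Rightarrow> bool" where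
  "integral_curve M X J c \<longleftrightarrow>
     open J \<and> is_interval J \<and> J \<noteq> {} \<and> continuous_map (top_of_set J) (mtop M) c \<and>
     (\<forall>t\<in>J. \<forall>f. smooth_fun M f \<longrightarrow> ((f \<circ> c) has_real_derivative X (c t) f) (at t))"


section \<open>The strong (Whitney) topology\<close>

text \<open>
  Basic neighbourhood of \<open>f\<close> of order \<open>r\<close>, for a family of charts \<open>C i\<close>, compact sets
  \<open>K i\<close> inside their domains and tolerances \<open>\<epsilon> i\<close>: all partial derivatives of order at most \<open>r\<close> of
  \<open>g - f\<close> in the chart \<open>C i\<close> are smaller than \<open>\<epsilon> i\<close> on \<open>K i\<close>.  By compactness of the unit ball,
  testing \<open>\<bar>D\<^sup>k(g - f)(v\<^sub>1, \<dots>, v\<^sub>k)\<bar> < \<epsilon>\<close> on all vectors of norm at most 1 amounts to the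
  same inequality for the operator norm of \<open>D\<^sup>k(g - f)\<close>.
\<close>

definition whitney_nbhd ::
  "('p, 'e::euclidean_space) manifold \<Rightarrow> nat \<Rightarrow> nat set \<Rightarrow> (nat \<Rightarrow> ('p, 'e) chart) \<Rightarrow>
     (nat \<Rightarrow> 'p set) \<Rightarrow> (nat \<Rightarrow> real) \<Rightarrow> ('p \<Rightarrow> real) \<Rightarrow> ('p \<Rightarrow> real) set" where
  "whitney_nbhd M r I C K \<epsilon> f =
     {g \<in> smooth_functions M. \<forall>i\<in>I. case C i of (U, \<phi>) \<Rightarrow>
        \<forall>x\<in>K i. \<forall>vs. set vs \<subseteq> model M \<inter> cball 0 1 \<and> length vs \<le> r \<longrightarrow>
          \<bar>iter_deriv (\<phi> ` U) vs (\<lambda>y. g (inv_into U \<phi> y) - f (inv_into U \<phi> y)) (\<phi> x)\<bar> < \<epsilon> i}"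

text \<open>
  The charts range over the maximal atlas and form a locally finite family; a
  locally finite family of nonempty sets in a second countable space is countable, so indices in
  \<open>nat\<close> suffice.  The order \<open>r\<close> is finite but arbitrary, the same for all \<open>i\<close>: the strong
  \<open>C\<^sup>\<infinity>\<close> topology is the union of the topologies induced by the strong \<open>C\<^sup>r\<close> topologies.
\<close>

definition whitney_topology :: "('p, 'e::euclidean_space) manifold \<Rightarrow> ('p \<Rightarrow> real) topology" where
  "whitney_topology M = topology_generated_by
     {whitney_nbhd M r I C K \<epsilon> f | r I C K \<epsilon> f.
        f \<in> smooth_functions M \<and>
        (\<forall>i\<in>I. C i \<in> maximal_atlas M \<and> compactin (mtop M) (K i) \<and> K i \<subseteq> fst (C i) \<and> 0 < \<epsilon> i) \<and>
        (\<forall>x\<in>topspace (mtop M). \<exists>N. openin (mtop M) N \<and> x \<in> N \<and>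
           finite {i \<in> I. fst (C i) \<inter> N \<noteq> {}})}"

lemma topspace_whitney_topology:
  fixes M :: "('p, 'e::euclidean_space) manifold"
  shows "topspace (whitney_topology M) = smooth_functions M"
proof -
  define \<B> where "\<B> = {whitney_nbhd M r I C K \<epsilon> f | r I C K \<epsilon> f.
        f \<in> smooth_functions M \<and>
        (\<forall>i\<in>I. C i \<in> maximal_atlas M \<and> compactin (mtop M) (K i) \<and> K i \<subseteq> fst (C i) \<and> 0 < \<epsilon> i) \<and>
        (\<forall>x\<in>topspace (mtop M). \<exists>N. openin (mtop M) N \<and> x \<in> N \<and>
           finite {i \<in> I. fst (C i) \<inter> N \<noteq> {}})}"
  have nbhd: "whitney_nbhd M 0 {} C K \<epsilon> f = smooth_functions M" for C K \<epsilon> f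
    by (simp add: whitney_nbhd_def)
  have "\<exists>N. openin (mtop M) N \<and> x \<in> N \<and> finite {i \<in> {}. fst (C i) \<inter> N \<noteq> {}}"
    if "x \<in> topspace (mtop M)" for x and C :: "nat \<Rightarrow> ('p, 'e) chart"
    using that by (intro exI[of _ "topspace (mtop M)"]) simp
  then have "whitney_nbhd M 0 {} (\<lambda>_. undefined) (\<lambda>_. {}) (\<lambda>_. 1) f \<in> \<B>"
    if "f \<in> smooth_functions M" for f
    unfolding \<B>_def using that
    by (intro CollectI exI[of _ "0::nat"] exI[of _ "{}::nat set"]
          exI[of _ "\<lambda>_. undefined"] exI[of _ "\<lambda>_. {}"] exI[of _ "\<lambda>_. 1"] exI[of _ f]
          conjI refl ballI) auto
  then have "smooth_functions M \<subseteq> \<Union>\<B>"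
    unfolding nbhd by blast
  moreover have "\<Union>\<B> \<subseteq> smooth_functions M"
    by (auto simp: \<B>_def whitney_nbhd_def)
  ultimately show ?thesis
    unfolding whitney_topology_def \<B>_def[symmetric] topology_generated_by_topspace by blast
qed

definition residual_in :: "'x topology \<Rightarrow> 'x set \<Rightarrow> bool" where
  "residual_in T R \<longleftrightarrow> R \<subseteq> topspace T \<and>
     (\<exists>\<U>. countable \<U> \<and> (\<forall>U\<in>\<U>. openin T U \<and> T closure_of U = topspace T) \<and>
          topspace T \<inter> \<Inter>\<U> \<subseteq> R)"


section \<open>Lie groups and their actions\<close>

definition lie_group ::
  "('g, 'r) monoid_scheme \<Rightarrow> ('g, 'f::euclidean_space) manifold \<Rightarrow> bool" where
  "lie_group G L \<longleftrightarrow> group G \<and> smooth_manifold L \<and> carrier G = topspace (mtop L) \<and>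
     smooth_map (product_manifold L L) L (\<lambda>(g, h). g \<otimes>\<^bsub>G\<^esub> h) \<and>
     smooth_map L L (\<lambda>g. inv\<^bsub>G\<^esub> g)"

definition smooth_action ::
  "('g, 'r) monoid_scheme \<Rightarrow> ('g, 'f::euclidean_space) manifold \<Rightarrow>
     ('p, 'e::euclidean_space) manifold \<Rightarrow> ('g \<Rightarrow> 'p \<Rightarrow> 'p) \<Rightarrow> bool" where
  "smooth_action G L M \<alpha> \<longleftrightarrow> group_action G (topspace (mtop M)) \<alpha> \<and>
     smooth_map (product_manifold L M) M (\<lambda>(g, x). \<alpha> g x)"

definition proper_action ::
  "('g, 'f::euclidean_space) manifold \<Rightarrow> ('p, 'e::euclidean_space) manifold \<Rightarrow>
     ('g \<Rightarrow> 'p \<Rightarrow> 'p) \<Rightarrow> bool" where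
  "proper_action L M \<alpha> \<longleftrightarrow>
     proper_map (prod_topology (mtop L) (mtop M)) (prod_topology (mtop M) (mtop M))
       (\<lambda>(g, x). (\<alpha> g x, x))"

definition free_action ::
  "('g, 'r) monoid_scheme \<Rightarrow> ('p, 'e::euclidean_space) manifold \<Rightarrow> ('g \<Rightarrow> 'p \<Rightarrow> 'p) \<Rightarrow> bool" where
  "free_action G M \<alpha> \<longleftrightarrow> (\<forall>x\<in>topspace (mtop M). stabilizer G \<alpha> x = {\<one>\<^bsub>G\<^esub>})"

text \<open>
  Invariance of a vector field: the derivative of \<open>\<alpha> g\<close> maps \<open>X x\<close> to \<open>X (\<alpha> g x)\<close>.
\<close>

definition invariant_vector_field ::
  "('g, 'r) monoid_scheme \<Rightarrow> ('p, 'e::euclidean_space) manifold \<Rightarrow> ('g \<Rightarrow> 'p \<Rightarrow> 'p) \<Rightarrow>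
     'p vector_field \<Rightarrow> bool" where
  "invariant_vector_field G M \<alpha> X \<longleftrightarrow>
     (\<forall>g\<in>carrier G. \<forall>x\<in>topspace (mtop M). \<forall>f. smooth_fun M f \<longrightarrow>
        X (\<alpha> g x) f = X x (f \<circ> \<alpha> g))"


section \<open>The orbit manifold\<close>

text \<open>
  For a free proper smooth action, the orbit space carries a unique smooth structure for
  which the projection \<open>orbit G \<alpha>\<close> is a submersion.  Its charts are exactly the topological charts
  \<open>(V, \<psi>)\<close> of the orbit space for which \<open>\<psi> \<circ> orbit G \<alpha>\<close> is a smooth submersion.  Its dimension is
  \<open>dim M - dim G\<close>; the choice of the model space is immaterial.
\<close>

definition orbit_topology ::
  "('g, 'r) monoid_scheme \<Rightarrow> ('p, 'e::euclidean_space) manifold \<Rightarrow> ('g \<Rightarrow> 'p \<Rightarrow> 'p) \<Rightarrow>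
     'p set topology" where
  "orbit_topology G M \<alpha> = topology (\<lambda>V. V \<subseteq> orbits G (topspace (mtop M)) \<alpha> \<and>
     openin (mtop M) {x \<in> topspace (mtop M). orbit G \<alpha> x \<in> V})"

lemma openin_orbit_topology:
  "openin (orbit_topology G M \<alpha>) V \<longleftrightarrow> V \<subseteq> orbits G (topspace (mtop M)) \<alpha> \<and>
     openin (mtop M) {x \<in> topspace (mtop M). orbit G \<alpha> x \<in> V}"
proof -
  have "istopology (\<lambda>V. V \<subseteq> orbits G (topspace (mtop M)) \<alpha> \<and>
     openin (mtop M) {x \<in> topspace (mtop M). orbit G \<alpha> x \<in> V})" (is "istopology ?P")
    unfolding istopology_def
  proof (intro conjI allI impI)
    fix A B assume *: "?P A" "?P B"
    have eq: "{x \<in> topspace (mtop M). orbit G \<alpha> x \<in> A \<inter> B} =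
      {x \<in> topspace (mtop M). orbit G \<alpha> x \<in> A} \<inter> {x \<in> topspace (mtop M). orbit G \<alpha> x \<in> B}"
      by auto
    show "openin (mtop M) {x \<in> topspace (mtop M). orbit G \<alpha> x \<in> A \<inter> B}"
      unfolding eq using * by (intro openin_Int) blast+
    show "A \<inter> B \<subseteq> orbits G (topspace (mtop M)) \<alpha>"
      using * by auto
  next
    fix \<K> assume *: "\<forall>K\<in>\<K>. ?P K"
    have eq: "{x \<in> topspace (mtop M). orbit G \<alpha> x \<in> \<Union>\<K>} =
      (\<Union>K\<in>\<K>. {x \<in> topspace (mtop M). orbit G \<alpha> x \<in> K})"
      by auto
    show "openin (mtop M) {x \<in> topspace (mtop M). orbit G \<alpha> x \<in> \<Union>\<K>}"
      unfolding eq using * by (intro openin_Union) blast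
    show "\<Union>\<K> \<subseteq> orbits G (topspace (mtop M)) \<alpha>"
      using * by auto
  qed
  from topology_inverse'[OF this] show ?thesis
    unfolding orbit_topology_def by (rule fun_cong)
qed

definition orbit_model :: "'f::euclidean_space set \<Rightarrow> 'e::euclidean_space set \<Rightarrow> 'e set" where
  "orbit_model SG S = (SOME T. subspace T \<and> T \<subseteq> S \<and> dim T = dim S - dim SG)"

definition submersive_chart ::
  "('g, 'r) monoid_scheme \<Rightarrow> ('p, 'e::euclidean_space) manifold \<Rightarrow> ('g \<Rightarrow> 'p \<Rightarrow> 'p) \<Rightarrow>
     'e set \<Rightarrow> ('p set, 'e) chart \<Rightarrow> bool" where
  "submersive_chart G M \<alpha> T = (\<lambda>(V, \<psi>). \<forall>(U, \<phi>)\<in>atlas M.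
     let W = \<phi> ` {x \<in> U. orbit G \<alpha> x \<in> V}; h = \<psi> \<circ> orbit G \<alpha> \<circ> inv_into U \<phi>
     in smooth_on (model M) W h \<and>
        (\<forall>y\<in>W. frechet_derivative h (at y within W) ` model M = T))"

definition orbit_manifold ::
  "('g, 'r) monoid_scheme \<Rightarrow> ('g, 'f::euclidean_space) manifold \<Rightarrow>
     ('p, 'e::euclidean_space) manifold \<Rightarrow> ('g \<Rightarrow> 'p \<Rightarrow> 'p) \<Rightarrow> ('p set, 'e) manifold" where
  "orbit_manifold G L M \<alpha> =
     (let T = orbit_model (model L) (model M) in
     \<lparr> mtop = orbit_topology G M \<alpha>,
       model = T,
       atlas = {C. top_chart (orbit_topology G M \<alpha>) T C \<and> submersive_chart G M \<alpha> T C} \<rparr>)"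

definition induced_vector_field ::
  "('g, 'r) monoid_scheme \<Rightarrow> ('g \<Rightarrow> 'p \<Rightarrow> 'p) \<Rightarrow> 'p vector_field \<Rightarrow> 'p set vector_field" where
  "induced_vector_field G \<alpha> X q f = X (SOME p. p \<in> q) (f \<circ> orbit G \<alpha>)"

definition relative_equilibrium ::
  "('g, 'r) monoid_scheme \<Rightarrow> ('g, 'f::euclidean_space) manifold \<Rightarrow>
     ('p, 'e::euclidean_space) manifold \<Rightarrow> ('g \<Rightarrow> 'p \<Rightarrow> 'p) \<Rightarrow> 'p vector_field \<Rightarrow>
     real set \<Rightarrow> (real \<Rightarrow> 'p) \<Rightarrow> bool" where
  "relative_equilibrium G L M \<alpha> X J c \<longleftrightarrow>
     integral_curve M X J c \<and>
     integral_curve (orbit_manifold G L M \<alpha>) (induced_vector_field G \<alpha> X) J (orbit G \<alpha> \<circ> c) \<and>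
     (orbit G \<alpha> \<circ> c) constant_on J"


section \<open>Invariant functions\<close>

definition invariant_functions ::
  "('g, 'r) monoid_scheme \<Rightarrow> ('p, 'e::euclidean_space) manifold \<Rightarrow> ('g \<Rightarrow> 'p \<Rightarrow> 'p) \<Rightarrow>
     ('p \<Rightarrow> real) set" where
  "invariant_functions G M \<alpha> =
     {F \<in> smooth_functions M. \<forall>g\<in>carrier G. \<forall>x\<in>topspace (mtop M). F (\<alpha> g x) = F x}"

text \<open>
  The natural bijection from the invariant smooth functions on \<open>M\<close> to the smooth functions on
  the orbit manifold.  The pullback topology along a bijection is the topology that makes
  the bijection a homeomorphism.
\<close>

definition descend ::
  "('g, 'r) monoid_scheme \<Rightarrow> ('p, 'e::euclidean_space) manifold \<Rightarrow> ('g \<Rightarrow> 'p \<Rightarrow> 'p) \<Rightarrow>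
     ('p \<Rightarrow> real) \<Rightarrow> 'p set \<Rightarrow> real" where
  "descend G M \<alpha> F = (\<lambda>q\<in>orbits G (topspace (mtop M)) \<alpha>. F (SOME p. p \<in> q))"

definition invariant_function_topology ::
  "('g, 'r) monoid_scheme \<Rightarrow> ('g, 'f::euclidean_space) manifold \<Rightarrow>
     ('p, 'e::euclidean_space) manifold \<Rightarrow> ('g \<Rightarrow> 'p \<Rightarrow> 'p) \<Rightarrow> ('p \<Rightarrow> real) topology" where
  "invariant_function_topology G L M \<alpha> =
     pullback_topology (invariant_functions G M \<alpha>) (descend G M \<alpha>)
       (whitney_topology (orbit_manifold G L M \<alpha>))"

end

theory Submission
  imports Defs
begin

text \<open>
  A slice of the action yields charts of the orbit space together with smooth sections.  In such a
  chart, the field induced by \<open>X\<close> becomes a smooth map \<open>\<xi>\<close>, and a solution projects to a curve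
  \<open>\<gamma>\<close> with \<open>\<gamma>' = \<xi> \<circ> \<gamma>\<close>.  Where a coordinate \<open>u = y \<bullet> b\<close> has \<open>\<xi> u \<noteq> 0\<close>, put
  \<open>\<eta> = \<xi> / \<xi> u\<close>, so that \<open>\<eta> u = 1\<close>.  If \<open>f\<close> is conserved along \<open>\<gamma>\<close>, then
  \<open>\<eta>\<^sup>j f = 0\<close> along \<open>\<gamma>\<close> for all \<open>j \<ge> 1\<close>.  Generically \<open>\<eta> f, \<dots>, \<eta>\<^sup>m f\<close> have no common
  zero on a given compact set, where \<open>m\<close> exceeds the dimension: since
  \<open>\<eta>\<^sup>j (f + p u) = \<eta>\<^sup>j f + p\<^sup>(\<^sup>j\<^sup>) u\<close>, the polynomials \<open>p'\<close> of degree less than \<open>m\<close> for which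
  \<open>f + p u\<close> fails this at \<open>y\<close> are determined by \<open>y\<close> through Taylor's formula, so that they form the
  image of a smooth map into a space of larger dimension, which is negligible.  The condition is
  open because it involves finitely many derivatives on a compact set.  Hence for generic \<open>f\<close>,
  conservation forces \<open>\<xi> = 0\<close> along \<open>\<gamma>\<close>, and \<open>\<gamma>\<close> is locally constant.
\<close>

section \<open>Smooth maps between open subsets of subspaces\<close>

text \<open>The normalisation \<eta> u = 1 is what keeps the count of parameters exact: adding a
  polynomial in u shifts the iterated derivatives by derivatives of that polynomial and by nothing
  else. Its price is that \<xi> u must not vanish, so for each coordinate the region where \<xi> u
  is nonzero is exhausted by the compact sets |\<xi> u| \<ge> 1/(m+1), each with its own open dense
  set. Perturbations have to be compactly supported. In the strong topology small multiples of a
  function need not be close to zero unless only finitely many of the charts meet its support; hence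
  the bump functions, and the Hausdorff property of the orbit space, which lets them be extended by
  zero. The model space is in general a proper subspace of its Euclidean space, where a derivative
  is unique only on the subspace. All differentiation is therefore along vectors of the subspace,
  and the inverse function theorem has to be carried over to subspaces of different spaces.
  Countability is drawn from \<open>P\<close>, which is covered by countably many saturated open
  sets.\<close>

definition open_in_subspace :: "'e::euclidean_space set \<Rightarrow> 'e set \<Rightarrow> bool" where
  "open_in_subspace S W \<longleftrightarrow> subspace S \<and> openin (top_of_set S) W"

abbreviation dirderiv ::
  "'e::euclidean_space set \<Rightarrow> 'e \<Rightarrow> ('e \<Rightarrow> 'b::real_normed_vector) \<Rightarrow> 'e \<Rightarrow> 'b" where
  "dirderiv W v f \<equiv> (\<lambda>x. frechet_derivative f (at x within W) v)"

lemma open_in_subspaceD: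
  assumes "open_in_subspace S W"
  shows "subspace S" "openin (top_of_set S) W" "W \<subseteq> S"
  using assms openin_imp_subset unfolding open_in_subspace_def by blast+

lemma open_in_subspace_subset: "open_in_subspace S W \<Longrightarrow> openin (top_of_set W) V \<Longrightarrow> open_in_subspace S V"
  unfolding open_in_subspace_def using openin_trans by blast

lemma open_in_subspace_Int: "open_in_subspace S W \<Longrightarrow> open_in_subspace S V \<Longrightarrow> open_in_subspace S (W \<inter> V)"
  unfolding open_in_subspace_def by (auto intro: openin_Int)

lemma open_in_subspace_Int_open: "open_in_subspace S W \<Longrightarrow> open V \<Longrightarrow> open_in_subspace S (W \<inter> V)"
  by (meson openin_open_Int open_in_subspace_subset)

lemma open_in_subspace_openin: "open_in_subspace S W \<Longrightarrow> open_in_subspace S V \<Longrightarrow> V \<subseteq> W \<Longrightarrow> openin (top_of_set W) V"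
  unfolding open_in_subspace_def by (meson openin_subset_trans openin_imp_subset)

lemma open_in_subspace_UNIV: "open W \<Longrightarrow> open_in_subspace UNIV W"
  by (simp add: open_in_subspace_def)

lemma open_in_subspace_vimage:
  assumes "open_in_subspace S W" "open_in_subspace S' W'" "continuous_on W f" "f ` W \<subseteq> S'"
  shows "open_in_subspace S {x \<in> W. f x \<in> W'}"
proof -
  obtain O' where O': "open O'" "W' = S' \<inter> O'"
    using assms(2) unfolding open_in_subspace_def openin_open by auto
  have "{x \<in> W. f x \<in> W'} = W \<inter> f -` O'" using assms(4) O' by auto
  moreover have "openin (top_of_set W) (W \<inter> f -` O')"
    using assms(3) O'(1) continuous_openin_preimage_gen by blast
  ultimately show ?thesis using assms(1) open_in_subspace_subset by metis
qed

section \<open>Derivatives within relatively open sets\<close>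

lemma at_within_openin:
  assumes "openin (top_of_set W) V" "x \<in> V"
  shows "at x within V = at x within W"
proof -
  obtain U where "open U" "V = W \<inter> U" using assms(1) by (auto simp: openin_open)
  then show ?thesis using assms(2) by (intro at_within_nhd[of x U]) auto
qed

lemma frechet_within_cong:
  assumes "x \<in> W" "\<And>y. y \<in> W \<Longrightarrow> f y = g y"
  shows "frechet_derivative f (at x within W) = frechet_derivative g (at x within W)"
proof -
  have "(f has_derivative D) (at x within W) \<longleftrightarrow> (g has_derivative D) (at x within W)" for D
    using has_derivative_transform[OF assms(1), of f g D] has_derivative_transform[OF assms(1), of g f D]
      assms(2) by auto
  then show ?thesis unfolding frechet_derivative_def by simp
qed

text \<open>For \<open>v\<close> in \<open>S\<close> the line through \<open>x\<close> in direction
  \<open>v\<close> stays in \<open>W\<close> for small times, and derivatives of curves on an open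
  set of times are unique. In directions off \<open>S\<close> nothing of the kind holds, because
  \<open>W\<close> can have empty interior.\<close>

lemma has_derivative_rel_unique:
  assumes W: "open_in_subspace S W" and x: "x \<in> W"
    and f: "(f has_derivative D) (at x within W)" "(f has_derivative D') (at x within W)"
    and v: "v \<in> S"
  shows "D v = D' v"
proof -
  obtain U where U: "open U" "W = S \<inter> U"
    using open_in_subspaceD(2)[OF W] by (auto simp: openin_open)
  define l where "l = (\<lambda>t::real. x + t *\<^sub>R v)"
  have S: "subspace S" using W open_in_subspaceD by auto
  have lS: "l t \<in> S" for t
    unfolding l_def using S v x U by (auto intro!: subspace_add subspace_scale)
  have cont: "continuous_on UNIV l" unfolding l_def by (intro continuous_intros)
  have A: "open (l -` U)" using cont U(1) open_vimage by blast
  have A0: "0 \<in> l -` U" using x U by (simp add: l_def)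
  have sub: "l ` (l -` U) \<subseteq> W" using lS U by auto
  have l: "(l has_derivative (\<lambda>t. t *\<^sub>R v)) (at 0 within l -` U)"
    unfolding l_def by (auto intro!: derivative_eq_intros)
  have *: "((\<lambda>t. f (l t)) has_derivative (\<lambda>t. F (t *\<^sub>R v))) (at 0)"
    if "(f has_derivative F) (at x within W)" for F
  proof -
    have "(f has_derivative F) (at (l 0) within l ` (l -` U))"
      using has_derivative_subset[OF _ sub] that by (simp add: l_def)
    from has_derivative_in_compose[OF l this] show ?thesis
      unfolding at_within_open[OF A0 A] .
  qed
  have "(\<lambda>t. D (t *\<^sub>R v)) = (\<lambda>t. D' (t *\<^sub>R v))"
    by (rule has_derivative_unique) (use * f in auto)
  from fun_cong[OF this, of 1] show ?thesis by simp
qed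

lemma dirderiv_eq:
  assumes "open_in_subspace S W" "x \<in> W" "(f has_derivative D) (at x within W)" "v \<in> S"
  shows "frechet_derivative f (at x within W) v = D v"
  by (meson assms differentiableI frechet_derivative_works has_derivative_rel_unique)

lemma subspace_basis:
  fixes T :: "'a::euclidean_space set"
  assumes "subspace T"
  obtains B where "finite B" "B \<subseteq> T" "\<forall>b\<in>B. norm b = 1" "\<forall>v\<in>T. (\<Sum>b\<in>B. (v \<bullet> b) *\<^sub>R b) = v"
proof -
  obtain B where B: "B \<subseteq> T" "pairwise orthogonal B" "\<And>b. b \<in> B \<Longrightarrow> norm b = 1"
      "independent B" "card B = dim T" "span B = T"
    using orthonormal_basis_subspace[OF assms] by blast
  have fin: "finite B" using B(4) independent_imp_finite by blast
  show thesis
    by (rule that[OF fin B(1)]) (use B(3) orthonormal_basis_expand[OF B(2) B(3) _ fin] B(6) in auto)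
qed

lemma orthogonal_projection:
  fixes S :: "'a::euclidean_space set"
  assumes "subspace S"
  obtains P where "bounded_linear P" "\<And>x. P x \<in> S" "\<And>x. x \<in> S \<Longrightarrow> P x = x"
proof -
  obtain B where B: "finite B" "B \<subseteq> S" "\<forall>b\<in>B. norm b = 1" "\<forall>v\<in>S. (\<Sum>b\<in>B. (v \<bullet> b) *\<^sub>R b) = v"
    by (rule subspace_basis[OF assms])
  show thesis
  proof
    show "bounded_linear (\<lambda>y. \<Sum>b\<in>B. (y \<bullet> b) *\<^sub>R b)"
      by (intro bounded_linear_sum bounded_linear_scaleR_left[THEN bounded_linear_compose] bounded_linear_inner_left)
    show "(\<Sum>b\<in>B. (x \<bullet> b) *\<^sub>R b) \<in> S" for x
      using B(2) assms by (intro subspace_sum subspace_scale) auto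
    show "(\<Sum>b\<in>B. (x \<bullet> b) *\<^sub>R b) = x" if "x \<in> S" for x
      using B(4) that by blast
  qed
qed

text \<open>Composing with a projection \<open>P\<close> onto \<open>T\<close> leaves
  \<open>f\<close> unchanged on \<open>W\<close>, so \<open>P\<close> after \<open>D\<close> is
  another derivative of \<open>f\<close> and agrees with \<open>D\<close> on
  \<open>S\<close>.\<close>

lemma derivative_in_subspace:
  fixes f :: "'a::euclidean_space \<Rightarrow> 'b::euclidean_space"
  assumes W: "open_in_subspace S W" and x: "x \<in> W"
    and f: "(f has_derivative D) (at x within W)" and im: "f ` W \<subseteq> T" and T: "subspace T"
    and v: "v \<in> S"
  shows "D v \<in> T"
proof -
  obtain P where lin: "bounded_linear P" and PT: "\<And>y. P y \<in> T" and Pid: "\<And>y. y \<in> T \<Longrightarrow> P y = y"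
    using orthogonal_projection[OF T] by blast
  have "((\<lambda>y. P (f y)) has_derivative (\<lambda>y. P (D y))) (at x within W)"
    by (rule bounded_linear.has_derivative[OF lin f])
  then have "(f has_derivative (\<lambda>y. P (D y))) (at x within W)"
    by (rule has_derivative_transform[OF x, rotated]) (use im Pid in auto)
  from has_derivative_rel_unique[OF W x f this v] show ?thesis using PT by metis
qed

text \<open>The class of k times continuously differentiable functions. \<open>smooth_on\<close>
  asks for all orders at once and leaves nothing to induct on; closure properties are proved here by
  induction on the order and then read off for smooth functions. Continuity at order 0 is what the
  last derivative retains.\<close>

primrec Cdiff ::
  "nat \<Rightarrow> 'e::euclidean_space set \<Rightarrow> 'e set \<Rightarrow> ('e \<Rightarrow> 'b::real_normed_vector) \<Rightarrow> bool" where
  "Cdiff 0 S W f \<longleftrightarrow> continuous_on W f"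
| "Cdiff (Suc k) S W f \<longleftrightarrow> f differentiable_on W \<and> (\<forall>v\<in>S. Cdiff k S W (dirderiv W v f))"

lemma smooth_on_iff:
  "smooth_on S W f \<longleftrightarrow> f differentiable_on W \<and> (\<forall>v\<in>S. smooth_on S W (dirderiv W v f))"
proof
  assume *: "smooth_on S W f"
  then have "f differentiable_on W" unfolding smooth_on_def by (metis iter_deriv.simps(1) empty_subsetI list.set(1))
  moreover have "smooth_on S W (dirderiv W v f)" if "v \<in> S" for v
    unfolding smooth_on_def
  proof (intro allI impI)
    fix vs assume "set vs \<subseteq> S"
    then have "iter_deriv W (v # vs) f differentiable_on W"
      using * that unfolding smooth_on_def by (metis insert_subset list.simps(15))
    then show "iter_deriv W vs (dirderiv W v f) differentiable_on W" by simp
  qed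
  ultimately show "f differentiable_on W \<and> (\<forall>v\<in>S. smooth_on S W (dirderiv W v f))" by blast
next
  assume *: "f differentiable_on W \<and> (\<forall>v\<in>S. smooth_on S W (dirderiv W v f))"
  show "smooth_on S W f"
    unfolding smooth_on_def
  proof (intro allI impI)
    fix vs assume vs: "set vs \<subseteq> S"
    show "iter_deriv W vs f differentiable_on W"
      using * vs unfolding smooth_on_def by (cases vs) auto
  qed
qed

lemma Cdiff_Suc_mono: "Cdiff (Suc k) S W f \<Longrightarrow> Cdiff k S W f"
proof (induction k arbitrary: f)
  case 0
  then show ?case by (auto simp: differentiable_imp_continuous_on)
next
  case (Suc k)
  then show ?case by (metis Cdiff.simps(2))
qed

lemma Cdiff_continuous: "Cdiff k S W f \<Longrightarrow> continuous_on W f"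
  by (cases k) (auto simp: differentiable_imp_continuous_on)

lemma smooth_on_Cdiff_iff: "smooth_on S W f \<longleftrightarrow> (\<forall>k. Cdiff k S W f)"
proof
  assume "smooth_on S W f"
  then have "Cdiff k S W f" for k
  proof (induction k arbitrary: f)
    case 0
    then show ?case using smooth_on_iff[of S W f] differentiable_imp_continuous_on by auto
  next
    case (Suc k)
    then show ?case using smooth_on_iff[of S W f] by auto
  qed
  then show "\<forall>k. Cdiff k S W f" by blast
next
  assume *: "\<forall>k. Cdiff k S W f"
  \<comment> \<open>One order more than the length of the list, since the last derivative has to be
    differentiable and not just continuous.\<close>
  have "Cdiff (Suc (length vs)) S W f \<Longrightarrow> set vs \<subseteq> S \<Longrightarrow> iter_deriv W vs f differentiable_on W" for vs
  proof (induction vs arbitrary: f)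
    case Nil
    then show ?case by simp
  next
    case (Cons a vs)
    from Cons.prems have "Cdiff (Suc (length vs)) S W (dirderiv W a f)"
      by (metis Cdiff.simps(2) length_Cons list.set_intros(1) subsetD)
    from Cons.IH[OF this] Cons.prems(2) show ?case by simp
  qed
  then show "smooth_on S W f" using * unfolding smooth_on_def by blast
qed

lemma Cdiff_cong_imp:
  assumes "Cdiff k S W f" "\<And>x. x \<in> W \<Longrightarrow> f x = g x"
  shows "Cdiff k S W g"
  using assms
proof (induction k arbitrary: f g)
  case 0
  then show ?case by (metis Cdiff.simps(1) continuous_on_cong)
next
  case (Suc k)
  have "g differentiable_on W"
    using Suc.prems by (metis (no_types, lifting) Cdiff.simps(2) differentiable_on_def differentiable_transform_within zero_less_one)
  moreover have "Cdiff k S W (dirderiv W v g)" if "v \<in> S" for v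
  proof (rule Suc.IH)
    show "Cdiff k S W (dirderiv W v f)" using Suc.prems that by simp
    show "dirderiv W v f x = dirderiv W v g x" if "x \<in> W" for x
      using frechet_within_cong[OF that, of f g] Suc.prems(2) by simp
  qed
  ultimately show ?case by simp
qed

lemma smooth_on_cong_imp:
  assumes "smooth_on S W f" "\<And>x. x \<in> W \<Longrightarrow> f x = g x"
  shows "smooth_on S W g"
  using assms Cdiff_cong_imp unfolding smooth_on_Cdiff_iff by blast

text \<open>By \<open>at_within_openin\<close> the filters within \<open>V\<close> and within
  \<open>W\<close> coincide at points of \<open>V\<close>. Derivatives within the two sets therefore
  agree on \<open>V\<close>, and locality passes to the directional derivatives.\<close>

lemma Cdiff_local:
  assumes W: "open_in_subspace S W"
    and loc: "\<And>x. x \<in> W \<Longrightarrow> \<exists>V. x \<in> V \<and> openin (top_of_set W) V \<and> Cdiff k S V f"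
  shows "Cdiff k S W f"
  using loc
proof (induction k arbitrary: f)
  case 0
  have "continuous (at x within W) f" if "x \<in> W" for x
  proof -
    obtain V where V: "x \<in> V" "openin (top_of_set W) V" "continuous_on V f"
      using 0[OF \<open>x \<in> W\<close>] by auto
    then show ?thesis by (metis at_within_openin continuous_on_eq_continuous_within)
  qed
  then show ?case by (simp add: continuous_on_eq_continuous_within)
next
  case (Suc k)
  have "f differentiable (at x within W)" if "x \<in> W" for x
  proof -
    obtain V where V: "x \<in> V" "openin (top_of_set W) V" "Cdiff (Suc k) S V f"
      using Suc.prems[OF \<open>x \<in> W\<close>] by auto
    then show ?thesis using at_within_openin[OF V(2,1)] by (auto simp: differentiable_on_def)
  qed
  moreover have "Cdiff k S W (dirderiv W v f)" if "v \<in> S" for v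
  proof (rule Suc.IH)
    fix x assume "x \<in> W"
    then obtain V where V: "x \<in> V" "openin (top_of_set W) V" "Cdiff (Suc k) S V f"
      using Suc.prems by auto
    have "Cdiff k S V (dirderiv V v f)" using V(3) that by auto
    then have "Cdiff k S V (dirderiv W v f)"
      by (rule Cdiff_cong_imp) (use at_within_openin[OF V(2)] in simp)
    then show "\<exists>V. x \<in> V \<and> openin (top_of_set W) V \<and> Cdiff k S V (dirderiv W v f)" using V by blast
  qed
  ultimately show ?case by (simp add: differentiable_on_def)
qed

lemma Cdiff_subset:
  assumes "Cdiff k S W f" "openin (top_of_set W) V"
  shows "Cdiff k S V f"
  using assms
proof (induction k arbitrary: f)
  case 0
  then show ?case by (meson Cdiff.simps(1) continuous_on_subset openin_imp_subset)
next
  case (Suc k)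
  have "f differentiable_on V" using Suc.prems
    by (meson Cdiff.simps(2) differentiable_on_subset openin_imp_subset)
  moreover have "Cdiff k S V (dirderiv V v f)" if "v \<in> S" for v
  proof (rule Cdiff_cong_imp)
    show "Cdiff k S V (dirderiv W v f)" using Suc that by auto
    show "dirderiv W v f x = dirderiv V v f x" if "x \<in> V" for x
      using at_within_openin[OF Suc.prems(2) that] by simp
  qed
  ultimately show ?case by simp
qed

lemma smooth_on_subset: "smooth_on S W f \<Longrightarrow> openin (top_of_set W) V \<Longrightarrow> smooth_on S V f"
  using Cdiff_subset unfolding smooth_on_Cdiff_iff by blast

lemma smooth_on_subset_rel: "smooth_on S W f \<Longrightarrow> open_in_subspace S W \<Longrightarrow> open_in_subspace S V \<Longrightarrow> V \<subseteq> W \<Longrightarrow> smooth_on S V f"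
  using open_in_subspace_openin smooth_on_subset by blast

lemma smooth_on_local:
  assumes W: "open_in_subspace S W"
    and loc: "\<And>x. x \<in> W \<Longrightarrow> \<exists>V. x \<in> V \<and> openin (top_of_set W) V \<and> smooth_on S V f"
  shows "smooth_on S W f"
  unfolding smooth_on_Cdiff_iff
proof
  fix k show "Cdiff k S W f"
  proof (rule Cdiff_local[OF W])
    fix x assume "x \<in> W"
    from loc[OF this] show "\<exists>V. x \<in> V \<and> openin (top_of_set W) V \<and> Cdiff k S V f"
      by (auto simp: smooth_on_Cdiff_iff)
  qed
qed

lemma smooth_on_local_rel:
  assumes W: "open_in_subspace S W"
    and loc: "\<And>x. x \<in> W \<Longrightarrow> \<exists>V. x \<in> V \<and> open_in_subspace S V \<and> smooth_on S V f"
  shows "smooth_on S W f"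
proof (rule smooth_on_local[OF W])
  fix x assume "x \<in> W"
  then obtain V where V: "x \<in> V" "open_in_subspace S V" "smooth_on S V f" using loc by blast
  have "open_in_subspace S (W \<inter> V)" using V W open_in_subspace_Int by blast
  then have "smooth_on S (W \<inter> V) f" using V smooth_on_subset_rel by (metis Int_lower2)
  then show "\<exists>V. x \<in> V \<and> openin (top_of_set W) V \<and> smooth_on S V f"
    by (metis Int_iff Int_lower1 V(1) W \<open>open_in_subspace S (W \<inter> V)\<close> \<open>x \<in> W\<close> open_in_subspace_openin)
qed

lemma iter_deriv_cong:
  assumes "\<And>y. y \<in> W \<Longrightarrow> f y = g y" "x \<in> W"
  shows "iter_deriv W vs f x = iter_deriv W vs g x"
  using assms
proof (induction vs arbitrary: f g)
  case (Cons v vs)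
  have "dirderiv W v f y = dirderiv W v g y" if "y \<in> W" for y
    using frechet_within_cong[OF that, of f g] Cons.prems(1) by simp
  from Cons.IH[OF this Cons.prems(2)] show ?case by simp
qed simp

lemma iter_deriv_subset:
  assumes "openin (top_of_set W) V" "x \<in> V"
  shows "iter_deriv W vs f x = iter_deriv V vs f x"
proof (induction vs arbitrary: f)
  case (Cons v vs)
  have "iter_deriv W vs (dirderiv W v f) x = iter_deriv V vs (dirderiv W v f) x"
    by (rule Cons)
  also have "\<dots> = iter_deriv V vs (dirderiv V v f) x"
    by (rule iter_deriv_cong) (use assms at_within_openin[OF assms(1)] in auto)
  finally show ?case by simp
qed simp

section \<open>Calculus of finitely often differentiable functions\<close>

lemma Cdiff_SucI:
  assumes W: "open_in_subspace S W"
    and f: "\<And>x. x \<in> W \<Longrightarrow> (f has_derivative f' x) (at x within W)"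
    and D: "\<And>v. v \<in> S \<Longrightarrow> Cdiff k S W (\<lambda>x. f' x v)"
  shows "Cdiff (Suc k) S W f"
proof -
  have "Cdiff k S W (dirderiv W v f)" if "v \<in> S" for v
    by (rule Cdiff_cong_imp[OF D[OF that]]) (metis W dirderiv_eq f that)
  then show ?thesis using f by (auto simp: differentiable_on_def intro: differentiableI)
qed

lemma Cdiff_SucD:
  assumes "Cdiff (Suc k) S W f"
  shows "\<And>x. x \<in> W \<Longrightarrow> (f has_derivative frechet_derivative f (at x within W)) (at x within W)"
    "\<And>v. v \<in> S \<Longrightarrow> Cdiff k S W (\<lambda>x. frechet_derivative f (at x within W) v)"
  using assms frechet_derivative_works by (auto simp: differentiable_on_def)

lemma Cdiff_const: "open_in_subspace S W \<Longrightarrow> Cdiff k S W (\<lambda>x. c)"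
proof (induction k arbitrary: c)
  case (Suc k)
  then show ?case by (intro Cdiff_SucI[where f'="\<lambda>x v. 0"]) auto
qed simp

lemma Cdiff_linear_map:
  assumes "open_in_subspace S W" "bounded_linear h"
  shows "Cdiff k S W h"
proof (cases k)
  case 0
  then show ?thesis using assms by (simp add: linear_continuous_on)
next
  case (Suc n)
  show ?thesis
    unfolding Suc by (intro Cdiff_SucI[where f'="\<lambda>x. h"] assms bounded_linear_imp_has_derivative Cdiff_const)
qed

lemma Cdiff_linear:
  assumes W: "open_in_subspace S W" and h: "bounded_linear h" and f: "Cdiff k S W f"
  shows "Cdiff k S W (\<lambda>x. h (f x))"
  using f
proof (induction k arbitrary: f)
  case 0
  then show ?case using h by (simp add: bounded_linear.continuous_on)
next
  case (Suc k)
  note * = Cdiff_SucD[OF Suc.prems]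
  show ?case
    by (rule Cdiff_SucI[OF W bounded_linear.has_derivative[OF h *(1)]]) (auto intro: Suc.IH *)
qed

lemma Cdiff_add:
  assumes W: "open_in_subspace S W" and f: "Cdiff k S W f" and g: "Cdiff k S W g"
  shows "Cdiff k S W (\<lambda>x. f x + g x)"
  using f g
proof (induction k arbitrary: f g)
  case 0
  then show ?case by (simp add: continuous_on_add)
next
  case (Suc k)
  note f = Cdiff_SucD[OF Suc.prems(1)] and g = Cdiff_SucD[OF Suc.prems(2)]
  show ?case
    by (rule Cdiff_SucI[OF W has_derivative_add[OF f(1) g(1)]]) (auto intro: Suc.IH f g)
qed

lemma Cdiff_sum:
  assumes W: "open_in_subspace S W" and f: "\<And>i. i \<in> I \<Longrightarrow> Cdiff k S W (f i)"
  shows "Cdiff k S W (\<lambda>x. \<Sum>i\<in>I. f i x)"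
proof (cases "finite I")
  case True
  then show ?thesis using f
    by (induction I rule: finite_induct) (auto simp: Cdiff_const[OF W] intro!: Cdiff_add[OF W])
qed (simp add: Cdiff_const[OF W])

lemma Cdiff_bilinear:
  assumes W: "open_in_subspace S W" and p: "bounded_bilinear p" and f: "Cdiff k S W f" and g: "Cdiff k S W g"
  shows "Cdiff k S W (\<lambda>x. p (f x) (g x))"
  using f g
proof (induction k arbitrary: f g)
  case 0
  then show ?case using bounded_bilinear.continuous_on[OF p] by auto
next
  case (Suc k)
  note f = Cdiff_SucD[OF Suc.prems(1)] and g = Cdiff_SucD[OF Suc.prems(2)]
  note m = Suc.prems[THEN Cdiff_Suc_mono]
  show ?case
    by (rule Cdiff_SucI[OF W bounded_bilinear.FDERIV[OF p f(1) g(1)]]) (auto intro!: Suc.IH f g m Cdiff_add[OF W])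
qed

text \<open>In the chain rule both the linear map Dg and its argument vary with x. Expanding the
  argument in an orthonormal basis of \<open>S'\<close> leaves products of scalar functions with
  derivatives of \<open>g\<close> in fixed directions, composed with \<open>f\<close>; the induction
  hypothesis covers these. The expansion is legitimate because Df maps \<open>S\<close> into
  \<open>S'\<close>.\<close>

lemma Cdiff_compose:
  fixes f :: "'a::euclidean_space \<Rightarrow> 'b::euclidean_space" and g :: "'b \<Rightarrow> 'c::real_normed_vector"
  assumes W: "open_in_subspace S W" and W': "open_in_subspace S' W'" and im: "f ` W \<subseteq> W'"
    and f: "Cdiff k S W f" and g: "Cdiff k S' W' g"
  shows "Cdiff k S W (\<lambda>x. g (f x))"
  using f g
proof (induction k arbitrary: g)
  case 0
  then show ?case using im continuous_on_compose2 by auto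
next
  case (Suc k)
  note f = Cdiff_SucD[OF Suc.prems(1)] and g = Cdiff_SucD[OF Suc.prems(2)]
  obtain B where B: "finite B" "B \<subseteq> S'" "\<forall>b\<in>B. norm b = 1" "\<forall>v\<in>S'. (\<Sum>b\<in>B. (v \<bullet> b) *\<^sub>R b) = v"
    by (rule subspace_basis[OF open_in_subspaceD(1)[OF W']])
  let ?Df = "\<lambda>x. frechet_derivative f (at x within W)"
  let ?Dg = "\<lambda>y. frechet_derivative g (at y within W')"
  have der: "((\<lambda>x. g (f x)) has_derivative (\<lambda>v. ?Dg (f x) (?Df x v))) (at x within W)" if "x \<in> W" for x
    by (rule has_derivative_in_compose[OF f(1)[OF that]])
       (meson g(1) has_derivative_subset im image_subset_iff that)
  show ?case
  proof (rule Cdiff_SucI[OF W der])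
    fix v assume v: "v \<in> S"
    have eq: "(\<Sum>b\<in>B. (?Df x v \<bullet> b) *\<^sub>R ?Dg (f x) b) = ?Dg (f x) (?Df x v)" if x: "x \<in> W" for x
    proof -
      have "?Df x v \<in> S'"
        by (rule derivative_in_subspace[OF W x f(1)[OF x] _ _ v])
           (use im open_in_subspaceD[OF W'] in auto)
      then have "(\<Sum>b\<in>B. (?Df x v \<bullet> b) *\<^sub>R b) = ?Df x v"
        using B(4) by blast
      moreover have "linear (?Dg (f x))"
        using g(1)[of "f x"] im x has_derivative_linear by blast
      ultimately show ?thesis
        using linear_sum[of "?Dg (f x)" "\<lambda>b. (?Df x v \<bullet> b) *\<^sub>R b" B]
        by (simp add: linear_scale)
    qed
    have "Cdiff k S W (\<lambda>x. \<Sum>b\<in>B. (?Df x v \<bullet> b) *\<^sub>R ?Dg (f x) b)"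
    proof (rule Cdiff_sum[OF W], rule Cdiff_bilinear[OF W bounded_bilinear_scaleR])
      fix b assume "b \<in> B"
      show "Cdiff k S W (\<lambda>x. ?Df x v \<bullet> b)"
        by (rule Cdiff_linear[OF W bounded_linear_inner_left f(2)[OF v]])
      show "Cdiff k S W (\<lambda>x. ?Dg (f x) b)"
        using Suc.IH[OF Cdiff_Suc_mono[OF Suc.prems(1)] g(2)] B \<open>b \<in> B\<close> by blast
    qed
    then show "Cdiff k S W (\<lambda>x. ?Dg (f x) (?Df x v))"
      by (rule Cdiff_cong_imp) (use eq in auto)
  qed
qed

section \<open>Calculus of smooth functions\<close>

lemma smooth_on_continuous: "smooth_on S W f \<Longrightarrow> continuous_on W f"
  by (metis smooth_on_Cdiff_iff Cdiff.simps(1))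

lemma smooth_on_has_derivative:
  "smooth_on S W f \<Longrightarrow> x \<in> W \<Longrightarrow>
    (f has_derivative frechet_derivative f (at x within W)) (at x within W)"
  using smooth_on_iff[of S W f] by (auto simp: differentiable_on_def frechet_derivative_works[symmetric])

lemma smooth_on_dirderiv: "smooth_on S W f \<Longrightarrow> v \<in> S \<Longrightarrow> smooth_on S W (dirderiv W v f)"
  using smooth_on_iff[of S W f] by auto

lemma smooth_on_iter_deriv:
  "smooth_on S W f \<Longrightarrow> set vs \<subseteq> S \<Longrightarrow> smooth_on S W (iter_deriv W vs f)"
proof (induction vs arbitrary: f)
  case (Cons v vs)
  then show ?case by (metis iter_deriv.simps(2) insert_subset list.simps(15) smooth_on_dirderiv)
qed simp

lemma smooth_on_const: "open_in_subspace S W \<Longrightarrow> smooth_on S W (\<lambda>x. c)"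
  by (simp add: smooth_on_Cdiff_iff Cdiff_const)

lemma smooth_on_linear_map: "open_in_subspace S W \<Longrightarrow> bounded_linear h \<Longrightarrow> smooth_on S W h"
  by (simp add: smooth_on_Cdiff_iff Cdiff_linear_map)

lemma smooth_on_id: "open_in_subspace S W \<Longrightarrow> smooth_on S W (\<lambda>x. x)"
  using smooth_on_linear_map bounded_linear_ident by blast

lemma smooth_on_linear:
  "open_in_subspace S W \<Longrightarrow> bounded_linear h \<Longrightarrow> smooth_on S W f \<Longrightarrow> smooth_on S W (\<lambda>x. h (f x))"
  by (simp add: smooth_on_Cdiff_iff Cdiff_linear)

lemma smooth_on_add:
  "open_in_subspace S W \<Longrightarrow> smooth_on S W f \<Longrightarrow> smooth_on S W g \<Longrightarrow> smooth_on S W (\<lambda>x. f x + g x)"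
  by (simp add: smooth_on_Cdiff_iff Cdiff_add)

lemma smooth_on_minus:
  "open_in_subspace S W \<Longrightarrow> smooth_on S W f \<Longrightarrow> smooth_on S W (\<lambda>x. - f x)"
  by (rule smooth_on_linear[where h=uminus]) (auto intro: bounded_linear_minus bounded_linear_ident)

lemma smooth_on_diff:
  "open_in_subspace S W \<Longrightarrow> smooth_on S W f \<Longrightarrow> smooth_on S W g \<Longrightarrow> smooth_on S W (\<lambda>x. f x - g x)"
  using smooth_on_add[OF _ _ smooth_on_minus, of S W f g] by simp

lemma smooth_on_sum:
  "open_in_subspace S W \<Longrightarrow> (\<And>i. i \<in> I \<Longrightarrow> smooth_on S W (f i)) \<Longrightarrow> smooth_on S W (\<lambda>x. \<Sum>i\<in>I. f i x)"
  by (simp add: smooth_on_Cdiff_iff Cdiff_sum)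

lemma smooth_on_bilinear:
  "open_in_subspace S W \<Longrightarrow> bounded_bilinear p \<Longrightarrow> smooth_on S W f \<Longrightarrow> smooth_on S W g \<Longrightarrow>
    smooth_on S W (\<lambda>x. p (f x) (g x))"
  by (simp add: smooth_on_Cdiff_iff Cdiff_bilinear)

lemma smooth_on_mult:
  fixes f g :: "'e::euclidean_space \<Rightarrow> real"
  shows "open_in_subspace S W \<Longrightarrow> smooth_on S W f \<Longrightarrow> smooth_on S W g \<Longrightarrow> smooth_on S W (\<lambda>x. f x * g x)"
  by (rule smooth_on_bilinear[OF _ bounded_bilinear_mult])

lemma smooth_on_scaleR:
  "open_in_subspace S W \<Longrightarrow> smooth_on S W f \<Longrightarrow> smooth_on S W g \<Longrightarrow> smooth_on S W (\<lambda>x. f x *\<^sub>R g x)"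
  by (rule smooth_on_bilinear[OF _ bounded_bilinear_scaleR])

lemma smooth_on_inner_left:
  "open_in_subspace S W \<Longrightarrow> smooth_on S W f \<Longrightarrow> smooth_on S W (\<lambda>x. f x \<bullet> b)"
  by (rule smooth_on_linear[OF _ bounded_linear_inner_left])

lemma smooth_on_compose:
  fixes f :: "'a::euclidean_space \<Rightarrow> 'b::euclidean_space" and g :: "'b \<Rightarrow> 'c::real_normed_vector"
  shows "open_in_subspace S W \<Longrightarrow> open_in_subspace S' W' \<Longrightarrow> f ` W \<subseteq> W' \<Longrightarrow> smooth_on S W f \<Longrightarrow> smooth_on S' W' g
    \<Longrightarrow> smooth_on S W (\<lambda>x. g (f x))"
  unfolding smooth_on_Cdiff_iff by (rule allI, rule Cdiff_compose[of S W S' W' f]) blast+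

lemma smooth_on_Pair:
  assumes "open_in_subspace S W" "smooth_on S W f" "smooth_on S W g"
  shows "smooth_on S W (\<lambda>x. (f x, g x))"
proof -
  have "smooth_on S W (\<lambda>x. (\<lambda>y. (y, 0)) (f x) + (\<lambda>y. (0, y)) (g x))"
    by (intro smooth_on_add assms smooth_on_linear[OF assms(1), of "\<lambda>y. (y, 0)"]
      smooth_on_linear[OF assms(1), of "\<lambda>y. (0, y)"] bounded_linear_Pair bounded_linear_ident bounded_linear_zero)
  then show ?thesis by simp
qed

text \<open>Differentiation never leaves the family, so one induction on the order treats all
  members together. This gives smoothness of functions whose higher derivatives have no convenient
  closed form but stay of one shape.\<close>

lemma smooth_on_closed_family:
  assumes diff: "\<And>f. f \<in> F \<Longrightarrow> f differentiable_on W"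
    and clos: "\<And>f v. f \<in> F \<Longrightarrow> v \<in> S \<Longrightarrow> \<exists>g\<in>F. \<forall>x\<in>W. dirderiv W v f x = g x"
    and f: "f \<in> F"
  shows "smooth_on S W f"
proof -
  have "Cdiff k S W f" for k
    using f
  proof (induction k arbitrary: f)
    case 0
    then show ?case using diff differentiable_imp_continuous_on by auto
  next
    case (Suc k)
    have "Cdiff k S W (dirderiv W v f)" if v: "v \<in> S" for v
    proof -
      obtain g where g: "g \<in> F" "\<forall>x\<in>W. dirderiv W v f x = g x" using clos[OF Suc.prems v] by blast
      show ?thesis by (rule Cdiff_cong_imp[OF Suc.IH[OF g(1)]]) (use g(2) in simp)
    qed
    then show ?case using diff[OF Suc.prems] by simp
  qed
  then show ?thesis by (simp add: smooth_on_Cdiff_iff)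
qed

lemma smooth_on_real_family:
  assumes W: "open W"
    and F: "\<And>f. f \<in> F \<Longrightarrow> \<exists>f'\<in>F. \<forall>x\<in>W. (f has_real_derivative f' x) (at x)"
    and sc: "\<And>f c. f \<in> F \<Longrightarrow> (\<lambda>x. c * f x) \<in> F"
    and f: "f \<in> F"
  shows "smooth_on UNIV W (f :: real \<Rightarrow> real)"
proof (rule smooth_on_closed_family[OF _ _ f])
  fix f assume f: "f \<in> F"
  obtain f' where f': "f' \<in> F" "\<And>x. x \<in> W \<Longrightarrow> (f has_real_derivative f' x) (at x)" using F[OF f] by blast
  then have d: "(f has_derivative (*) (f' x)) (at x within W)" if "x \<in> W" for x
    using that unfolding has_field_derivative_def by (meson has_derivative_at_withinI)
  show "f differentiable_on W" using d by (auto simp: differentiable_on_def intro: differentiableI)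
  \<comment> \<open>The derivative in direction \<open>v\<close> is \<open>v\<close> times the
    ordinary one; this is why the family is required to be closed under scalar multiples.\<close>
  fix v :: real
  have "\<forall>x\<in>W. dirderiv W v f x = v * f' x"
    using dirderiv_eq[OF open_in_subspace_UNIV[OF W] _ d, of _ v] by (auto simp: mult.commute)
  then show "\<exists>g\<in>F. \<forall>x\<in>W. dirderiv W v f x = g x"
    by (rule bexI[where x="\<lambda>x. v * f' x"]) (rule sc[OF f'(1), of v])
qed

lemma smooth_on_real_inverse: "smooth_on UNIV (- {0::real}) inverse"
proof (rule smooth_on_real_family[where F = "{\<lambda>x. c * inverse x ^ n | c n. True}"])
  fix f :: "real \<Rightarrow> real" assume "f \<in> {\<lambda>x. c * inverse x ^ n | c n. True}"
  then obtain c n where f: "f = (\<lambda>x. c * inverse x ^ n)" by auto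
  have "(f has_real_derivative (- (c * n)) * inverse x ^ (Suc n)) (at x)" if "x \<in> - {0}" for x
  proof (cases n)
    case (Suc m)
    have "x \<noteq> 0" using that by simp
    then have "((\<lambda>x. c * inverse x ^ Suc m) has_real_derivative
        c * ((1 + real m) * (- (inverse x ^ Suc (Suc 0)) * inverse x ^ m))) (at x)"
      by (intro DERIV_cmult DERIV_power_Suc DERIV_inverse)
    then show ?thesis unfolding f Suc by (simp add: algebra_simps)
  qed (simp add: f)
  then have "\<forall>x\<in>- {0}. (f has_real_derivative (- (c * n)) * inverse x ^ (Suc n)) (at x)" by blast
  then show "\<exists>f'\<in>{\<lambda>x. c * inverse x ^ n | c n. True}. \<forall>x\<in>- {0}. (f has_real_derivative f' x) (at x)"
    by (rule bexI[where x="\<lambda>x. (- (c * n)) * inverse x ^ (Suc n)"]) (rule CollectI, rule exI[of _ "- (c * n)"], rule exI[of _ "Suc n"], simp)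
next
  show "(inverse :: real \<Rightarrow> real) \<in> {\<lambda>x. c * inverse x ^ n | c n. True}"
    by (intro CollectI exI[of _ "1::real"] exI[of _ "1::nat"]) auto
next
  fix f :: "real \<Rightarrow> real" and d assume "f \<in> {\<lambda>x. c * inverse x ^ n | c n. True}"
  then obtain c n where f: "f = (\<lambda>x. c * inverse x ^ n)" by auto
  show "(\<lambda>x. d * f x) \<in> {\<lambda>x. c * inverse x ^ n | c n. True}"
    unfolding f by (rule CollectI, rule exI[of _ "d * c"], rule exI[of _ n]) (simp add: mult.assoc)
qed auto

lemma smooth_on_inverse:
  fixes f :: "'e::euclidean_space \<Rightarrow> real"
  assumes "open_in_subspace S W" "smooth_on S W f" "\<And>x. x \<in> W \<Longrightarrow> f x \<noteq> 0"
  shows "smooth_on S W (\<lambda>x. inverse (f x))"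
  by (rule smooth_on_compose[OF assms(1) open_in_subspace_UNIV[of "- {0}"] _ assms(2) smooth_on_real_inverse])
     (use assms(3) in auto)

lemma smooth_on_power:
  fixes f :: "'e::euclidean_space \<Rightarrow> real"
  shows "open_in_subspace S W \<Longrightarrow> smooth_on S W f \<Longrightarrow> smooth_on S W (\<lambda>x. f x ^ n)"
  by (induction n) (auto simp: smooth_on_const intro: smooth_on_mult)

section \<open>Flat functions and bump functions\<close>

lemma poly_times_exp_tendsto_0: "((\<lambda>x. poly p x * exp (- x)) \<longlongrightarrow> (0::real)) at_top"
proof -
  have "((\<lambda>x. \<Sum>i\<le>degree p. coeff p i * (x ^ i / exp x)) \<longlongrightarrow> (\<Sum>i\<le>degree p. coeff p i * 0)) at_top"
    by (intro tendsto_sum tendsto_mult tendsto_const tendsto_power_div_exp_0)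
  then show ?thesis
    by (simp add: poly_altdef exp_minus sum_distrib_right sum_distrib_left divide_inverse mult.assoc)
qed

text \<open>The function exp(-1/x) continued by zero, with a polynomial factor in 1/x that makes the
  family closed under differentiation.\<close>

definition flat_exp :: "real poly \<Rightarrow> real \<Rightarrow> real" where
  "flat_exp p x = (if x > 0 then poly p (1 / x) * exp (- (1 / x)) else 0)"

text \<open>With t = 1/x one has d/dx = - t^2 d/dt, and - t^2 d/dt (p(t) exp(-t)) = t^2 (p(t) -
  p'(t)) exp(-t); the factor t^2 is \<open>[:0, 0, 1:]\<close>. At the origin exponential decay
  beats every polynomial.\<close>

lemma flat_exp_deriv:
  "(flat_exp p has_real_derivative flat_exp ([:0, 0, 1:] * (p - pderiv p)) x) (at x)"
proof -
  let ?q = "[:0, 0, 1:] * (p - pderiv p)"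
  consider "x > 0" | "x < 0" | "x = 0" by linarith
  then show ?thesis
  proof cases
    case 1
    have "((\<lambda>x. poly p (1 / x) * exp (- (1 / x))) has_real_derivative flat_exp ?q x) (at x)"
      using 1 by (auto intro!: derivative_eq_intros simp: flat_exp_def field_simps power2_eq_square)
    then show ?thesis
      by (rule DERIV_cong_ev[THEN iffD1, rotated -1])
         (use 1 in \<open>auto simp: flat_exp_def eventually_nhds intro!: exI[of _ "{0<..}"]\<close>)
  next
    case 2
    have "((\<lambda>x. 0) has_real_derivative flat_exp ?q x) (at x)" using 2 by (simp add: flat_exp_def)
    then show ?thesis
      by (rule DERIV_cong_ev[THEN iffD1, rotated -1])
         (use 2 in \<open>auto simp: flat_exp_def eventually_nhds intro!: exI[of _ "{..<0}"]\<close>)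
  next
    case 3
    \<comment> \<open>The difference quotient at 0 contributes one more factor 1/x, hence
      \<open>[:0,1:] * p\<close>.\<close>
    have "((\<lambda>x. poly ([:0,1:] * p) (1 / x) * exp (- (1 / x))) \<longlongrightarrow> 0) (at_right 0)"
      by (rule filterlim_compose[OF poly_times_exp_tendsto_0])
         (simp add: filterlim_inverse_at_top_right inverse_eq_divide[symmetric])
    then have r: "((\<lambda>h. (flat_exp p (0 + h) - flat_exp p 0) / h) \<longlongrightarrow> 0) (at_right 0)"
      by (rule Lim_transform_eventually)
         (auto simp: flat_exp_def eventually_at_right_less field_simps intro!: eventually_mono[OF eventually_at_right_less])
    have l: "((\<lambda>h. (flat_exp p (0 + h) - flat_exp p 0) / h) \<longlongrightarrow> 0) (at_left 0)"
      by (rule Lim_transform_eventually[OF tendsto_const])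
         (auto simp: flat_exp_def eventually_at_left_field intro!: exI[of _ "-1"])
    have "((\<lambda>h. (flat_exp p (0 + h) - flat_exp p 0) / h) \<longlongrightarrow> 0) (at 0)"
      by (rule filterlim_split_at[OF l r])
    then show ?thesis unfolding 3 DERIV_def by (simp add: flat_exp_def)
  qed
qed

lemma smooth_flat_exp: "smooth_on UNIV UNIV (flat_exp p)"
proof (rule smooth_on_real_family[where F = "range flat_exp"])
  show "\<exists>f'\<in>range flat_exp. \<forall>x\<in>UNIV. (f has_real_derivative f' x) (at x)" if "f \<in> range flat_exp" for f
    using that flat_exp_deriv by blast
  show "(\<lambda>x. c * f x) \<in> range flat_exp" if f: "f \<in> range flat_exp" for f c
  proof -
    obtain p where "f = flat_exp p" using f by auto
    then have "(\<lambda>x. c * f x) = flat_exp (smult c p)" by (auto simp: flat_exp_def)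
    then show ?thesis by blast
  qed
qed auto

text \<open>The quotient h(b - x) / (h(b - x) + h(x - a)) with h flat at 0. Its denominator never
  vanishes, because every x satisfies x < b or x > a.\<close>

lemma smooth_bump_real:
  assumes "a < b"
  obtains \<beta> :: "real \<Rightarrow> real" where "smooth_on UNIV UNIV \<beta>" "\<And>x. x \<le> a \<Longrightarrow> \<beta> x = 1" "\<And>x. x \<ge> b \<Longrightarrow> \<beta> x = 0"
proof
  let ?h = "flat_exp 1"
  have pos: "?h x > 0" if "x > 0" for x using that by (simp add: flat_exp_def)
  have nn: "?h x \<ge> 0" for x by (simp add: flat_exp_def)
  have z: "?h x = 0" if "x \<le> 0" for x using that by (simp add: flat_exp_def)
  let ?d = "\<lambda>x. ?h (b - x) + ?h (x - a)"
  have d: "?d x \<noteq> 0" for x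
  proof (cases "x < b")
    case True
    then show ?thesis using pos[of "b - x"] nn[of "x - a"] by simp
  next
    case False
    then show ?thesis using pos[of "x - a"] nn[of "b - x"] assms by simp
  qed
  have U: "open_in_subspace UNIV (UNIV :: real set)" by (simp add: open_in_subspace_UNIV)
  have s: "smooth_on UNIV UNIV (\<lambda>x. ?h (b - x))" "smooth_on UNIV UNIV (\<lambda>x. ?h (x - a))"
    by (rule smooth_on_compose[OF U U _ _ smooth_flat_exp];
        auto intro!: smooth_on_diff smooth_on_const smooth_on_id U)+
  show "smooth_on UNIV UNIV (\<lambda>x. ?h (b - x) * inverse (?d x))"
    by (intro smooth_on_mult smooth_on_inverse smooth_on_add U s d)
  show "?h (b - x) * inverse (?d x) = 1" if "x \<le> a" for x
    using z[of "x - a"] d[of x] that by simp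
  show "?h (b - x) * inverse (?d x) = 0" if "x \<ge> b" for x
    using z[of "b - x"] that by simp
qed

text \<open>The cut-off is applied to the squared distance, which is smooth at the centre too; so it
  is built for the thresholds \<open>r\<^sup>2\<close> and \<open>s\<^sup>2\<close>.\<close>

lemma smooth_bump:
  fixes e :: "'e::euclidean_space"
  assumes "0 < r" "r < s"
  obtains \<rho> :: "'e \<Rightarrow> real" where "\<And>S W. open_in_subspace S W \<Longrightarrow> smooth_on S W \<rho>"
    "\<And>x. dist e x \<le> r \<Longrightarrow> \<rho> x = 1" "\<And>x. dist e x \<ge> s \<Longrightarrow> \<rho> x = 0"
proof -
  obtain \<beta> :: "real \<Rightarrow> real" where b: "smooth_on UNIV UNIV \<beta>" "\<And>x. x \<le> r\<^sup>2 \<Longrightarrow> \<beta> x = 1" "\<And>x. x \<ge> s\<^sup>2 \<Longrightarrow> \<beta> x = 0"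
    using smooth_bump_real[of "r\<^sup>2" "s\<^sup>2"] assms by (metis less_eq_real_def power_strict_mono zero_less_numeral)
  show thesis
  proof
    fix S W :: "'e set" assume W: "open_in_subspace S W"
    show "smooth_on S W (\<lambda>x. \<beta> ((x - e) \<bullet> (x - e)))"
      by (rule smooth_on_compose[OF W open_in_subspace_UNIV[OF open_UNIV] _ _ b(1)])
         (auto intro!: smooth_on_bilinear[OF W bounded_bilinear_inner] smooth_on_diff smooth_on_id smooth_on_const W)
  next
    fix x :: 'e
    have *: "(x - e) \<bullet> (x - e) = (dist e x)\<^sup>2" by (simp add: dist_norm power2_norm_eq_inner norm_minus_commute[of e])
    show "\<beta> ((x - e) \<bullet> (x - e)) = 1" if "dist e x \<le> r" unfolding * by (rule b(2)) (simp add: that power_mono)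
    show "\<beta> ((x - e) \<bullet> (x - e)) = 0" if "dist e x \<ge> s" unfolding * by (rule b(3)) (use that assms in \<open>simp add: power_mono\<close>)
  qed
qed

section \<open>The inverse function theorem\<close>

text \<open>At a zero of \<open>u\<close> the product rule asks only for continuity of
  \<open>h\<close>: since \<open>u z\<close> is of order |z - y|, the error
  \<open>p (h z - h y) (u z)\<close> is of smaller order. This allows an operator inverse to be
  differentiated when only its continuity is known.\<close>

lemma has_derivative_bilinear_null:
  assumes p: "bounded_bilinear p" and u: "(u has_derivative u') (at y within W)" and u0: "u y = 0"
    and h: "continuous (at y within W) h"
  shows "((\<lambda>z. p (h z) (u z)) has_derivative (\<lambda>v. p (h y) (u' v))) (at y within W)"
proof -
  interpret p: bounded_bilinear p by fact
  obtain K where K: "K > 0" "\<And>a b. norm (p a b) \<le> norm a * norm b * K" using p.pos_bounded by blast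
  have bl: "bounded_linear u'" using u has_derivative_bounded_linear by blast
  have "((\<lambda>z. p (h z - h y) (u z)) has_derivative (\<lambda>v. 0)) (at y within W)"
    unfolding has_derivative_iff_norm
  proof (intro conjI bounded_linear_zero)
    let ?g = "\<lambda>z. norm (h z - h y) * (norm (u z - u y - u' (z - y)) / norm (z - y) + onorm u') * K"
    have "((\<lambda>z. norm (u z - u y - u' (z - y)) / norm (z - y)) \<longlongrightarrow> 0) (at y within W)"
      using u unfolding has_derivative_iff_norm by blast
    moreover have "((\<lambda>z. norm (h z - h y)) \<longlongrightarrow> 0) (at y within W)"
      using h unfolding continuous_within by (simp add: LIM_zero tendsto_norm_zero)
    ultimately have "(?g \<longlongrightarrow> 0 * (0 + onorm u') * K) (at y within W)"
      by (intro tendsto_intros)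
    then have g: "(?g \<longlongrightarrow> 0) (at y within W)" by simp
    show "((\<lambda>z. norm (p (h z - h y) (u z) - p (h y - h y) (u y) - 0) / norm (z - y)) \<longlongrightarrow> 0) (at y within W)"
    proof (rule Lim_null_comparison[OF _ g], rule always_eventually, rule allI)
      fix z
      show "norm (norm (p (h z - h y) (u z) - p (h y - h y) (u y) - 0) / norm (z - y)) \<le> ?g z"
      proof (cases "z = y")
        case False
        have "norm (u z) \<le> norm (u z - u y - u' (z - y)) + norm (u' (z - y))"
          using norm_triangle_sub[of "u z" "u' (z - y)"] u0 by simp
        also have "norm (u' (z - y)) \<le> onorm u' * norm (z - y)" by (rule onorm[OF bl])
        finally have "norm (u z) / norm (z - y) \<le> norm (u z - u y - u' (z - y)) / norm (z - y) + onorm u'"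
          using False by (simp add: field_simps)
        then have "norm (h z - h y) * (norm (u z) / norm (z - y)) * K \<le> ?g z"
          using K by (intro mult_right_mono mult_left_mono) auto
        moreover have "norm (p (h z - h y) (u z)) / norm (z - y) \<le> norm (h z - h y) * (norm (u z) / norm (z - y)) * K"
          using divide_right_mono[OF K(2)[of "h z - h y" "u z"], of "norm (z - y)"] by (simp add: field_simps)
        ultimately show ?thesis using u0 by (simp add: p.zero_right)
      qed (use K onorm_pos_le[OF bl] in \<open>simp add: p.zero_left u0\<close>)
    qed
  qed
  moreover have "((\<lambda>z. p (h y) (u z)) has_derivative (\<lambda>v. p (h y) (u' v))) (at y within W)"
    by (rule bounded_linear.has_derivative[OF p.bounded_linear_right u])
  ultimately have "((\<lambda>z. p (h y) (u z) + p (h z - h y) (u z)) has_derivative (\<lambda>v. p (h y) (u' v) + 0)) (at y within W)"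
    by (rule has_derivative_add[rotated])
  then show ?thesis by (simp add: p.diff_left)
qed

text \<open>Everything comes from the resolvent identity \<open>eq\<close>. It yields continuity of
  \<open>I\<close>, then the derivative - I A' I, and as this involves \<open>I\<close> itself
  undifferentiated, regularity of \<open>A\<close> passes to \<open>I\<close> one order at a
  time.\<close>

lemma Cdiff_blinfun_inverse:
  fixes A I :: "'e::euclidean_space \<Rightarrow> ('a::real_normed_vector \<Rightarrow>\<^sub>L 'a)"
  assumes W: "open_in_subspace S W" and A: "Cdiff k S W A"
    and inv: "\<And>x v. x \<in> W \<Longrightarrow> blinfun_apply (A x) (blinfun_apply (I x) v) = v"
      "\<And>x v. x \<in> W \<Longrightarrow> blinfun_apply (I x) (blinfun_apply (A x) v) = v"
  shows "Cdiff k S W I"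
proof -
  have eq: "I z - I y = - (I z o\<^sub>L ((A z - A y) o\<^sub>L I y))" if "z \<in> W" "y \<in> W" for z y
    by (rule blinfun_eqI) (simp add: inv that blinfun.diff_left blinfun.diff_right blinfun.minus_left)
  have cont: "continuous_on W I"
    unfolding continuous_on_eq_continuous_within
  proof
    fix y assume y: "y \<in> W"
    have cA: "(A \<longlongrightarrow> A y) (at y within W)"
      using Cdiff_continuous[OF A] y by (auto simp: continuous_on_def)
    then have nA: "((\<lambda>z. norm (A z - A y)) \<longlongrightarrow> 0) (at y within W)"
      by (simp add: LIM_zero tendsto_norm_zero)
    have "((\<lambda>z. norm (A z - A y) * norm (I y)) \<longlongrightarrow> 0 * norm (I y)) (at y within W)"
      by (intro tendsto_mult nA tendsto_const)
    \<comment> \<open>Once this product is below 1/2, the resolvent identity bounds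
      \<open>norm (I z)\<close> by \<open>2 * norm (I y)\<close>; without such a bound it would
      estimate \<open>I z\<close> by itself.\<close>
    then have ev: "\<forall>\<^sub>F z in at y within W. norm (A z - A y) * norm (I y) < 1 / 2"
      by (rule order_tendstoD) simp
    have inW: "\<forall>\<^sub>F z in at y within W. z \<in> W" by (simp add: eventually_at_filter)
    have "\<forall>\<^sub>F z in at y within W. norm (I z - I y) \<le> 2 * norm (I y) * (norm (A z - A y) * norm (I y))"
      using ev inW
    proof eventually_elim
      case (elim z)
      have "norm (I z - I y) \<le> norm (I z) * norm ((A z - A y) o\<^sub>L I y)"
        unfolding eq[OF elim(2) y] norm_minus_cancel by (rule norm_blinfun_compose)
      also have "\<dots> \<le> norm (I z) * (norm (A z - A y) * norm (I y))"
        by (intro mult_left_mono norm_blinfun_compose) simp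
      finally have 1: "norm (I z - I y) \<le> norm (I z) * (norm (A z - A y) * norm (I y))" .
      also have "\<dots> \<le> norm (I z) * (1 / 2)" using elim(1) by (intro mult_left_mono) auto
      finally have "norm (I z) \<le> 2 * norm (I y)"
        using norm_triangle_ineq2[of "I z" "I y"] by simp
      then have "norm (I z) * (norm (A z - A y) * norm (I y)) \<le> 2 * norm (I y) * (norm (A z - A y) * norm (I y))"
        by (intro mult_right_mono) auto
      with 1 show ?case by linarith
    qed
    moreover have "((\<lambda>z. 2 * norm (I y) * (norm (A z - A y) * norm (I y))) \<longlongrightarrow> 2 * norm (I y) * (0 * norm (I y))) (at y within W)"
      by (intro tendsto_intros nA)
    then have "((\<lambda>z. 2 * norm (I y) * (norm (A z - A y) * norm (I y))) \<longlongrightarrow> 0) (at y within W)"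
      by simp
    ultimately have "((\<lambda>z. I z - I y) \<longlongrightarrow> 0) (at y within W)"
      by (rule Lim_null_comparison)
    then show "continuous (at y within W) I" unfolding continuous_within by (rule LIM_zero_cancel)
  qed
  show ?thesis using A
  proof (induction k)
    case 0
    then show ?case using cont by simp
  next
    case (Suc k)
    note DA = Cdiff_SucD[OF Suc.prems]
    let ?DA = "\<lambda>x. frechet_derivative A (at x within W)"
    have CI: "Cdiff k S W I" using Suc.IH[OF Cdiff_Suc_mono[OF Suc.prems]] .
    show ?case
    proof (rule Cdiff_SucI[OF W, where f'="\<lambda>y v. - (I y o\<^sub>L (?DA y v o\<^sub>L I y))"])
      fix y assume y: "y \<in> W"
      have lin: "bounded_linear (\<lambda>M. M o\<^sub>L I y)"
        by (rule bounded_bilinear.bounded_linear_left[OF bounded_bilinear_blinfun_compose])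
      \<comment> \<open>The resolvent identity is differentiated at z = y, where its middle factor
        vanishes, so that the outer factor \<open>I z\<close> need only be continuous.\<close>
      have "((\<lambda>z. A z - A y) has_derivative ?DA y) (at y within W)"
        using DA(1)[OF y] by (auto intro!: derivative_eq_intros)
      then have "((\<lambda>z. (A z - A y) o\<^sub>L I y) has_derivative (\<lambda>v. ?DA y v o\<^sub>L I y)) (at y within W)"
        by (rule bounded_linear.has_derivative[OF lin])
      then have "((\<lambda>z. I z o\<^sub>L ((A z - A y) o\<^sub>L I y)) has_derivative (\<lambda>v. I y o\<^sub>L (?DA y v o\<^sub>L I y))) (at y within W)"
        by (rule has_derivative_bilinear_null[OF bounded_bilinear_blinfun_compose])
           (use cont y in \<open>auto simp: continuous_on_eq_continuous_within bounded_bilinear.zero_left[OF bounded_bilinear_blinfun_compose]\<close>)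
      then have "((\<lambda>z. - (I z o\<^sub>L ((A z - A y) o\<^sub>L I y)) + I y) has_derivative (\<lambda>v. - (I y o\<^sub>L (?DA y v o\<^sub>L I y)) + 0)) (at y within W)"
        by (intro has_derivative_add has_derivative_minus has_derivative_const)
      then have "((\<lambda>z. - (I z o\<^sub>L ((A z - A y) o\<^sub>L I y)) + I y) has_derivative (\<lambda>v. - (I y o\<^sub>L (?DA y v o\<^sub>L I y)))) (at y within W)"
        by simp
      then show "(I has_derivative (\<lambda>v. - (I y o\<^sub>L (?DA y v o\<^sub>L I y)))) (at y within W)"
        by (rule has_derivative_transform[OF y, rotated]) (use eq y in \<open>auto simp: algebra_simps\<close>)
    next
      fix v assume v: "v \<in> S"
      have "Cdiff k S W (\<lambda>x. I x o\<^sub>L (?DA x v o\<^sub>L I x))"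
        by (intro Cdiff_bilinear[OF W bounded_bilinear_blinfun_compose] CI DA(2)[OF v])
      then show "Cdiff k S W (\<lambda>x. - (I x o\<^sub>L (?DA x v o\<^sub>L I x)))"
        by (rule Cdiff_linear[OF W bounded_linear_minus[OF bounded_linear_ident]])
    qed
  qed
qed

text \<open>The inverse function theorem makes \<open>g\<close> differentiable with derivative the
  inverse of Df at \<open>g y\<close>. If \<open>g\<close> has k continuous derivatives, so has this
  expression by \<open>Cdiff_blinfun_inverse\<close>, and \<open>g\<close> gains one order.\<close>

lemma smooth_inverse_UNIV:
  fixes f :: "'a::euclidean_space \<Rightarrow> 'a"
  assumes \<Omega>: "open \<Omega>" and f: "smooth_on UNIV \<Omega> f" and x0: "x0 \<in> \<Omega>"
    and D: "(f has_derivative (\<lambda>x. x)) (at x0)"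
  obtains U V g where "open U" "U \<subseteq> \<Omega>" "x0 \<in> U" "open V" "f x0 \<in> V" "homeomorphism U V f g"
    "smooth_on UNIV V g"
proof -
  have R: "open_in_subspace UNIV \<Omega>" using \<Omega> open_in_subspace_UNIV by blast
  \<comment> \<open>The derivative of \<open>f\<close> assembled from its directional derivatives
    along \<open>Basis\<close>; in this form its smoothness as an operator-valued map is
    evident.\<close>
  define F where "F = (\<lambda>x. \<Sum>b\<in>Basis. blinfun_scaleR_left (frechet_derivative f (at x within \<Omega>) b) o\<^sub>L blinfun_inner_right (b::'a))"
  have smF: "smooth_on UNIV \<Omega> F"
    unfolding F_def
    by (intro smooth_on_sum[OF R] smooth_on_bilinear[OF R bounded_bilinear_blinfun_compose] smooth_on_const[OF R]
      smooth_on_linear[OF R bounded_linear_blinfun_scaleR_left] smooth_on_dirderiv[OF f] UNIV_I)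
  have derW: "(f has_derivative frechet_derivative f (at x within \<Omega>)) (at x)" if "x \<in> \<Omega>" for x
    using smooth_on_has_derivative[OF f that] by (metis \<Omega> at_within_open that)
  have F: "blinfun_apply (F x) = frechet_derivative f (at x within \<Omega>)" if "x \<in> \<Omega>" for x
  proof
    fix v
    have lin: "linear (frechet_derivative f (at x within \<Omega>))" using derW[OF that] has_derivative_linear by blast
    have "blinfun_apply (F x) v = (\<Sum>b\<in>Basis. (b \<bullet> v) *\<^sub>R frechet_derivative f (at x within \<Omega>) b)"
      by (simp add: F_def blinfun.sum_left)
    also have "\<dots> = frechet_derivative f (at x within \<Omega>) (\<Sum>b\<in>Basis. (b \<bullet> v) *\<^sub>R b)"
      by (simp add: linear_sum[OF lin] linear_scale[OF lin])
    finally show "blinfun_apply (F x) v = frechet_derivative f (at x within \<Omega>) v"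
      by (simp add: inner_commute[of _ v] euclidean_representation)
  qed
  have derF: "(f has_derivative blinfun_apply (F x)) (at x)" if "x \<in> \<Omega>" for x
    using derW[OF that] F[OF that] by simp
  have "blinfun_apply (F x0) = (\<lambda>x. x)" using has_derivative_unique[OF derF[OF x0] D] .
  then have "id_blinfun o\<^sub>L F x0 = id_blinfun" by (intro blinfun_eqI) simp
  then obtain U V g g' where UV: "open U" "U \<subseteq> \<Omega>" "x0 \<in> U" "open V" "f x0 \<in> V" "homeomorphism U V f g"
    and g: "\<And>y. y \<in> V \<Longrightarrow> (g has_derivative (g' y)) (at y)"
    "\<And>y. y \<in> V \<Longrightarrow> g' y = inv_into UNIV (blinfun_apply (F (g y)))"
    "\<And>y. y \<in> V \<Longrightarrow> bij (blinfun_apply (F (g y)))"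
    using inverse_function_theorem[OF \<Omega> derF smooth_on_continuous[OF smF] x0] by metis
  have gV: "g y \<in> \<Omega>" if "y \<in> V" for y using UV(2,6) that unfolding homeomorphism_def by blast
  have RV: "open_in_subspace UNIV V" using UV(4) open_in_subspace_UNIV by blast
  define I where "I = (\<lambda>y. Blinfun (g' y))"
  have I: "blinfun_apply (I y) = g' y" if "y \<in> V" for y
    unfolding I_def by (rule bounded_linear_Blinfun_apply) (use g(1)[OF that] has_derivative_bounded_linear in blast)
  have "Cdiff k UNIV V g" for k
  proof (induction k)
    case 0
    then show ?case using UV(6) by (simp add: homeomorphism_def)
  next
    case (Suc k)
    have "Cdiff k UNIV V (\<lambda>y. F (g y))"
      by (rule Cdiff_compose[OF RV R _ Suc]) (use gV smF in \<open>auto simp: smooth_on_Cdiff_iff\<close>)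
    then have "Cdiff k UNIV V I"
      by (rule Cdiff_blinfun_inverse[OF RV])
         (simp_all add: I g(2) g(3)[THEN bij_is_surj, THEN surj_f_inv_f] g(3)[THEN bij_is_inj, THEN inv_f_f])
    then have "Cdiff k UNIV V (\<lambda>y. blinfun_apply (I y) v)" for v
      by (rule Cdiff_linear[OF RV bounded_bilinear.bounded_linear_left[OF bounded_bilinear_blinfun_apply]])
    then have "Cdiff k UNIV V (\<lambda>y. g' y v)" for v
      by (rule Cdiff_cong_imp) (simp add: I)
    then show ?case
      by (intro Cdiff_SucI[OF RV has_derivative_at_withinI[OF g(1)]])
  qed
  then have "smooth_on UNIV V g" by (simp add: smooth_on_Cdiff_iff)
  then show ?thesis using that UV by blast
qed

text \<open>\<open>S1\<close> and \<open>S2\<close> may be proper subspaces of different spaces.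
  With \<open>P\<close> a projection onto \<open>S1\<close> and \<open>A\<close> a left inverse of
  \<open>D\<close> with values in \<open>S1\<close>, the map A f P + (id - P) acts on one full space
  and has the identity as derivative at \<open>x0\<close>. If \<open>G\<close> inverts it locally,
  then \<open>G\<close> after \<open>A\<close> inverts \<open>f\<close>, as \<open>A\<close> is
  injective on \<open>S2\<close>.\<close>

lemma smooth_inverse_rel:
  fixes f :: "'a::euclidean_space \<Rightarrow> 'b::euclidean_space"
  assumes W1: "open_in_subspace S1 W1" and S2: "subspace S2" and f: "smooth_on S1 W1 f" and im: "f ` W1 \<subseteq> S2"
    and x0: "x0 \<in> W1" and D: "(f has_derivative D) (at x0 within W1)"
    and inj: "inj_on D S1" and onto: "D ` S1 = S2"
  obtains W V g where "open_in_subspace S1 W" "W \<subseteq> W1" "x0 \<in> W" "open_in_subspace S2 V" "homeomorphism W V f g" "smooth_on S2 V g"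
proof -
  have S1: "subspace S1" and W1S: "W1 \<subseteq> S1" using open_in_subspaceD[OF W1] by auto
  obtain P where P: "bounded_linear P" "\<And>x. P x \<in> S1" "\<And>x. x \<in> S1 \<Longrightarrow> P x = x"
    using orthogonal_projection[OF S1] by blast
  have Dlin: "linear D" using D has_derivative_linear by blast
  obtain A where A: "range A \<subseteq> S1" "linear A" "\<And>v. v \<in> S1 \<Longrightarrow> A (D v) = v"
    using linear_exists_left_inverse_on[OF Dlin S1 inj] by blast
  have Ab: "bounded_linear A" using A(2) linear_conv_bounded_linear by blast
  have Ainj: "y = y'" if "A y = A y'" "y \<in> S2" "y' \<in> S2" for y y'
    using that A(3) onto by (metis imageE)
  define \<Omega> where "\<Omega> = P -` W1"
  obtain U0 where U0: "open U0" "W1 = S1 \<inter> U0" using open_in_subspaceD(2)[OF W1] by (auto simp: openin_open)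
  have "\<Omega> = P -` U0" unfolding \<Omega>_def U0(2) using P(2) by auto
  then have \<Omega>: "open \<Omega>" using open_vimage[OF U0(1)] linear_continuous_on[OF P(1)] by auto
  have R: "open_in_subspace UNIV \<Omega>" using open_in_subspace_UNIV[OF \<Omega>] .
  \<comment> \<open>an extension of \<open>f\<close> to the ambient space with invertible derivative\<close>
  define F where "F = (\<lambda>x. A (f (P x)) + (x - P x))"
  have fP: "smooth_on UNIV \<Omega> (\<lambda>x. f (P x))"
    by (rule smooth_on_compose[OF R W1 _ smooth_on_linear_map[OF R P(1)] f]) (auto simp: \<Omega>_def)
  have F: "smooth_on UNIV \<Omega> F"
    unfolding F_def
    by (intro smooth_on_add smooth_on_diff smooth_on_linear[OF R Ab] smooth_on_linear_map[OF R P(1)] smooth_on_id R fP)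
  have x0P: "P x0 = x0" using P(3) x0 W1S by auto
  have x0\<Omega>: "x0 \<in> \<Omega>" using x0 x0P by (simp add: \<Omega>_def)
  have "((\<lambda>x. f (P x)) has_derivative (\<lambda>v. D (P v))) (at x0 within \<Omega>)"
    by (rule has_derivative_in_compose[OF bounded_linear_imp_has_derivative[OF P(1)]])
       (use D x0P has_derivative_subset[of f D x0 W1 "P ` \<Omega>"] in \<open>auto simp: \<Omega>_def\<close>)
  then have "((\<lambda>x. f (P x)) has_derivative (\<lambda>v. D (P v))) (at x0)"
    using at_within_open[OF x0\<Omega> \<Omega>] by simp
  then have "(F has_derivative (\<lambda>v. A (D (P v)) + (v - P v))) (at x0)"
    unfolding F_def
    by (intro has_derivative_add has_derivative_diff bounded_linear.has_derivative[OF Ab]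
        has_derivative_ident bounded_linear_imp_has_derivative[OF P(1)])
  then have DF: "(F has_derivative (\<lambda>v. v)) (at x0)" using A(3) P(2) by simp
  obtain U V G where UV: "open U" "U \<subseteq> \<Omega>" "x0 \<in> U" "open V" "F x0 \<in> V" "homeomorphism U V F G" "smooth_on UNIV V G"
    using smooth_inverse_UNIV[OF \<Omega> F x0\<Omega> DF] by blast
  have FW: "F x = A (f x)" if "x \<in> S1" for x using P(3)[OF that] by (simp add: F_def)
  define W where "W = S1 \<inter> U"
  define V2 where "V2 = {y \<in> S2. A y \<in> V}"
  have WW1: "W \<subseteq> W1" using UV(2) P(3) unfolding W_def \<Omega>_def by fastforce
  have RW: "open_in_subspace S1 W" unfolding open_in_subspace_def W_def using S1 UV(1) by (simp add: openin_open_Int)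
  have RV: "open_in_subspace S2 V2"
    unfolding V2_def open_in_subspace_def
  proof (intro conjI S2)
    have "{y \<in> S2. A y \<in> V} = S2 \<inter> A -` V" by auto
    then show "openin (top_of_set S2) {y \<in> S2. A y \<in> V}"
      using open_vimage[OF UV(4) linear_continuous_on[OF Ab, of UNIV]] by (simp add: openin_open_Int)
  qed
  let ?g = "\<lambda>y. G (A y)"
  have fW: "f x \<in> V2 \<and> ?g (f x) = x" if "x \<in> W" for x
  proof -
    have "x \<in> S1" "x \<in> U" "x \<in> W1" using that WW1 W_def by auto
    then have "A (f x) \<in> V" "G (A (f x)) = x" "f x \<in> S2"
      using FW[of x] UV(6) im unfolding homeomorphism_def by (metis image_eqI, metis, blast)
    then show ?thesis unfolding V2_def by simp
  qed
  have gV: "?g y \<in> W \<and> f (?g y) = y" if "y \<in> V2" for y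
  proof -
    have y: "y \<in> S2" "A y \<in> V" using that V2_def by auto
    then have x: "?g y \<in> U" "F (?g y) = A y" using UV(6) unfolding homeomorphism_def by auto
    let ?x = "?g y"
    \<comment> \<open>\<open>F\<close> changes a point only by vectors of \<open>S1\<close>, so a
      preimage of a point of \<open>S1\<close> lies in \<open>S1\<close>.\<close>
    have "?x = (F ?x - A (f (P ?x))) + P ?x" by (simp add: F_def)
    also have "\<dots> \<in> S1"
      unfolding x(2) using A(1) P(2) S1 by (intro subspace_add subspace_diff) auto
    finally have xS: "?x \<in> S1" .
    then have xW: "?x \<in> W" using x(1) W_def by simp
    have "A (f ?x) = A y" using FW[OF xS] x(2) by simp
    then have "f ?x = y" using Ainj y(1) im WW1 xW by blast
    then show ?thesis using xW by simp
  qed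
  have g: "smooth_on S2 V2 ?g"
    by (rule smooth_on_compose[OF RV open_in_subspace_UNIV[OF UV(4)] _ smooth_on_linear_map[OF RV Ab] UV(7)])
       (auto simp: V2_def)
  have "homeomorphism W V2 f ?g"
    using fW gV by (intro homeomorphismI smooth_on_continuous[OF g]
      continuous_on_subset[OF smooth_on_continuous[OF f] WW1]) auto
  then show ?thesis using that[OF RW WW1 _ RV _ g] UV(3) x0 W1S W_def by blast
qed

section \<open>Kernels, complements and ranks\<close>

lemma kernel_complement:
  fixes f :: "'a::euclidean_space \<Rightarrow> 'b::euclidean_space"
  assumes f: "linear f" and S: "subspace S"
  defines "N \<equiv> {x \<in> S. f x = 0}"
  defines "C \<equiv> {y \<in> S. \<forall>x\<in>N. orthogonal x y}"
  shows "subspace N" "subspace C" "C \<inter> N = {0}" "\<And>x. x \<in> S \<Longrightarrow> \<exists>y\<in>N. \<exists>z\<in>C. x = y + z"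
    "inj_on f C" "f ` C = f ` S" "dim C + dim N = dim S"
proof -
  show N: "subspace N"
    unfolding N_def using S f by (auto simp: subspace_def linear_0 linear_add linear_scale)
  show C: "subspace C"
    unfolding C_def using S by (auto simp: subspace_def orthogonal_clauses)
  show CN: "C \<inter> N = {0}"
  proof
    show "C \<inter> N \<subseteq> {0}"
    proof
      fix x assume "x \<in> C \<inter> N"
      then have "orthogonal x x" by (auto simp: C_def)
      then show "x \<in> {0}" by (simp add: orthogonal_self)
    qed
    show "{0} \<subseteq> C \<inter> N" using subspace_0[OF N] subspace_0[OF C] by simp
  qed
  show dec: "\<exists>y\<in>N. \<exists>z\<in>C. x = y + z" if x: "x \<in> S" for x
  proof -
    obtain y z where yz: "y \<in> span N" "\<And>w. w \<in> span N \<Longrightarrow> orthogonal z w" "x = y + z"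
      using orthogonal_subspace_decomp_exists[of N x] by blast
    have "y \<in> N" using yz(1) N by (simp add: span_eq_iff[THEN iffD2])
    moreover have "z \<in> S"
      using subspace_diff[OF S x, of y] \<open>y \<in> N\<close> yz(3) N_def by auto
    ultimately show ?thesis using yz(2,3) unfolding C_def
      by (intro bexI[of _ y] bexI[of _ z]) (auto simp: span_base orthogonal_commute)
  qed
  show "inj_on f C"
  proof (rule inj_onI)
    fix x y assume "x \<in> C" "y \<in> C" "f x = f y"
    then have "x - y \<in> C \<inter> N"
      using subspace_diff[OF C] linear_diff[OF f] by (auto simp: N_def C_def)
    then show "x = y" using CN by auto
  qed
  show "f ` C = f ` S"
  proof
    show "f ` C \<subseteq> f ` S" by (auto simp: C_def)
    show "f ` S \<subseteq> f ` C"
    proof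
      fix w assume "w \<in> f ` S"
      then obtain x where "x \<in> S" "w = f x" by auto
      then show "w \<in> f ` C" using dec[of x] linear_add[OF f] by (auto simp: N_def)
    qed
  qed
  show "dim C + dim N = dim S"
    unfolding C_def by (rule dim_subspace_orthogonal_to_vectors[OF N S]) (auto simp: N_def)
qed

lemma linear_inj_on_if_dim_le:
  fixes f :: "'a::euclidean_space \<Rightarrow> 'b::euclidean_space"
  assumes f: "linear f" and S: "subspace S" and d: "dim S \<le> dim (f ` S)"
  shows "inj_on f S"
proof -
  note K = kernel_complement[OF f S]
  have "dim (f ` S) \<le> dim {y \<in> S. \<forall>x\<in>{x \<in> S. f x = 0}. orthogonal x y}"
    unfolding K(6)[symmetric] by (rule dim_image_le[OF f])
  then have "dim {x \<in> S. f x = 0} = 0" using K(7) d by linarith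
  then have "{x \<in> S. f x = 0} \<subseteq> {0}" by (simp add: dim_eq_0)
  then have *: "x = 0" if "x \<in> S" "f x = 0" for x using that by blast
  show ?thesis
  proof (rule inj_onI)
    fix x y assume "x \<in> S" "y \<in> S" "f x = f y"
    then have "x - y = 0" by (intro * subspace_diff[OF S]) (simp_all add: linear_diff[OF f])
    then show "x = y" by simp
  qed
qed


text \<open>
  Where the rank of the derivative is maximal, it is locally constant.  If it were smaller than the
  dimension, \<open>f\<close> would be constant along some line of suitable coordinates, as in the constant rank
  theorem.
\<close>

lemma exists_injective_derivative:
  fixes f :: "'a::euclidean_space \<Rightarrow> 'b::euclidean_space"
  assumes W: "open_in_subspace S W" and ne: "W \<noteq> {}" and f: "smooth_on S W f" and inj: "inj_on f W"
  shows "\<exists>x\<in>W. inj_on (frechet_derivative f (at x within W)) S"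
proof (rule ccontr)
  assume contra: "\<not> ?thesis"
  let ?D = "\<lambda>x. frechet_derivative f (at x within W)"
  have S: "subspace S" using open_in_subspaceD(1)[OF W] .
  have der: "(f has_derivative ?D x) (at x within W)" if "x \<in> W" for x
    using smooth_on_has_derivative[OF f that] .
  have lin: "linear (?D x)" if "x \<in> W" for x using der[OF that] has_derivative_linear by blast
  define r where "r = (\<lambda>x. dim (?D x ` S))"
  have fin: "finite (r ` W)"
    by (rule finite_subset[of _ "{..DIM('b)}"]) (auto simp: r_def dim_subset_UNIV)
  \<comment> \<open>A point of maximal rank exists because ranks are bounded by the dimension of the
    target.\<close>
  obtain x0 where x0: "x0 \<in> W" "\<And>x. x \<in> W \<Longrightarrow> r x \<le> r x0"
  proof -
    have "Max (r ` W) \<in> r ` W" using fin ne by (intro Max_in) auto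
    then obtain x0 where "x0 \<in> W" "Max (r ` W) = r x0" by auto
    then show thesis using that[of x0] Max_ge[OF fin] by (metis imageI)
  qed
  define N where "N = {x \<in> S. ?D x0 x = 0}"
  define C where "C = {y \<in> S. \<forall>x\<in>N. orthogonal x y}"
  note K = kernel_complement[OF lin[OF x0(1)] S, folded N_def, folded C_def]
  obtain n where n: "n \<in> N" "n \<noteq> 0"
  proof -
    obtain x y where "x \<in> S" "y \<in> S" "?D x0 x = ?D x0 y" "x \<noteq> y"
      using contra x0(1) unfolding inj_on_def by blast
    then show thesis
      using that[of "x - y"] subspace_diff[OF S] linear_diff[OF lin[OF x0(1)]] by (auto simp: N_def)
  qed
  obtain A where A: "range A \<subseteq> C" "linear A" "\<And>v. v \<in> C \<Longrightarrow> A (?D x0 v) = v"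
    using linear_exists_left_inverse_on[OF lin[OF x0(1)] K(2) K(5)] by blast
  have Ab: "bounded_linear A" using A(2) linear_conv_bounded_linear by blast
  have D0b: "bounded_linear (?D x0)" using lin[OF x0(1)] linear_conv_bounded_linear by blast
  have CS: "C \<subseteq> S" "N \<subseteq> S" by (auto simp: C_def N_def)
  \<comment> \<open>On \<open>S\<close> this is the projection onto the kernel \<open>N\<close>
    along its complement \<open>C\<close>.\<close>
  define \<kappa> where "\<kappa> = (\<lambda>x. x - A (?D x0 x))"
  have \<kappa>b: "bounded_linear \<kappa>" unfolding \<kappa>_def
    by (intro bounded_linear_sub bounded_linear_ident bounded_linear_compose[OF Ab D0b])
  have \<kappa>N: "\<kappa> x \<in> N" if xS: "x \<in> S" for x
  proof -
    obtain y z where yz: "y \<in> N" "z \<in> C" "x = y + z" using K(4)[OF xS] by blast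
    then have "?D x0 x = ?D x0 z" using linear_add[OF lin[OF x0(1)]] by (simp add: N_def)
    then have "\<kappa> x = y" using A(3)[OF yz(2)] yz(3) by (simp add: \<kappa>_def)
    then show ?thesis using yz by simp
  qed
  have CN: "c = 0" if "c \<in> C" "c \<in> N" for c using K(3) that by blast
  \<comment> \<open>Straightening coordinates: \<open>A (f x)\<close> supplies the part in
    \<open>C\<close> and \<kappa> the part in \<open>N\<close>, and the derivative at
    \<open>x0\<close> is the identity.\<close>
  define h where "h = (\<lambda>x. A (f x) + \<kappa> x)"
  have h: "smooth_on S W h" unfolding h_def
    by (intro smooth_on_add[OF W] smooth_on_linear[OF W Ab f] smooth_on_linear_map[OF W \<kappa>b])
  have hS: "h ` W \<subseteq> S"
  proof
    fix z assume "z \<in> h ` W"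
    then obtain x where x: "x \<in> W" "z = h x" by auto
    have "A (f x) \<in> S" using A(1) CS by blast
    moreover have "\<kappa> x \<in> S" using \<kappa>N CS open_in_subspaceD(3)[OF W] x by blast
    ultimately show "z \<in> S" unfolding x(2) h_def by (rule subspace_add[OF S])
  qed
  have derh: "(h has_derivative (\<lambda>v. A (?D x v) + \<kappa> v)) (at x within W)" if "x \<in> W" for x
    unfolding h_def
    by (intro has_derivative_add bounded_linear.has_derivative[OF Ab der[OF that]]
        bounded_linear_imp_has_derivative \<kappa>b)
  have der0: "(h has_derivative (\<lambda>v. v)) (at x0 within W)"
    using derh[OF x0(1)] by (simp add: \<kappa>_def)
  obtain W' V g where UV: "open_in_subspace S W'" "W' \<subseteq> W" "x0 \<in> W'" "open_in_subspace S V" "homeomorphism W' V h g" "smooth_on S V g"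
    using smooth_inverse_rel[OF W S h hS x0(1) der0] by auto
  have gV: "g y \<in> W'" "h (g y) = y" if "y \<in> V" for y
    using UV(5) that unfolding homeomorphism_def by auto
  let ?Dg = "\<lambda>y. frechet_derivative g (at y within V)"
  have derg: "(g has_derivative ?Dg y) (at y within V)" if "y \<in> V" for y
    using smooth_on_has_derivative[OF UV(6) that] .
  have DgS: "?Dg y w \<in> S" if "y \<in> V" "w \<in> S" for y w
    by (rule derivative_in_subspace[OF UV(4) that(1) derg[OF that(1)] _ S that(2)])
       (use gV UV(2) open_in_subspaceD(3)[OF W] in blast)
  have Dhg: "A (?D (g y) (?Dg y w)) + \<kappa> (?Dg y w) = w" if y: "y \<in> V" and w: "w \<in> S" for y w
  proof -
    have gW: "g ` V \<subseteq> W" using gV UV(2) by blast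
    have "((\<lambda>y. h (g y)) has_derivative (\<lambda>w. A (?D (g y) (?Dg y w)) + \<kappa> (?Dg y w))) (at y within V)"
      using has_derivative_in_compose[OF derg[OF y] has_derivative_subset[OF derh gW]] gW y by blast
    then have "((\<lambda>y. y) has_derivative (\<lambda>w. A (?D (g y) (?Dg y w)) + \<kappa> (?Dg y w))) (at y within V)"
      by (rule has_derivative_transform[OF y, rotated]) (use gV in simp)
    from has_derivative_rel_unique[OF UV(4) y this has_derivative_ident w] show ?thesis .
  qed
  \<comment> \<open>In the new coordinates the derivative of \<open>f\<close> in the kernel
    direction \<open>n\<close> vanishes at every point near \<open>y0\<close>, not just at
    \<open>y0\<close>. This is where maximality of the rank is used.\<close>
  have zero: "?D (g y) (?Dg y n) = 0" if y: "y \<in> V" for y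
  proof -
    let ?x = "g y"
    have x: "?x \<in> W" using gV y UV(2) by blast
    let ?R = "?D ?x ` S"
    have R: "subspace ?R" using linear_subspace_image[OF lin[OF x] S] .
    \<comment> \<open>\<open>A\<close> maps the image \<open>?R\<close> of the derivative onto
      \<open>C\<close>, while the dimension of \<open>?R\<close> is at most that of \<open>C\<close>
      by maximality. Hence \<open>A\<close> is injective on \<open>?R\<close>, and what
      \<open>A\<close> sends to zero there is zero.\<close>
    have "C \<subseteq> A ` ?R"
    proof
      fix c assume c: "c \<in> C"
      have cS: "c \<in> S" using c CS by auto
      have "\<kappa> (?Dg y c) = c - A (?D ?x (?Dg y c))" using Dhg[OF y cS] by (simp add: algebra_simps)
      then have "\<kappa> (?Dg y c) \<in> C" using subspace_diff[OF K(2) c] A(1) by auto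
      then have "\<kappa> (?Dg y c) = 0" using CN \<kappa>N DgS[OF y cS] by blast
      then have "c = A (?D ?x (?Dg y c))" using Dhg[OF y cS] by simp
      then show "c \<in> A ` ?R" using DgS[OF y cS] by blast
    qed
    then have "dim C \<le> dim (A ` ?R)" by (rule dim_subset)
    moreover have "dim ?R \<le> dim C"
      using x0(2)[OF x] dim_image_le[OF lin[OF x0(1)], of C] K(6) unfolding r_def by simp
    ultimately have injA: "inj_on A ?R" by (intro linear_inj_on_if_dim_le[OF A(2) R]) linarith
    have nS: "n \<in> S" using n CS by auto
    let ?u = "?Dg y n"
    have "A (?D ?x ?u) = n - \<kappa> ?u" using Dhg[OF y nS] by (simp add: algebra_simps)
    then have "A (?D ?x ?u) \<in> N" using subspace_diff[OF K(1) n(1)] \<kappa>N DgS[OF y nS] by simp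
    then have "A (?D ?x ?u) = 0" using CN A(1) by blast
    then have "A (?D ?x ?u) = A 0" using linear_0[OF A(2)] by simp
    then show ?thesis using inj_onD[OF injA] DgS[OF y nS] subspace_0[OF R] by blast
  qed
  define y0 where "y0 = h x0"
  have y0: "y0 \<in> V" using UV(3,5) unfolding y0_def homeomorphism_def by auto
  obtain U where U: "open U" "V = S \<inter> U" using open_in_subspaceD(2)[OF UV(4)] by (auto simp: openin_open)
  \<comment> \<open>A segment in direction \<open>n\<close>. Along it \<open>f\<close> composed with
    \<open>g\<close> has zero derivative, hence is constant, contrary to injectivity of
    \<open>f\<close>.\<close>
  define l where "l = (\<lambda>t::real. y0 + t *\<^sub>R n)"
  have lV: "l t \<in> V \<longleftrightarrow> l t \<in> U" for t
    unfolding U(2) l_def using n(1) CS y0 U(2) by (auto intro!: subspace_add[OF S] subspace_scale[OF S])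
  have "continuous_on UNIV l" unfolding l_def by (intro continuous_intros)
  then have "open (l -` U)" using open_vimage[OF U(1)] by blast
  moreover have "0 \<in> l -` U" using y0 U by (simp add: l_def)
  ultimately obtain e where e: "e > 0" "ball 0 e \<subseteq> l -` U" by (meson open_contains_ball)
  have lbV: "l ` ball 0 e \<subseteq> V" using e(2) lV by auto
  have "((\<lambda>t. f (g (l t))) has_derivative (\<lambda>h. 0)) (at t within ball 0 e)" if t: "t \<in> ball 0 e" for t
  proof -
    have lt: "l t \<in> V" using lbV t by auto
    have "(l has_derivative (\<lambda>s. s *\<^sub>R n)) (at t within ball 0 e)"
      unfolding l_def by (auto intro!: derivative_eq_intros)
    from has_derivative_in_compose[OF this has_derivative_subset[OF derg[OF lt] lbV]]
    have 1: "((\<lambda>t. g (l t)) has_derivative (\<lambda>s. ?Dg (l t) (s *\<^sub>R n))) (at t within ball 0 e)" .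
    have glW: "(\<lambda>t. g (l t)) ` ball 0 e \<subseteq> W" using lbV gV UV(2) by blast
    then have x: "g (l t) \<in> W" using t by blast
    from has_derivative_in_compose[OF 1 has_derivative_subset[OF der[OF x] glW]]
    have 2: "((\<lambda>t. f (g (l t))) has_derivative (\<lambda>s. ?D (g (l t)) (?Dg (l t) (s *\<^sub>R n)))) (at t within ball 0 e)" .
    have "?D (g (l t)) (?Dg (l t) (s *\<^sub>R n)) = 0" for s
      using zero[OF lt] linear_scale[OF has_derivative_linear[OF derg[OF lt]]] linear_scale[OF lin[OF x]] by simp
    then show ?thesis using 2 by simp
  qed
  then obtain c where c: "\<And>t. t \<in> ball 0 e \<Longrightarrow> f (g (l t)) = c"
    using has_derivative_zero_constant[of "ball 0 e" "\<lambda>t. f (g (l t))"] by auto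
  have t: "e / 2 \<in> ball 0 e" "0 \<in> ball 0 e" using e(1) by auto
  then have "f (g (l (e / 2))) = f (g (l 0))" using c by simp
  moreover have lt: "l (e / 2) \<in> V" "l 0 \<in> V" using lbV t by blast+
  ultimately have "g (l (e / 2)) = g (l 0)"
    using inj_onD[OF inj] gV UV(2) by blast
  then have "l (e / 2) = l 0" using gV(2) lt by metis
  then show False using e(1) n(2) by (simp add: l_def)
qed

section \<open>Plots of manifolds\<close>

lemma top_chartD:
  assumes "top_chart T S (U, \<phi>)"
  shows "openin T U" "openin (top_of_set S) (\<phi> ` U)"
    "homeomorphic_map (subtopology T U) (top_of_set (\<phi> ` U)) \<phi>" "U \<subseteq> topspace T"
  using assms openin_subset unfolding top_chart_def by auto

lemma top_chart_inj_on:
  assumes "top_chart T S (U, \<phi>)"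
  shows "inj_on \<phi> U"
  using homeomorphic_imp_injective_map[OF top_chartD(3)[OF assms]] top_chartD(4)[OF assms]
  by (simp add: topspace_subtopology Int_absorb1)

lemma top_chart_open_image:
  assumes C: "top_chart T S (U, \<phi>)" and S: "subspace S" and O: "openin T V"
  shows "open_in_subspace S (\<phi> ` (U \<inter> V))"
proof -
  have "openin (subtopology T U) (U \<inter> V)" using O by (simp add: openin_subtopology_Int2 Int_commute)
  then have "openin (top_of_set (\<phi> ` U)) (\<phi> ` (U \<inter> V))"
    using homeomorphic_imp_open_map[OF top_chartD(3)[OF C]] unfolding open_map_def by blast
  then show ?thesis
    unfolding open_in_subspace_def using S top_chartD(2)[OF C] openin_trans by blast
qed

lemma top_chart_rel_open:
  assumes "top_chart T S (U, \<phi>)" "subspace S"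
  shows "open_in_subspace S (\<phi> ` U)"
  using assms top_chartD(2) unfolding open_in_subspace_def by blast

lemma top_chart_continuous:
  assumes "top_chart T S (U, \<phi>)"
  shows "continuous_map (subtopology T U) euclidean \<phi>"
  using homeomorphic_imp_continuous_map[OF top_chartD(3)[OF assms]] continuous_map_in_subtopology by blast

lemma top_chart_inv:
  assumes "top_chart T S (U, \<phi>)"
  shows "continuous_map (top_of_set (\<phi> ` U)) T (inv_into U \<phi>)"
    "\<And>x. x \<in> U \<Longrightarrow> inv_into U \<phi> (\<phi> x) = x" "\<And>y. y \<in> \<phi> ` U \<Longrightarrow> inv_into U \<phi> y \<in> U"
    "\<And>y. y \<in> \<phi> ` U \<Longrightarrow> \<phi> (inv_into U \<phi> y) = y"
proof -
  note inj = top_chart_inj_on[OF assms]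
  show 1: "\<And>x. x \<in> U \<Longrightarrow> inv_into U \<phi> (\<phi> x) = x" using inj by simp
  show 2: "\<And>y. y \<in> \<phi> ` U \<Longrightarrow> inv_into U \<phi> y \<in> U" by (simp add: inv_into_into)
  show "\<And>y. y \<in> \<phi> ` U \<Longrightarrow> \<phi> (inv_into U \<phi> y) = y" by (simp add: f_inv_into_f)
  obtain g where g: "homeomorphic_maps (subtopology T U) (top_of_set (\<phi> ` U)) \<phi> g"
    using top_chartD(3)[OF assms] homeomorphic_map_maps by blast
  have "topspace (subtopology T U) = U" using top_chartD(4)[OF assms] by auto
  then have "continuous_map (top_of_set (\<phi> ` U)) T g" "\<And>x. x \<in> U \<Longrightarrow> g (\<phi> x) = x"
    using g unfolding homeomorphic_maps_def by (auto simp: continuous_map_in_subtopology)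
  then show "continuous_map (top_of_set (\<phi> ` U)) T (inv_into U \<phi>)"
    by (auto intro!: continuous_map_eq[of _ _ g] simp: 1)
qed

lemma top_chart_open_preimage:
  assumes C: "top_chart T S (U, \<phi>)" and S: "subspace S" and V: "open_in_subspace S V"
  shows "openin T {x \<in> U. \<phi> x \<in> V}"
proof -
  obtain O' where O': "open O'" "V = S \<inter> O'" using open_in_subspaceD(2)[OF V] by (auto simp: openin_open)
  have "openin (subtopology T U) {x \<in> topspace (subtopology T U). \<phi> x \<in> O'}"
    by (rule openin_continuous_map_preimage[OF top_chart_continuous[OF C]]) (use O' in simp)
  moreover have "{x \<in> topspace (subtopology T U). \<phi> x \<in> O'} = {x \<in> U. \<phi> x \<in> V}"
    using top_chartD(4)[OF C] openin_imp_subset[OF top_chartD(2)[OF C]] O'(2) by auto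
  ultimately show ?thesis using top_chartD(1)[OF C] by (metis openin_trans_full)
qed

text \<open>Charts and their covering property without smoothness of transitions and without
  countability. This much suffices for composing maps with plots, and it is available for products
  and for the orbit manifold alike.\<close>

definition charted :: "('p, 'e::euclidean_space) manifold \<Rightarrow> bool" where
  "charted M \<longleftrightarrow> subspace (model M) \<and> (\<forall>C\<in>atlas M. top_chart (mtop M) (model M) C) \<and>
     (\<Union>C\<in>atlas M. fst C) = topspace (mtop M)"

lemma smooth_manifold_charted: "smooth_manifold M \<Longrightarrow> charted M"
  unfolding smooth_manifold_def charted_def by blast

lemma charted_subspace: "charted M \<Longrightarrow> subspace (model M)"
  unfolding charted_def by blast

lemma charted_chart: "charted M \<Longrightarrow> C \<in> atlas M \<Longrightarrow> top_chart (mtop M) (model M) C"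
  unfolding charted_def by blast

lemma charted_cover:
  assumes "charted M" "x \<in> topspace (mtop M)"
  obtains U \<phi> where "(U, \<phi>) \<in> atlas M" "x \<in> U"
  using assms unfolding charted_def by fastforce

text \<open>Smooth maps into the manifold from open parts of a linear space of any type. Smoothness
  is tested and transported by composing with plots, which hides changes of charts. Continuity is
  part of the notion so that preimages of chart domains are open.\<close>

definition plot :: "('p, 'e::euclidean_space) manifold \<Rightarrow> 'a::euclidean_space set \<Rightarrow> 'a set \<Rightarrow> ('a \<Rightarrow> 'p) \<Rightarrow> bool" where
  "plot M S W h \<longleftrightarrow> open_in_subspace S W \<and> continuous_map (top_of_set W) (mtop M) h \<and>
     (\<forall>(U, \<phi>)\<in>atlas M. smooth_on S {w \<in> W. h w \<in> U} (\<lambda>w. \<phi> (h w)))"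

text \<open>The counterpart of plots: functions on an open part of the manifold. A plot into
  \<open>V\<close> followed by such a function is a smooth map between linear spaces.\<close>

definition smooth_on_open :: "('p, 'e::euclidean_space) manifold \<Rightarrow> 'p set \<Rightarrow> ('p \<Rightarrow> 'b::real_normed_vector) \<Rightarrow> bool" where
  "smooth_on_open M V r \<longleftrightarrow> openin (mtop M) V \<and>
     (\<forall>(U, \<phi>)\<in>atlas M. smooth_on (model M) (\<phi> ` (U \<inter> V)) (\<lambda>y. r (inv_into U \<phi> y)))"

lemma plotI:
  assumes "open_in_subspace S W" "continuous_map (top_of_set W) (mtop M) h"
    "\<And>U \<phi>. (U, \<phi>) \<in> atlas M \<Longrightarrow> smooth_on S {w \<in> W. h w \<in> U} (\<lambda>w. \<phi> (h w))"
  shows "plot M S W h"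
  using assms unfolding plot_def by auto

lemma smooth_on_open_chartI:
  assumes "openin (mtop M) V"
    "\<And>U \<phi>. (U, \<phi>) \<in> atlas M \<Longrightarrow> smooth_on (model M) (\<phi> ` (U \<inter> V)) (\<lambda>y. r (inv_into U \<phi> y))"
  shows "smooth_on_open M V r"
  using assms unfolding smooth_on_open_def by auto

lemma plotD:
  assumes "plot M S W h"
  shows "open_in_subspace S W" "continuous_map (top_of_set W) (mtop M) h"
    "\<And>U \<phi>. (U, \<phi>) \<in> atlas M \<Longrightarrow> smooth_on S {w \<in> W. h w \<in> U} (\<lambda>w. \<phi> (h w))"
    "\<And>w. w \<in> W \<Longrightarrow> h w \<in> topspace (mtop M)"
proof -
  show *: "open_in_subspace S W" "continuous_map (top_of_set W) (mtop M) h"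
    "\<And>U \<phi>. (U, \<phi>) \<in> atlas M \<Longrightarrow> smooth_on S {w \<in> W. h w \<in> U} (\<lambda>w. \<phi> (h w))"
    using assms unfolding plot_def by auto
  show "\<And>w. w \<in> W \<Longrightarrow> h w \<in> topspace (mtop M)"
    using continuous_map_image_subset_topspace[OF *(2)] by auto
qed

lemma open_in_subspace_continuous_preimage:
  assumes "open_in_subspace S W" "continuous_map (top_of_set W) T h" "openin T V"
  shows "open_in_subspace S {w \<in> W. h w \<in> V}"
  using openin_continuous_map_preimage[OF assms(2,3)] open_in_subspace_subset[OF assms(1)] by simp

lemma plot_preimage:
  assumes "plot M S W h" "openin (mtop M) V"
  shows "open_in_subspace S {w \<in> W. h w \<in> V}"
  using open_in_subspace_continuous_preimage[OF plotD(1,2)[OF assms(1)] assms(2)] .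

lemma plot_compose:
  fixes f :: "'b::euclidean_space \<Rightarrow> 'a::euclidean_space"
  assumes M: "charted M" and h: "plot M S W h" and V: "open_in_subspace S' V" and f: "smooth_on S' V f" and im: "f ` V \<subseteq> W"
  shows "plot M S' V (\<lambda>x. h (f x))"
proof (rule plotI[OF V])
  have fc: "continuous_map (top_of_set V) (top_of_set W) f"
    using smooth_on_continuous[OF f] im by (auto simp: continuous_map_in_subtopology)
  show c: "continuous_map (top_of_set V) (mtop M) (\<lambda>x. h (f x))"
    using continuous_map_compose[OF fc plotD(2)[OF h]] by (simp add: o_def)
  fix U \<phi> assume C: "(U, \<phi>) \<in> atlas M"
  have U: "openin (mtop M) U" using top_chartD(1) charted_chart[OF M C] by blast
  have R: "open_in_subspace S' {x \<in> V. h (f x) \<in> U}" by (rule open_in_subspace_continuous_preimage[OF V c U])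
  have fs: "smooth_on S' {x \<in> V. h (f x) \<in> U} f"
    by (rule smooth_on_subset_rel[OF f V R]) auto
  show "smooth_on S' {w \<in> V. h (f w) \<in> U} (\<lambda>w. \<phi> (h (f w)))"
    by (rule smooth_on_compose[OF R plot_preimage[OF h U] _ fs plotD(3)[OF h C]]) (use im in auto)
qed

lemma plot_subset:
  assumes M: "charted M" and h: "plot M S W h" and V: "open_in_subspace S V" "V \<subseteq> W"
  shows "plot M S V h"
  using plot_compose[OF M h V(1) smooth_on_id[OF V(1)]] V(2) by simp

lemma plot_const:
  fixes M :: "('p, 'c::euclidean_space) manifold"
  assumes "open_in_subspace S W" "x \<in> topspace (mtop M)"
  shows "plot M S W (\<lambda>w. x)"
proof -
  have "smooth_on S {w \<in> W. x \<in> U} (\<lambda>w. y)" for U and y :: 'c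
    by (cases "x \<in> U") (use assms(1) in \<open>auto intro!: smooth_on_const simp: open_in_subspace_def\<close>)
  then show ?thesis using assms unfolding plot_def by auto
qed

text \<open>Compatibility of charts enters here: seen in another chart, the inverse of a chart is a
  transition map.\<close>

lemma plot_chart:
  assumes M: "smooth_manifold M" and C: "(U, \<phi>) \<in> atlas M"
  shows "plot M (model M) (\<phi> ` U) (inv_into U \<phi>)"
  unfolding plot_def
proof (intro conjI ballI, goal_cases)
  note ch = charted_chart[OF smooth_manifold_charted[OF M] C]
  case 1
  show ?case by (rule top_chart_rel_open[OF ch charted_subspace[OF smooth_manifold_charted[OF M]]])
  case 2
  show ?case by (rule top_chart_inv(1)[OF ch])
next
  case (3 D)
  note ch = charted_chart[OF smooth_manifold_charted[OF M] C]
  obtain V \<psi> where D: "D = (V, \<psi>)" by fastforce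
  have "{w \<in> \<phi> ` U. inv_into U \<phi> w \<in> V} = \<phi> ` (U \<inter> V)"
    using top_chart_inv(2)[OF ch] by auto
  moreover have "smooth_on (model M) (\<phi> ` (U \<inter> V)) (\<psi> \<circ> inv_into U \<phi>)"
    using M C 3 unfolding smooth_manifold_def smooth_transition_def D by fastforce
  ultimately show ?case unfolding D by (simp add: o_def)
qed

lemma plot_smooth_on_open:
  assumes M: "charted M" and r: "smooth_on_open M V r" and h: "plot M S W h" and im: "h ` W \<subseteq> V"
  shows "smooth_on S W (\<lambda>w. r (h w))"
proof (rule smooth_on_local_rel[OF plotD(1)[OF h]])
  fix w assume w: "w \<in> W"
  obtain U \<phi> where C: "(U, \<phi>) \<in> atlas M" "h w \<in> U" using charted_cover[OF M plotD(4)[OF h w]] by blast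
  note ch = charted_chart[OF M C(1)]
  have V: "openin (mtop M) V" using r by (simp add: smooth_on_open_def)
  let ?W = "{w \<in> W. h w \<in> U}"
  have R: "open_in_subspace S ?W" by (rule plot_preimage[OF h top_chartD(1)[OF ch]])
  have R2: "open_in_subspace (model M) (\<phi> ` (U \<inter> V))" by (rule top_chart_open_image[OF ch charted_subspace[OF M] V])
  have "smooth_on S ?W (\<lambda>w. (\<lambda>y. r (inv_into U \<phi> y)) (\<phi> (h w)))"
    by (rule smooth_on_compose[OF R R2 _ plotD(3)[OF h C(1)]])
       (use r C(1) im in \<open>auto simp: smooth_on_open_def\<close>)
  then have "smooth_on S ?W (\<lambda>w. r (h w))"
    by (rule smooth_on_cong_imp) (simp add: top_chart_inv(2)[OF ch])
  then show "\<exists>V. w \<in> V \<and> open_in_subspace S V \<and> smooth_on S V (\<lambda>w. r (h w))"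
    using R w C(2) by (intro exI[of _ ?W]) auto
qed

text \<open>Restricted inverse charts are plots, so testing along plots covers all charts.\<close>

lemma smooth_on_openI:
  fixes M :: "('p, 'e::euclidean_space) manifold"
  assumes M: "smooth_manifold M" and V: "openin (mtop M) V"
    and r: "\<And>W (h :: 'e \<Rightarrow> 'p). plot M (model M) W h \<Longrightarrow> h ` W \<subseteq> V \<Longrightarrow> smooth_on (model M) W (\<lambda>w. r (h w))"
  shows "smooth_on_open M V r"
proof (rule smooth_on_open_chartI[OF V])
  fix U \<phi> assume C: "(U, \<phi>) \<in> atlas M"
  note ch = charted_chart[OF smooth_manifold_charted[OF M] C]
  have "plot M (model M) (\<phi> ` (U \<inter> V)) (inv_into U \<phi>)"
    by (rule plot_subset[OF smooth_manifold_charted[OF M] plot_chart[OF M C]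
          top_chart_open_image[OF ch charted_subspace[OF smooth_manifold_charted[OF M]] V]]) auto
  then show "smooth_on (model M) (\<phi> ` (U \<inter> V)) (\<lambda>y. r (inv_into U \<phi> y))"
    by (rule r) (use top_chart_inv(2)[OF ch] in auto)
qed

lemma smooth_fun_iff_open:
  assumes M: "charted M"
  shows "smooth_fun M f \<longleftrightarrow> smooth_on_open M (topspace (mtop M)) f"
proof -
  have "U \<inter> topspace (mtop M) = U" if "(U, \<phi>) \<in> atlas M" for U \<phi>
    using top_chartD(4)[OF charted_chart[OF M that]] by blast
  then show ?thesis unfolding smooth_fun_def smooth_on_open_def by (auto simp: o_def)
qed

lemma plot_smooth_fun:
  assumes M: "charted M" and f: "smooth_fun M f" and h: "plot M S W h"
  shows "smooth_on S W (\<lambda>w. f (h w))"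
  by (rule plot_smooth_on_open[OF M f[unfolded smooth_fun_iff_open[OF M]] h]) (use plotD(4)[OF h] in auto)

lemma plot_smooth_map:
  assumes M: "charted M" and N: "charted N" and F: "smooth_map M N F" and h: "plot M S W h"
  shows "plot N S W (\<lambda>w. F (h w))"
proof (rule plotI[OF plotD(1)[OF h]])
  have Fc: "continuous_map (mtop M) (mtop N) F" using F by (simp add: smooth_map_def)
  show c: "continuous_map (top_of_set W) (mtop N) (\<lambda>w. F (h w))"
    using continuous_map_compose[OF plotD(2)[OF h] Fc] by (simp add: o_def)
  fix V \<psi> assume D: "(V, \<psi>) \<in> atlas N"
  have V: "openin (mtop N) V" using top_chartD(1) charted_chart[OF N D] by blast
  let ?O = "{x \<in> topspace (mtop M). F x \<in> V}"
  have O: "openin (mtop M) ?O" by (rule openin_continuous_map_preimage[OF Fc V])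
  have "smooth_on_open M ?O (\<lambda>x. \<psi> (F x))"
  proof (rule smooth_on_open_chartI[OF O])
    fix U \<phi> assume C: "(U, \<phi>) \<in> atlas M"
    have "U \<inter> ?O = {x \<in> U. F x \<in> V}" using top_chartD(4)[OF charted_chart[OF M C]] by auto
    then show "smooth_on (model M) (\<phi> ` (U \<inter> ?O)) (\<lambda>y. \<psi> (F (inv_into U \<phi> y)))"
      using F C D unfolding smooth_map_def by (auto simp: o_def)
  qed
  moreover have "plot M S {w \<in> W. F (h w) \<in> V} h"
    by (rule plot_subset[OF M h open_in_subspace_continuous_preimage[OF plotD(1)[OF h] c V]]) auto
  ultimately show "smooth_on S {w \<in> W. F (h w) \<in> V} (\<lambda>w. \<psi> (F (h w)))"
    by (rule plot_smooth_on_open[OF M]) (use plotD(4)[OF h] in auto)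
qed

lemma charted_product:
  assumes M: "charted M" and N: "charted N"
  shows "charted (product_manifold M N)"
  unfolding charted_def product_manifold_def
proof (simp, intro conjI allI impI, goal_cases)
  case 1
  then show ?case using charted_subspace[OF M] charted_subspace[OF N] by (rule subspace_Times)
next
  case (2 W \<theta>)
  then obtain U \<phi> V \<psi> where W: "W = U \<times> V" "\<theta> = map_prod \<phi> \<psi>" and C: "(U, \<phi>) \<in> atlas M" "(V, \<psi>) \<in> atlas N" by auto
  note c = charted_chart[OF M C(1)] and d = charted_chart[OF N C(2)]
  have im: "map_prod \<phi> \<psi> ` (U \<times> V) = \<phi> ` U \<times> \<psi> ` V" by (auto simp: image_iff)
  obtain \<phi>' where \<phi>': "homeomorphic_maps (subtopology (mtop M) U) (top_of_set (\<phi> ` U)) \<phi> \<phi>'"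
    using top_chartD(3)[OF c] homeomorphic_map_maps by blast
  obtain \<psi>' where \<psi>': "homeomorphic_maps (subtopology (mtop N) V) (top_of_set (\<psi> ` V)) \<psi> \<psi>'"
    using top_chartD(3)[OF d] homeomorphic_map_maps by blast
  have "homeomorphic_maps (prod_topology (subtopology (mtop M) U) (subtopology (mtop N) V))
     (prod_topology (top_of_set (\<phi> ` U)) (top_of_set (\<psi> ` V))) (\<lambda>(x, y). (\<phi> x, \<psi> y)) (\<lambda>(x, y). (\<phi>' x, \<psi>' y))"
    using \<phi>' \<psi>' homeomorphic_maps_prod by blast
  then have "homeomorphic_map (subtopology (prod_topology (mtop M) (mtop N)) (U \<times> V))
     (top_of_set (\<phi> ` U \<times> \<psi> ` V)) (\<lambda>(x, y). (\<phi> x, \<psi> y))"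
    unfolding subtopology_Times prod_topology_subtopology_eu by (rule homeomorphic_maps_imp_map)
  then have 1: "homeomorphic_map (subtopology (prod_topology (mtop M) (mtop N)) (U \<times> V))
     (top_of_set (\<phi> ` U \<times> \<psi> ` V)) (map_prod \<phi> \<psi>)" unfolding map_prod_def .
  have 2: "openin (prod_topology (mtop M) (mtop N)) (U \<times> V)"
    using top_chartD(1)[OF c] top_chartD(1)[OF d] by (simp add: openin_prod_Times_iff)
  have 3: "openin (top_of_set (model M \<times> model N)) (\<phi> ` U \<times> \<psi> ` V)"
    using top_chartD(2)[OF c] top_chartD(2)[OF d] by (rule openin_Times)
  show ?case unfolding top_chart_def W prod.case im
    by (rule conjI[OF 2 conjI[OF 3 1]])
next
  case 3
  have "(\<Union>C\<in>{(U \<times> V, map_prod \<phi> \<psi>) |U \<phi> V \<psi>. (U, \<phi>) \<in> atlas M \<and> (V, \<psi>) \<in> atlas N}. fst C)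
    = (\<Union>C\<in>atlas M. fst C) \<times> (\<Union>C\<in>atlas N. fst C)" (is "?A = ?B")
  proof
    show "?A \<subseteq> ?B" by force
    show "?B \<subseteq> ?A"
    proof
      fix z assume "z \<in> ?B"
      then obtain U \<phi> V \<psi> where "(U, \<phi>) \<in> atlas M" "(V, \<psi>) \<in> atlas N" "z \<in> U \<times> V" by force
      then show "z \<in> ?A" by (intro UN_I[of "(U \<times> V, map_prod \<phi> \<psi>)"]) auto
    qed
  qed
  then show ?case using M N unfolding charted_def by simp
qed

lemma plot_pair:
  assumes M: "charted M" and N: "charted N" and h: "plot M S W h" and k: "plot N S W k"
  shows "plot (product_manifold M N) S W (\<lambda>w. (h w, k w))"
  unfolding plot_def
proof (intro conjI plotD(1)[OF h] ballI)
  show "continuous_map (top_of_set W) (mtop (product_manifold M N)) (\<lambda>w. (h w, k w))"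
    using plotD(2)[OF h] plotD(2)[OF k] by (simp add: product_manifold_def continuous_map_pairedI)
  fix D assume "D \<in> atlas (product_manifold M N)"
  then obtain U \<phi> V \<psi> where D: "D = (U \<times> V, map_prod \<phi> \<psi>)" and C: "(U, \<phi>) \<in> atlas M" "(V, \<psi>) \<in> atlas N"
    unfolding product_manifold_def by auto
  have R1: "open_in_subspace S {w \<in> W. h w \<in> U}"
    by (rule plot_preimage[OF h top_chartD(1)[OF charted_chart[OF M C(1)]]])
  have R2: "open_in_subspace S {w \<in> W. k w \<in> V}"
    by (rule plot_preimage[OF k top_chartD(1)[OF charted_chart[OF N C(2)]]])
  have R: "open_in_subspace S {w \<in> W. h w \<in> U \<and> k w \<in> V}"
  proof -
    have "{w \<in> W. h w \<in> U \<and> k w \<in> V} = {w \<in> W. h w \<in> U} \<inter> {w \<in> W. k w \<in> V}" by blast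
    then show ?thesis using open_in_subspace_Int[OF R1 R2] by (simp only:)
  qed
  have "smooth_on S {w \<in> W. h w \<in> U \<and> k w \<in> V} (\<lambda>w. (\<phi> (h w), \<psi> (k w)))"
    by (intro smooth_on_Pair R smooth_on_subset_rel[OF plotD(3)[OF h C(1)] R1 R]
         smooth_on_subset_rel[OF plotD(3)[OF k C(2)] R2 R]) auto
  then show "case D of (U, \<phi>) \<Rightarrow> smooth_on S {w \<in> W. (h w, k w) \<in> U} (\<lambda>w. \<phi> (h w, k w))"
    unfolding D by simp
qed

lemma plot_in_chart:
  assumes "plot M S W h" "(U, \<phi>) \<in> atlas M" "h ` W \<subseteq> U"
  shows "smooth_on S W (\<lambda>w. \<phi> (h w))"
proof -
  have "{w \<in> W. h w \<in> U} = W" using assms(3) by auto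
  then show ?thesis using plotD(3)[OF assms(1,2)] by simp
qed

section \<open>Free proper actions\<close>

locale free_proper_action =
  fixes P :: "('p, 'e::euclidean_space) manifold"
    and G :: "('g, 'r) monoid_scheme" (structure)
    and L :: "('g, 'f::euclidean_space) manifold"
    and \<alpha> :: "'g \<Rightarrow> 'p \<Rightarrow> 'p"
  assumes P: "smooth_manifold P"
    and lie: "lie_group G L"
    and act: "smooth_action G L P \<alpha>"
    and proper: "proper_action L P \<alpha>"
    and free: "free_action G P \<alpha>"
begin

abbreviation "E \<equiv> topspace (mtop P)"
abbreviation "S \<equiv> model P"
abbreviation "SG \<equiv> model L"
abbreviation "\<pi> \<equiv> orbit G \<alpha>"
abbreviation "Q \<equiv> orbit_topology G P \<alpha>"
abbreviation "T \<equiv> orbit_model SG S"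
abbreviation "QM \<equiv> orbit_manifold G L P \<alpha>"

lemma smooth_manifold_L: "smooth_manifold L" and group_G: "group G" and carrier_eq: "carrier G = topspace (mtop L)"
  using lie unfolding lie_group_def by auto

lemma charted_P: "charted P" and charted_L: "charted L"
  using P smooth_manifold_L smooth_manifold_charted by auto

sublocale group G by (rule group_G)
sublocale group_action G E \<alpha> using act unfolding smooth_action_def by blast

lemma act_closed [simp]: "g \<in> carrier G \<Longrightarrow> x \<in> E \<Longrightarrow> \<alpha> g x \<in> E"
  using element_image by blast

lemma act_one [simp]: "x \<in> E \<Longrightarrow> \<alpha> \<one> x = x"
  using id_eq_one by (metis restrict_apply')

lemma act_mult: "g \<in> carrier G \<Longrightarrow> h \<in> carrier G \<Longrightarrow> x \<in> E \<Longrightarrow> \<alpha> (g \<otimes> h) x = \<alpha> g (\<alpha> h x)"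
  using composition_rule by blast

lemma act_inv [simp]: "g \<in> carrier G \<Longrightarrow> x \<in> E \<Longrightarrow> \<alpha> (inv g) (\<alpha> g x) = x"
  using orbit_sym_aux by blast

lemma act_inv' [simp]: "g \<in> carrier G \<Longrightarrow> x \<in> E \<Longrightarrow> \<alpha> g (\<alpha> (inv g) x) = x"
  using act_inv[of "inv g" x] by simp

lemma act_free: "g \<in> carrier G \<Longrightarrow> x \<in> E \<Longrightarrow> \<alpha> g x = x \<Longrightarrow> g = \<one>"
  using free unfolding free_action_def stabilizer_def by blast

lemma act_inj: 
  assumes "g \<in> carrier G" "h \<in> carrier G" "x \<in> E" "\<alpha> g x = \<alpha> h x"
  shows "g = h"
proof -
  have "\<alpha> (inv h \<otimes> g) x = x" using assms by (simp add: act_mult)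
  then have "inv h \<otimes> g = \<one>" using assms by (intro act_free) auto
  then show ?thesis using assms by (metis inv_equality inv_inv inv_closed)
qed

lemma orbit_eq_iff:
  assumes "x \<in> E" "y \<in> E"
  shows "\<pi> x = \<pi> y \<longleftrightarrow> (\<exists>g\<in>carrier G. y = \<alpha> g x)"
proof
  assume "\<pi> x = \<pi> y"
  then have "y \<in> \<pi> x" using orbit_refl assms by auto
  then show "\<exists>g\<in>carrier G. y = \<alpha> g x" unfolding orbit_def by auto
next
  assume "\<exists>g\<in>carrier G. y = \<alpha> g x"
  then obtain g where g: "g \<in> carrier G" "y = \<alpha> g x" by blast
  show "\<pi> x = \<pi> y"
  proof
    show "\<pi> y \<subseteq> \<pi> x"
    proof
      fix z assume "z \<in> \<pi> y"
      then obtain h where "h \<in> carrier G" "z = \<alpha> h y" unfolding orbit_def by auto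
      then have "z = \<alpha> (h \<otimes> g) x" "h \<otimes> g \<in> carrier G" using g assms by (auto simp: act_mult)
      then show "z \<in> \<pi> x" unfolding orbit_def by blast
    qed
    show "\<pi> x \<subseteq> \<pi> y"
    proof
      fix z assume "z \<in> \<pi> x"
      then obtain h where h: "h \<in> carrier G" "z = \<alpha> h x" unfolding orbit_def by auto
      have "\<alpha> (inv g) y = x" using g assms by simp
      then have "z = \<alpha> (h \<otimes> inv g) y" "h \<otimes> inv g \<in> carrier G" using g h assms by (simp_all add: act_mult)
      then show "z \<in> \<pi> y" unfolding orbit_def by blast
    qed
  qed
qed

lemma orbit_act [simp]: "g \<in> carrier G \<Longrightarrow> x \<in> E \<Longrightarrow> \<pi> (\<alpha> g x) = \<pi> x"
  using orbit_eq_iff[of x "\<alpha> g x"] by auto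

lemma orbit_subset: "x \<in> E \<Longrightarrow> y \<in> \<pi> x \<Longrightarrow> y \<in> E \<and> \<pi> y = \<pi> x"
proof -
  assume x: "x \<in> E" and "y \<in> \<pi> x"
  then obtain g where "g \<in> carrier G" "y = \<alpha> g x" unfolding orbit_def by auto
  then show "y \<in> E \<and> \<pi> y = \<pi> x" using x by simp
qed

lemma orbit_in_orbits [simp]: "x \<in> E \<Longrightarrow> \<pi> x \<in> orbits G E \<alpha>"
  unfolding orbits_def by blast

lemma orbit_some: "x \<in> E \<Longrightarrow> (SOME p. p \<in> \<pi> x) \<in> \<pi> x"
  using orbit_refl someI_ex[of "\<lambda>p. p \<in> \<pi> x"] by blast

lemma act_continuous2: "continuous_map (prod_topology (mtop L) (mtop P)) (mtop P) (\<lambda>(g, x). \<alpha> g x)"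
  using act unfolding smooth_action_def smooth_map_def product_manifold_def by simp

lemma mult_continuous2: "continuous_map (prod_topology (mtop L) (mtop L)) (mtop L) (\<lambda>(g, h). g \<otimes> h)"
  using lie unfolding lie_group_def smooth_map_def product_manifold_def by simp

lemma act_continuous:
  assumes "g \<in> carrier G"
  shows "continuous_map (mtop P) (mtop P) (\<alpha> g)"
proof -
  have "continuous_map (mtop P) (prod_topology (mtop L) (mtop P)) (\<lambda>x. (g, x))"
    using assms carrier_eq by (intro continuous_map_pairedI continuous_map_id[unfolded id_def]) auto
  from continuous_map_compose[OF this act_continuous2] show ?thesis by (simp add: o_def)
qed

lemma mult_right_continuous:
  assumes "g \<in> carrier G"
  shows "continuous_map (mtop L) (mtop L) (\<lambda>h. h \<otimes> g)"
proof -
  have "continuous_map (mtop L) (prod_topology (mtop L) (mtop L)) (\<lambda>h. (h, g))"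
    using assms carrier_eq by (intro continuous_map_pairedI continuous_map_id[unfolded id_def]) auto
  from continuous_map_compose[OF this mult_continuous2] show ?thesis by (simp add: o_def)
qed

lemma plot_act2:
  assumes h: "plot L A W h" and k: "plot P A W k"
  shows "plot P A W (\<lambda>w. \<alpha> (h w) (k w))"
proof -
  have "smooth_map (product_manifold L P) P (\<lambda>(g, x). \<alpha> g x)"
    using act unfolding smooth_action_def by blast
  from plot_smooth_map[OF charted_product[OF charted_L charted_P] charted_P this plot_pair[OF charted_L charted_P h k]]
  show ?thesis by simp
qed

lemma plot_act:
  assumes g: "g \<in> carrier G" and k: "plot P A W k"
  shows "plot P A W (\<lambda>w. \<alpha> g (k w))"
  by (rule plot_act2[OF plot_const[OF plotD(1)[OF k]] k]) (use g carrier_eq in simp)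

lemma act_open_image:
  assumes g: "g \<in> carrier G" and V: "openin (mtop P) V"
  shows "openin (mtop P) (\<alpha> g ` V)"
proof -
  have "\<alpha> g ` V = {x \<in> E. \<alpha> (inv g) x \<in> V}"
  proof
    show "\<alpha> g ` V \<subseteq> {x \<in> E. \<alpha> (inv g) x \<in> V}" using openin_subset[OF V] g by auto
    show "{x \<in> E. \<alpha> (inv g) x \<in> V} \<subseteq> \<alpha> g ` V"
      using g by (auto intro!: rev_image_eqI)
  qed
  then show ?thesis using openin_continuous_map_preimage[OF act_continuous V, of "inv g"] g by simp
qed

section \<open>The topology of the orbit space\<close>

lemma topspace_Q: "topspace Q = orbits G E \<alpha>"
proof
  show "topspace Q \<subseteq> orbits G E \<alpha>" using openin_topspace[of Q] unfolding openin_orbit_topology by blast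
  have "{x \<in> E. \<pi> x \<in> orbits G E \<alpha>} = E" by auto
  then have "openin Q (orbits G E \<alpha>)" unfolding openin_orbit_topology by simp
  then show "orbits G E \<alpha> \<subseteq> topspace Q" by (rule openin_subset)
qed

lemma orbit_continuous: "continuous_map (mtop P) Q \<pi>"
  unfolding continuous_map_def using topspace_Q by (simp add: openin_orbit_topology)

lemma orbit_open_image:
  assumes V: "openin (mtop P) V"
  shows "openin Q (\<pi> ` V)"
proof -
  have VE: "V \<subseteq> E" using openin_subset[OF V] .
  have "{x \<in> E. \<pi> x \<in> \<pi> ` V} = (\<Union>g\<in>carrier G. \<alpha> g ` V)"
  proof
    show "{x \<in> E. \<pi> x \<in> \<pi> ` V} \<subseteq> (\<Union>g\<in>carrier G. \<alpha> g ` V)"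
    proof
      fix x assume "x \<in> {x \<in> E. \<pi> x \<in> \<pi> ` V}"
      then obtain y where y: "x \<in> E" "y \<in> V" "\<pi> y = \<pi> x" by auto
      then obtain g where "g \<in> carrier G" "x = \<alpha> g y" using orbit_eq_iff[of y x] VE by auto
      then show "x \<in> (\<Union>g\<in>carrier G. \<alpha> g ` V)" using y by blast
    qed
    show "(\<Union>g\<in>carrier G. \<alpha> g ` V) \<subseteq> {x \<in> E. \<pi> x \<in> \<pi> ` V}" using VE by fastforce
  qed
  moreover have "openin (mtop P) (\<Union>g\<in>carrier G. \<alpha> g ` V)"
    using act_open_image V by (intro openin_Union) auto
  ultimately show ?thesis unfolding openin_orbit_topology using VE by auto
qed

lemma closed_action_map: "closed_map (prod_topology (mtop L) (mtop P)) (prod_topology (mtop P) (mtop P)) (\<lambda>(g, x). (\<alpha> g x, x))"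
  using proper unfolding proper_action_def by (rule proper_imp_closed_map)

text \<open>A proper map is closed, so the pairs (g z, z) with g in \<open>C\<close> form a closed
  set; it misses (y, x) and hence a product neighbourhood of it. With \<open>C\<close> the whole
  group this separates orbits; with \<open>C\<close> the complement of a neighbourhood of the unit
  it keeps far group elements from returning points to a slice.\<close>

lemma action_separation:
  assumes C: "closedin (mtop L) C" and x: "x \<in> E" "y \<in> E" and n: "\<And>g. g \<in> C \<Longrightarrow> \<alpha> g x \<noteq> y"
  obtains U V where "openin (mtop P) U" "openin (mtop P) V" "x \<in> U" "y \<in> V"
    "\<And>g z. g \<in> C \<Longrightarrow> z \<in> U \<Longrightarrow> \<alpha> g z \<notin> V"
proof -
  let ?A = "(\<lambda>(g, x). (\<alpha> g x, x)) ` (C \<times> E)"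
  have "closedin (prod_topology (mtop L) (mtop P)) (C \<times> E)"
    using C by (simp add: closedin_prod_Times_iff)
  then have "closedin (prod_topology (mtop P) (mtop P)) ?A"
    using closed_action_map unfolding closed_map_def by blast
  then have op: "openin (prod_topology (mtop P) (mtop P)) (E \<times> E - ?A)"
    unfolding closedin_def by simp
  have "(y, x) \<in> E \<times> E - ?A" using x n by auto
  from op[unfolded openin_prod_topology_alt, rule_format, OF this]
  obtain V U where VU: "openin (mtop P) V" "openin (mtop P) U" "y \<in> V" "x \<in> U" "V \<times> U \<subseteq> E \<times> E - ?A"
    by (elim exE conjE)
  have "\<alpha> g z \<notin> V" if "g \<in> C" "z \<in> U" for g z
  proof
    assume "\<alpha> g z \<in> V"
    then have "(\<alpha> g z, z) \<in> E \<times> E - ?A" using VU(5) that by blast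
    moreover have "z \<in> E" using openin_subset[OF VU(2)] that by blast
    ultimately show False using that by auto
  qed
  then show thesis using that VU by blast
qed

lemma Hausdorff_Q: "Hausdorff_space Q"
  unfolding Hausdorff_space_def
proof (intro allI impI)
  fix a b assume ab: "a \<in> topspace Q \<and> b \<in> topspace Q \<and> a \<noteq> b"
  then obtain x y where xy: "x \<in> E" "y \<in> E" "a = \<pi> x" "b = \<pi> y"
    unfolding topspace_Q orbits_def by auto
  have "\<alpha> g x \<noteq> y" if "g \<in> topspace (mtop L)" for g
    using ab xy orbit_eq_iff[of x y] that carrier_eq by auto
  then obtain U V where UV: "openin (mtop P) U" "openin (mtop P) V" "x \<in> U" "y \<in> V"
    "\<And>g z. g \<in> topspace (mtop L) \<Longrightarrow> z \<in> U \<Longrightarrow> \<alpha> g z \<notin> V"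
    using action_separation[OF closedin_topspace xy(1,2)] by metis
  have "disjnt (\<pi> ` U) (\<pi> ` V)"
    unfolding disjnt_iff
  proof (intro allI notI)
    fix q assume "q \<in> \<pi> ` U \<and> q \<in> \<pi> ` V"
    then obtain u v where uv: "u \<in> U" "v \<in> V" "\<pi> u = \<pi> v" by auto
    then obtain g where "g \<in> carrier G" "v = \<alpha> g u"
      using orbit_eq_iff[of u v] openin_subset[OF UV(1)] openin_subset[OF UV(2)] by auto
    then show False using UV(5) uv carrier_eq by auto
  qed
  then show "\<exists>U V. openin Q U \<and> openin Q V \<and> a \<in> U \<and> b \<in> V \<and> disjnt U V"
    using orbit_open_image UV xy by blast
qed

end

section \<open>Slices\<close>

context free_proper_action begin

text \<open>A slice given by a parametrization \<sigma> meeting each orbit at most once. The local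
  maps \<open>r\<close> send a point to the parameter of its orbit; they make the orbits meeting the
  slice an open set and the slice parameter a smooth function on \<open>P\<close>.\<close>

definition transversal :: "'e set \<Rightarrow> 'e set \<Rightarrow> ('e \<Rightarrow> 'p) \<Rightarrow> bool" where
  "transversal R A \<sigma> \<longleftrightarrow> plot P R A \<sigma> \<and> inj_on (\<lambda>s. \<pi> (\<sigma> s)) A \<and>
     (\<forall>y\<in>E. \<forall>s\<in>A. \<pi> (\<sigma> s) = \<pi> y \<longrightarrow>
       (\<exists>V r. y \<in> V \<and> smooth_on_open P V (r :: 'p \<Rightarrow> 'e) \<and> (\<forall>z\<in>V. r z \<in> A \<and> \<pi> (\<sigma> (r z)) = \<pi> z)))"

text \<open>
  The base point of the slice is moved within its orbit to a point where the orbit map is immersive.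
  This avoids the one-parameter subgroups that would show immersivity at \<open>\<one>\<close>.
\<close>

lemma orbit_map_immersion:
  assumes p: "p \<in> E"
  obtains U1 \<phi>1 Up \<phi>p v0 D1 where "(U1, \<phi>1) \<in> atlas L" "(Up, \<phi>p) \<in> atlas P" "p \<in> Up"
    "v0 \<in> \<phi>1 ` U1" "\<alpha> (inv_into U1 \<phi>1 v0) p \<in> Up"
    "open_in_subspace SG {v \<in> \<phi>1 ` U1. \<alpha> (inv_into U1 \<phi>1 v) p \<in> Up}"
    "((\<lambda>v. \<phi>p (\<alpha> (inv_into U1 \<phi>1 v) p)) has_derivative D1)
       (at v0 within {v \<in> \<phi>1 ` U1. \<alpha> (inv_into U1 \<phi>1 v) p \<in> Up})"
    "inj_on D1 SG" "D1 ` SG \<subseteq> S"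
proof -
  obtain U1 \<phi>1 where C1: "(U1, \<phi>1) \<in> atlas L" "\<one> \<in> U1"
    using charted_cover[OF charted_L] carrier_eq one_closed by metis
  obtain Up \<phi>p where Cp: "(Up, \<phi>p) \<in> atlas P" "p \<in> Up" using charted_cover[OF charted_P p] by blast
  note c1 = charted_chart[OF charted_L C1(1)] and cp = charted_chart[OF charted_P Cp(1)]
  let ?i = "inv_into U1 \<phi>1"
  let ?W = "{v \<in> \<phi>1 ` U1. \<alpha> (?i v) p \<in> Up}"
  let ?o = "\<lambda>v. \<phi>p (\<alpha> (?i v) p)"
  have pl: "plot P SG (\<phi>1 ` U1) (\<lambda>v. \<alpha> (?i v) p)"
    by (rule plot_act2[OF plot_chart[OF smooth_manifold_L C1(1)] plot_const[OF top_chart_rel_open[OF c1 charted_subspace[OF charted_L]] p]])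
  have R: "open_in_subspace SG ?W" by (rule plot_preimage[OF pl top_chartD(1)[OF cp]])
  have pW: "plot P SG ?W (\<lambda>v. \<alpha> (?i v) p)" by (rule plot_subset[OF charted_P pl R]) auto
  have sm: "smooth_on SG ?W ?o" by (rule plot_in_chart[OF pW Cp(1)]) auto
  have "\<phi>1 \<one> \<in> ?W" using C1(2) Cp(2) top_chart_inv(2)[OF c1 C1(2)] p by simp
  then have ne: "?W \<noteq> {}" by blast
  have gc: "?i v \<in> carrier G" if "v \<in> \<phi>1 ` U1" for v
    using top_chart_inv(3)[OF c1 that] top_chartD(4)[OF c1] carrier_eq by auto
  \<comment> \<open>Freeness makes the orbit map injective, which is all that
    \<open>exists_injective_derivative\<close> needs.\<close>
  have "inj_on ?o ?W"
  proof (rule inj_onI)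
    fix v w assume vw: "v \<in> ?W" "w \<in> ?W" "?o v = ?o w"
    then have "\<alpha> (?i v) p = \<alpha> (?i w) p" using inj_onD[OF top_chart_inj_on[OF cp]] by blast
    then have "?i v = ?i w" using act_inj gc vw p by blast
    then show "v = w" using top_chart_inv(4)[OF c1] vw by (metis (mono_tags, lifting) mem_Collect_eq)
  qed
  from exists_injective_derivative[OF R ne sm this]
  obtain v0 where v0: "v0 \<in> ?W" "inj_on (frechet_derivative ?o (at v0 within ?W)) SG" by blast
  note D = smooth_on_has_derivative[OF sm v0(1)]
  have "?o ` ?W \<subseteq> S" using open_in_subspaceD(3)[OF top_chart_rel_open[OF cp charted_subspace[OF charted_P]]] by blast
  then have "frechet_derivative ?o (at v0 within ?W) ` SG \<subseteq> S"
    using derivative_in_subspace[OF R v0(1) D _ charted_subspace[OF charted_P]] by blast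
  then show thesis using that[OF C1(1) Cp(1,2) _ _ R D v0(2)] v0(1) by blast
qed

text \<open>Let \<open>S'\<close> be the orthogonal complement of the orbit directions. Moving the
  affine slice \<open>x0 + s\<close> by group elements gives a map from
  \<open>SG \<times> S'\<close> whose derivative is \<open>D1 v + s\<close>, a bijection onto
  \<open>S\<close>. The second component of its local inverse reads off the slice parameter;
  freeness and properness show that a small slice meets an orbit only once.\<close>

lemma slice_raw:
  assumes p: "p \<in> E"
  obtains S' A \<sigma> where "subspace S'" "S' \<subseteq> S" "dim S' = dim S - dim SG"
    "transversal S' A \<sigma>" "\<exists>s\<in>A. \<pi> (\<sigma> s) = \<pi> p"
proof -
  obtain U1 \<phi>1 Up \<phi>p v0 D1 where C1: "(U1, \<phi>1) \<in> atlas L" and Cp: "(Up, \<phi>p) \<in> atlas P" and pU: "p \<in> Up"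
    and v0: "v0 \<in> \<phi>1 ` U1" "\<alpha> (inv_into U1 \<phi>1 v0) p \<in> Up"
    and R1: "open_in_subspace SG {v \<in> \<phi>1 ` U1. \<alpha> (inv_into U1 \<phi>1 v) p \<in> Up}"
    and D1: "((\<lambda>v. \<phi>p (\<alpha> (inv_into U1 \<phi>1 v) p)) has_derivative D1)
       (at v0 within {v \<in> \<phi>1 ` U1. \<alpha> (inv_into U1 \<phi>1 v) p \<in> Up})"
    and D1inj: "inj_on D1 SG" and D1S: "D1 ` SG \<subseteq> S"
    by (rule orbit_map_immersion[OF p])
  note c1 = charted_chart[OF charted_L C1] and cp = charted_chart[OF charted_P Cp]
  have sS: "subspace S" and sSG: "subspace SG" using charted_subspace charted_P charted_L by auto
  define i where "i = inv_into U1 \<phi>1"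
  define j where "j = inv_into Up \<phi>p"
  have iC: "i v \<in> carrier G" "\<phi>1 (i v) = v" "i v \<in> U1" if "v \<in> \<phi>1 ` U1" for v
    using top_chart_inv(3,4)[OF c1 that] top_chartD(4)[OF c1] carrier_eq unfolding i_def by auto
  have ji: "j y \<in> E" "\<phi>p (j y) = y" "j y \<in> Up" if "y \<in> \<phi>p ` Up" for y
    using top_chart_inv(3,4)[OF cp that] top_chartD(4)[OF cp] unfolding j_def by auto
  have j\<phi>: "j (\<phi>p x) = x" if "x \<in> Up" for x using top_chart_inv(2)[OF cp that] unfolding j_def .
  define g0 where "g0 = i v0"
  have g0: "g0 \<in> carrier G" using iC v0 g0_def by auto
  define p0 where "p0 = \<alpha> g0 p"
  have p0: "p0 \<in> Up" "p0 \<in> E" using v0(2) g0 p unfolding p0_def g0_def i_def by auto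
  define x0 where "x0 = \<phi>p p0"
  have D1lin: "linear D1" using D1 has_derivative_linear by blast
  let ?I = "D1 ` SG"
  have sI: "subspace ?I" using linear_subspace_image[OF D1lin sSG] .
  define S' where "S' = {y \<in> S. \<forall>x\<in>?I. orthogonal x y}"
  have sS': "subspace S'" unfolding S'_def using sS by (auto simp: subspace_def orthogonal_clauses)
  have S'S: "S' \<subseteq> S" by (auto simp: S'_def)
  have dimI: "dim ?I = dim SG" by (rule dim_image_eq[OF D1lin]) (use D1inj sSG in \<open>simp add: span_eq_iff[THEN iffD2]\<close>)
  have "dim S' + dim ?I = dim S" unfolding S'_def by (rule dim_subspace_orthogonal_to_vectors[OF sI sS D1S])
  then have dimS': "dim S' = dim S - dim SG" using dimI by simp
  have IS'0: "y = 0" if "y \<in> ?I" "y \<in> S'" for y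
    using that orthogonal_self[of y] by (auto simp: S'_def)
  have dec: "\<exists>a\<in>?I. \<exists>b\<in>S'. y = a + b" if y: "y \<in> S" for y
  proof -
    obtain a b where ab: "a \<in> span ?I" "\<And>w. w \<in> span ?I \<Longrightarrow> orthogonal b w" "y = a + b"
      using orthogonal_subspace_decomp_exists[of ?I y] by blast
    have a: "a \<in> ?I" using ab(1) sI by (simp only: span_eq_iff[THEN iffD2])
    have "b \<in> S" using subspace_diff[OF sS y, of a] a D1S ab(3) by auto
    moreover have "orthogonal x b" if "x \<in> ?I" for x
      using ab(2)[OF span_base[OF that]] orthogonal_commute by blast
    ultimately have "b \<in> S'" unfolding S'_def by blast
    then show ?thesis using a ab(3) by blast
  qed
  define A0 where "A0 = {s \<in> S'. x0 + s \<in> \<phi>p ` Up}"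
  have RUp: "open_in_subspace S (\<phi>p ` Up)" by (rule top_chart_rel_open[OF cp sS])
  have x0S: "x0 \<in> S" using p0 open_in_subspaceD(3)[OF RUp] unfolding x0_def by blast
  have RS': "open_in_subspace S' S'" using sS' by (simp add: open_in_subspace_def)
  have RA0: "open_in_subspace S' A0" unfolding A0_def
    by (rule open_in_subspace_vimage[OF RS' RUp]) (use S'S x0S sS in \<open>auto intro!: continuous_intros subspace_add\<close>)
  have A00: "0 \<in> A0" using subspace_0[OF sS'] p0 by (simp add: A0_def x0_def)
  define \<sigma> where "\<sigma> = (\<lambda>s. j (x0 + s))"
  have \<sigma>E: "\<sigma> s \<in> E" "\<sigma> s \<in> Up" "\<phi>p (\<sigma> s) = x0 + s" if "s \<in> A0" for s
    using ji that unfolding \<sigma>_def A0_def by auto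
  have \<sigma>0: "\<sigma> 0 = p0" unfolding \<sigma>_def x0_def using j\<phi> p0 by simp
  have pl\<sigma>: "plot P S' A0 \<sigma>"
    unfolding \<sigma>_def j_def
    by (rule plot_compose[OF charted_P plot_chart[OF P Cp] RA0])
       (auto simp: A0_def intro!: smooth_on_add smooth_on_const smooth_on_id RA0[unfolded A0_def])
  let ?M = "SG \<times> S'"
  let ?W0 = "\<phi>1 ` U1 \<times> A0"
  have RU1: "open_in_subspace SG (\<phi>1 ` U1)" by (rule top_chart_rel_open[OF c1 sSG])
  have R0: "open_in_subspace ?M ?W0"
    using RU1 RA0 sSG sS' unfolding open_in_subspace_def by (auto intro: subspace_Times openin_Times)
  \<comment> \<open>The factor \<open>inv g0\<close> makes the group element at \<open>v0\<close>
    act trivially: \<open>c (v0, s)\<close> is the slice itself, while \<open>c (v, 0)\<close> runs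
    through the orbit of \<open>p\<close>.\<close>
  define c where "c = (\<lambda>z. \<alpha> (i (fst z)) (\<alpha> (inv g0) (\<sigma> (snd z))))"
  have plc: "plot P ?M ?W0 c"
    unfolding c_def
  proof (rule plot_act2, unfold i_def)
    show "plot L ?M ?W0 (\<lambda>z. inv_into U1 \<phi>1 (fst z))"
      by (rule plot_compose[OF charted_L plot_chart[OF smooth_manifold_L C1] R0]) (auto intro!: smooth_on_linear_map[OF R0] bounded_linear_fst)
    show "plot P ?M ?W0 (\<lambda>z. \<alpha> (inv g0) (\<sigma> (snd z)))"
      by (rule plot_act, use g0 in simp)
        (rule plot_compose[OF charted_P pl\<sigma> R0], auto intro!: smooth_on_linear_map[OF R0] bounded_linear_snd)
  qed
  have c1v: "c (v, 0) = \<alpha> (i v) p" for v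
    unfolding c_def using \<sigma>0 g0 p by (simp add: p0_def)
  have c2s: "c (v0, s) = \<sigma> s" if "s \<in> A0" for s
    unfolding c_def using \<sigma>E[OF that] g0 by (simp add: g0_def)
  define W where "W = {z \<in> ?W0. c z \<in> Up}"
  have RW: "open_in_subspace ?M W" unfolding W_def by (rule plot_preimage[OF plc top_chartD(1)[OF cp]])
  define \<Theta> where "\<Theta> = (\<lambda>z. \<phi>p (c z))"
  have plcW: "plot P ?M W c" by (rule plot_subset[OF charted_P plc RW]) (auto simp: W_def)
  have sm\<Theta>: "smooth_on ?M W \<Theta>" unfolding \<Theta>_def
    by (rule plot_in_chart[OF plcW Cp]) (auto simp: W_def)
  have \<Theta>S: "\<Theta> ` W \<subseteq> S" using open_in_subspaceD(3)[OF RUp] unfolding \<Theta>_def W_def by blast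
  have \<Theta>2: "\<Theta> (v0, s) = x0 + s" if "s \<in> A0" for s unfolding \<Theta>_def c2s[OF that] using \<sigma>E[OF that] by simp
  have W2: "(v0, s) \<in> W" if "s \<in> A0" for s using that v0(1) c2s[OF that] \<sigma>E[OF that] by (simp add: W_def)
  have w0: "(v0, 0) \<in> W" using W2[OF A00] .
  define D where "D = frechet_derivative \<Theta> (at (v0, 0) within W)"
  have D: "(\<Theta> has_derivative D) (at (v0, 0) within W)"
    unfolding D_def by (rule smooth_on_has_derivative[OF sm\<Theta> w0])
  have Dlin: "linear D" using D has_derivative_linear by blast
  let ?W1 = "{v \<in> \<phi>1 ` U1. \<alpha> (i v) p \<in> Up}"
  have Da: "D (v, 0) = D1 v" if v: "v \<in> SG" for v
  proof -
    have im: "(\<lambda>v. (v, 0)) ` ?W1 \<subseteq> W" using A00 c1v by (auto simp: W_def)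
    have v0W: "v0 \<in> ?W1" using v0 unfolding i_def by simp
    have "((\<lambda>v. (v, 0::'e)) has_derivative (\<lambda>v. (v, 0))) (at v0 within ?W1)"
      by (auto intro!: derivative_eq_intros)
    from has_derivative_in_compose[OF this has_derivative_subset[OF D im]]
    have 1: "((\<lambda>v. \<Theta> (v, 0)) has_derivative (\<lambda>v. D (v, 0))) (at v0 within ?W1)" .
    have 2: "((\<lambda>v. \<Theta> (v, 0)) has_derivative D1) (at v0 within ?W1)"
      unfolding \<Theta>_def c1v using D1 unfolding i_def .
    show ?thesis by (rule has_derivative_rel_unique[OF R1[folded i_def] v0W 1 2 v])
  qed
  have Db: "D (0, s) = s" if s: "s \<in> S'" for s
  proof -
    have im: "(\<lambda>s. (v0, s)) ` A0 \<subseteq> W" using W2 by auto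
    have "((\<lambda>s. (v0, s)) has_derivative (\<lambda>s. (0, s))) (at 0 within A0)"
      by (auto intro!: derivative_eq_intros)
    from has_derivative_in_compose[OF this has_derivative_subset[OF D im]]
    have "((\<lambda>s. \<Theta> (v0, s)) has_derivative (\<lambda>s. D (0, s))) (at 0 within A0)" .
    then have 1: "((\<lambda>s. x0 + s) has_derivative (\<lambda>s. D (0, s))) (at 0 within A0)"
      by (rule has_derivative_transform[OF A00, rotated]) (simp add: \<Theta>2)
    have 2: "((\<lambda>s. x0 + s) has_derivative (\<lambda>s. s)) (at 0 within A0)"
      by (auto intro!: derivative_eq_intros)
    show ?thesis by (rule has_derivative_rel_unique[OF RA0 A00 1 2 s])
  qed
  have DD: "D (v, s) = D1 v + s" if "v \<in> SG" "s \<in> S'" for v s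
    using linear_add[OF Dlin, of "(v, 0)" "(0, s)"] Da[OF that(1)] Db[OF that(2)] by simp
  have sM: "subspace ?M" using sSG sS' by (rule subspace_Times)
  have Dinj: "inj_on D ?M"
  proof (rule inj_onI)
    fix a b assume ab: "a \<in> ?M" "b \<in> ?M" "D a = D b"
    have m: "a - b \<in> ?M" using subspace_diff[OF sM ab(1,2)] .
    then obtain v s where vs: "a - b = (v, s)" "v \<in> SG" "s \<in> S'" by (metis SigmaE)
    have "D (v, s) = 0" using linear_diff[OF Dlin, of a b] ab(3) vs(1) by simp
    then have e: "D1 v = - s" using DD[OF vs(2,3)] by (simp add: eq_neg_iff_add_eq_0)
    then have "D1 v \<in> S'" using subspace_neg[OF sS' vs(3)] by simp
    then have "D1 v = 0" using IS'0 vs(2) by blast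
    then have "v = 0" using inj_onD[OF D1inj, of v 0] linear_0[OF D1lin] vs(2) subspace_0[OF sSG] by simp
    then show "a = b" using vs(1) e \<open>D1 v = 0\<close> by (metis add.inverse_neutral eq_iff_diff_eq_0 minus_minus zero_prod_def)
  qed
  have Donto: "D ` ?M = S"
  proof
    show "D ` ?M \<subseteq> S"
    proof
      fix y assume "y \<in> D ` ?M"
      then obtain v s where vs: "v \<in> SG" "s \<in> S'" "y = D (v, s)" by auto
      have "D1 v \<in> S" "s \<in> S" using vs D1S S'S by auto
      then show "y \<in> S" unfolding vs(3) DD[OF vs(1,2)] by (rule subspace_add[OF sS])
    qed
    show "S \<subseteq> D ` ?M"
    proof
      fix y assume "y \<in> S"
      then obtain a b where "a \<in> ?I" "b \<in> S'" "y = a + b" using dec by blast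
      then obtain v where "v \<in> SG" "y = D1 v + b" by auto
      then have "y = D (v, b)" "(v, b) \<in> ?M" using DD \<open>b \<in> S'\<close> by auto
      then show "y \<in> D ` ?M" by blast
    qed
  qed
  obtain W2' V2 \<Gamma> where IFT: "open_in_subspace ?M W2'" "W2' \<subseteq> W" "(v0, 0) \<in> W2'" "open_in_subspace S V2"
    "homeomorphism W2' V2 \<Theta> \<Gamma>" "smooth_on S V2 \<Gamma>"
    using smooth_inverse_rel[OF RW sS sm\<Theta> \<Theta>S w0 D Dinj Donto] by blast
  have \<Gamma>1: "\<Gamma> (\<Theta> z) = z" "\<Theta> z \<in> V2" if "z \<in> W2'" for z using IFT(5) that unfolding homeomorphism_def by auto
  have \<Gamma>2: "\<Theta> (\<Gamma> y) = y" "\<Gamma> y \<in> W2'" if "y \<in> V2" for y using IFT(5) that unfolding homeomorphism_def by auto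
  obtain N D0 where ND: "openin (top_of_set SG) N" "v0 \<in> N" "openin (top_of_set S') D0" "0 \<in> D0" "N \<times> D0 \<subseteq> W2'"
    using Times_in_interior_subtopology[OF IFT(3) open_in_subspaceD(2)[OF IFT(1)]] by blast
  have NW: "N \<subseteq> \<phi>1 ` U1" "D0 \<subseteq> A0" using ND(2,4,5) IFT(2) unfolding W_def by auto
  have RN: "open_in_subspace SG N" and RD0: "open_in_subspace S' D0" using ND sSG sS' unfolding open_in_subspace_def by auto
  define N1 where "N1 = {g \<in> U1. \<phi>1 g \<in> N}"
  have oN1: "openin (mtop L) N1" unfolding N1_def by (rule top_chart_open_preimage[OF c1 sSG RN])
  \<comment> \<open>The neighbourhood \<open>N1\<close> of \<open>g0\<close> moved to the unit: its
    elements \<open>h\<close> are those for which \<open>h \<otimes> g0\<close> has a coordinate in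
    \<open>N\<close>.\<close>
  define N2 where "N2 = {h \<in> topspace (mtop L). h \<otimes> g0 \<in> N1}"
  have oN2: "openin (mtop L) N2" unfolding N2_def
    by (rule openin_continuous_map_preimage[OF mult_right_continuous[OF g0] oN1])
  have oneN2: "\<one> \<in> N2" using g0 carrier_eq iC[OF v0(1)] ND(2) by (auto simp: N2_def N1_def g0_def)
  \<comment> \<open>By freeness only the unit fixes \<open>p0\<close>, and it lies in
    \<open>N2\<close>. Properness turns this into neighbourhoods of \<open>p0\<close> between which
    no element outside \<open>N2\<close> maps.\<close>
  have "\<alpha> h p0 \<noteq> p0" if "h \<in> topspace (mtop L) - N2" for h
    using act_free[of h p0] that p0 oneN2 carrier_eq by auto
  moreover have "closedin (mtop L) (topspace (mtop L) - N2)" using oN2 by blast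
  ultimately obtain B1 B2 where B: "openin (mtop P) B1" "openin (mtop P) B2" "p0 \<in> B1" "p0 \<in> B2"
    "\<And>h z. h \<in> topspace (mtop L) - N2 \<Longrightarrow> z \<in> B1 \<Longrightarrow> \<alpha> h z \<notin> B2"
    using action_separation[OF _ p0(2) p0(2)] by metis
  define A where "A = {s \<in> D0. \<sigma> s \<in> B1 \<inter> B2}"
  have pl\<sigma>D: "plot P S' D0 \<sigma>" by (rule plot_subset[OF charted_P pl\<sigma> RD0 NW(2)])
  have RA: "open_in_subspace S' A" unfolding A_def
    by (rule plot_preimage[OF pl\<sigma>D openin_Int[OF B(1,2)]])
  have AD: "A \<subseteq> D0" by (auto simp: A_def)
  have A0': "0 \<in> A" using ND(4) B \<sigma>0 by (simp add: A_def)
  have pl: "plot P S' A \<sigma>" by (rule plot_subset[OF charted_P pl\<sigma>D RA AD])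
  have inj: "inj_on (\<lambda>s. \<pi> (\<sigma> s)) A"
  proof (rule inj_onI)
    fix s t assume st: "s \<in> A" "t \<in> A" "\<pi> (\<sigma> s) = \<pi> (\<sigma> t)"
    have stA: "s \<in> A0" "t \<in> A0" "s \<in> D0" "t \<in> D0" using st AD NW by auto
    obtain h where h: "h \<in> carrier G" "\<sigma> t = \<alpha> h (\<sigma> s)" using orbit_eq_iff \<sigma>E(1) stA st(3) by blast
    \<comment> \<open>The group element joining two slice points on one orbit is thus close to the
      unit and has a coordinate \<open>?v\<close>. Then \<open>(?v, s)\<close> and
      \<open>(v0, t)\<close> have the same image under \<Theta>, which is injective on
      \<open>W2'\<close>.\<close>
    have "h \<in> N2" using B(5)[of h "\<sigma> s"] st h carrier_eq unfolding A_def by auto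
    then have hN: "h \<otimes> g0 \<in> U1" "\<phi>1 (h \<otimes> g0) \<in> N" unfolding N2_def N1_def by auto
    let ?v = "\<phi>1 (h \<otimes> g0)"
    have "i ?v = h \<otimes> g0" unfolding i_def using top_chart_inv(2)[OF c1 hN(1)] .
    then have "c (?v, s) = \<sigma> t"
      unfolding c_def using h g0 \<sigma>E(1)[OF stA(1)] by (simp add: act_mult)
    then have "\<Theta> (?v, s) = \<Theta> (v0, t)" unfolding \<Theta>_def c2s[OF stA(2)] by simp
    moreover have "(?v, s) \<in> W2'" "(v0, t) \<in> W2'" using ND hN stA by auto
    ultimately have "(?v, s) = (v0, t)" using \<Gamma>1(1) by metis
    then show "s = t" by simp
  qed
  have \<pi>p: "\<exists>s\<in>A. \<pi> (\<sigma> s) = \<pi> p" using A0' \<sigma>0 g0 p by (intro bexI[of _ 0]) (simp_all add: p0_def)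
  have retr: "\<exists>V r. y \<in> V \<and> smooth_on_open P V (r :: 'p \<Rightarrow> 'e) \<and> (\<forall>z\<in>V. r z \<in> A \<and> \<pi> (\<sigma> (r z)) = \<pi> z)"
    if y: "y \<in> E" and s: "s \<in> A" "\<pi> (\<sigma> s) = \<pi> y" for y s
  proof -
    have sA: "s \<in> A0" "s \<in> D0" using s AD NW by auto
    obtain h where h: "h \<in> carrier G" "y = \<alpha> h (\<sigma> s)" using orbit_eq_iff[of "\<sigma> s" y] \<sigma>E(1)[OF sA(1)] s(2) y by blast
    \<comment> \<open>Points near \<open>y\<close> are moved back to the slice by \<open>h'\<close>
      before \<Gamma> is applied; this does not change their orbits.\<close>
    define h' where "h' = inv h"
    have h': "h' \<in> carrier G" using h h'_def by simp
    have RNA: "open_in_subspace ?M (N \<times> A)"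
      using RN RA sM unfolding open_in_subspace_def by (auto intro: openin_Times)
    have NAW: "N \<times> A \<subseteq> W2'" using ND(5) AD by auto
    define V3 where "V3 = {x \<in> V2. \<Gamma> x \<in> N \<times> A}"
    have RV3: "open_in_subspace S V3" unfolding V3_def
      by (rule open_in_subspace_vimage[OF IFT(4) RNA smooth_on_continuous[OF IFT(6)]])
         (use \<Gamma>2(2) IFT(1)[THEN open_in_subspaceD(3)] in blast)
    define V where "V = {z \<in> E. \<alpha> h' z \<in> {x \<in> Up. \<phi>p x \<in> V3}}"
    have oV: "openin (mtop P) V" unfolding V_def
      by (rule openin_continuous_map_preimage[OF act_continuous[OF h'] top_chart_open_preimage[OF cp sS RV3]])
    define r where "r = (\<lambda>z. snd (\<Gamma> (\<phi>p (\<alpha> h' z))))"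
    have yh: "\<alpha> h' y = \<sigma> s" using h \<sigma>E(1)[OF sA(1)] by (simp add: h'_def)
    have vs: "(v0, s) \<in> N \<times> A" using ND(2) s(1) by auto
    then have "\<Gamma> (x0 + s) = (v0, s)" "x0 + s \<in> V2" using \<Gamma>1[of "(v0, s)"] \<Theta>2[OF sA(1)] NAW by auto
    then have yV: "y \<in> V" using y yh \<sigma>E[OF sA(1)] vs by (simp add: V_def V3_def)
    have sm: "smooth_on_open P V r"
    proof (rule smooth_on_openI[OF P oV])
      fix B and k :: "'e \<Rightarrow> 'p" assume k: "plot P S B k" "k ` B \<subseteq> V"
      have RB: "open_in_subspace S B" using plotD(1)[OF k(1)] .
      have 1: "smooth_on S B (\<lambda>w. \<phi>p (\<alpha> h' (k w)))"
        by (rule plot_in_chart[OF plot_act[OF h' k(1)] Cp]) (use k(2) V_def in auto)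
      have "smooth_on S B (\<lambda>w. \<Gamma> (\<phi>p (\<alpha> h' (k w))))"
        by (rule smooth_on_compose[OF RB IFT(4) _ 1 IFT(6)]) (use k(2) V_def V3_def in auto)
      then show "smooth_on S B (\<lambda>w. r (k w))"
        unfolding r_def by (rule smooth_on_linear[OF RB bounded_linear_snd])
    qed
    have "r z \<in> A \<and> \<pi> (\<sigma> (r z)) = \<pi> z" if z: "z \<in> V" for z
    proof -
      have zz: "z \<in> E" "\<alpha> h' z \<in> Up" "\<phi>p (\<alpha> h' z) \<in> V2" "\<Gamma> (\<phi>p (\<alpha> h' z)) \<in> N \<times> A"
        using z by (auto simp: V_def V3_def)
      obtain v t where vt: "\<Gamma> (\<phi>p (\<alpha> h' z)) = (v, t)" "v \<in> N" "t \<in> A" using zz(4) by auto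
      have r: "r z = t" by (simp add: r_def vt)
      have "(v, t) \<in> W" using vt NAW IFT(2) by auto
      then have cU: "c (v, t) \<in> Up" by (simp add: W_def)
      have "\<phi>p (c (v, t)) = \<phi>p (\<alpha> h' z)" using \<Gamma>2(1)[OF zz(3)] vt by (simp add: \<Theta>_def)
      then have "c (v, t) = \<alpha> h' z" using inj_onD[OF top_chart_inj_on[OF cp]] cU zz(2) by blast
      moreover have tA: "t \<in> A0" using vt AD NW by auto
      moreover have "\<pi> (c (v, t)) = \<pi> (\<sigma> t)"
        unfolding c_def using iC(1)[of v] vt(2) NW(1) \<sigma>E(1)[OF tA] g0 by auto
      ultimately have "\<pi> (\<sigma> t) = \<pi> z" using zz(1) h' by simp
      then show ?thesis using r vt by simp
    qed
    then show ?thesis using yV sm by blast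
  qed
  have "transversal S' A \<sigma>" unfolding transversal_def using pl inj retr by blast
  then show thesis by (rule that[OF sS' S'S dimS' _ \<pi>p])
qed

lemma orbit_model: "subspace T" "T \<subseteq> S"
  and dim_orbit_model: "dim T = dim S - dim SG"
proof -
  obtain T' where "subspace T'" "T' \<subseteq> S" "dim T' = dim S - dim SG"
  proof (rule choose_subspace_of_subspace[of "dim S - dim SG" S])
    fix T' assume *: "subspace T'" "T' \<subseteq> span S" "dim T' = dim S - dim SG"
    have "span S = S" using charted_subspace[OF charted_P] by (simp only: span_eq_iff)
    then have "T' \<subseteq> S" using *(2) by (simp only:)
    then show thesis using that[OF *(1) _ *(3)] by blast
  qed (rule diff_le_self)
  then have "subspace T' \<and> T' \<subseteq> S \<and> dim T' = dim S - dim SG" by blast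
  then have "subspace T \<and> T \<subseteq> S \<and> dim T = dim S - dim SG"
    unfolding orbit_model_def by (rule someI)
  then show "subspace T" "T \<subseteq> S" "dim T = dim S - dim SG" by auto
qed

text \<open>The parameter space of \<open>slice_raw\<close> depends on the point, while all charts
  of the orbit manifold share the space \<open>T\<close>. Equal dimension provides a linear isometry
  between them.\<close>

lemma slice:
  assumes p: "p \<in> E"
  obtains A \<sigma> where "transversal T A \<sigma>" "\<exists>s\<in>A. \<pi> (\<sigma> s) = \<pi> p"
proof -
  obtain S' A \<sigma> where *: "subspace S'" "S' \<subseteq> S" "dim S' = dim S - dim SG"
    "transversal S' A \<sigma>" "\<exists>s\<in>A. \<pi> (\<sigma> s) = \<pi> p"
    by (rule slice_raw[OF p])
  have pl: "plot P S' A \<sigma>" and inj: "inj_on (\<lambda>s. \<pi> (\<sigma> s)) A"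
    and retr: "\<And>y s. y \<in> E \<Longrightarrow> s \<in> A \<Longrightarrow> \<pi> (\<sigma> s) = \<pi> y \<Longrightarrow>
      \<exists>V r. y \<in> V \<and> smooth_on_open P V (r :: 'p \<Rightarrow> 'e) \<and> (\<forall>z\<in>V. r z \<in> A \<and> \<pi> (\<sigma> (r z)) = \<pi> z)"
    using *(4) unfolding transversal_def by blast+
  have "dim S' = dim T" using *(3) dim_orbit_model by simp
  from isometries_subspaces[OF *(1) orbit_model(1) this]
  obtain l m where lm: "linear l" "linear m" "l ` S' = T" "m ` T = S'"
    "\<And>x. x \<in> S' \<Longrightarrow> m (l x) = x" "\<And>y. y \<in> T \<Longrightarrow> l (m y) = y" by metis
  have lb: "bounded_linear l" "bounded_linear m" using lm(1,2) by (simp_all only: linear_conv_bounded_linear)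
  have RA: "open_in_subspace S' A" by (rule plotD(1)[OF pl])
  then have AS': "A \<subseteq> S'" by (rule open_in_subspaceD(3))
  define A' where "A' = {y \<in> T. m y \<in> A}"
  have RT: "open_in_subspace T T" using orbit_model by (simp add: open_in_subspace_def)
  have RA': "open_in_subspace T A'" unfolding A'_def
    by (rule open_in_subspace_vimage[OF RT RA]) (use lm lb in \<open>auto simp: linear_continuous_on\<close>)
  have lA: "l s \<in> A'" if "s \<in> A" for s using that AS' lm(3,5) by (auto simp: A'_def)
  have ml: "m (l s) = s" if "s \<in> A" for s using that AS' lm(5) by auto
  show thesis
  proof (rule that[of A' "\<lambda>y. \<sigma> (m y)"])
    obtain s where "s \<in> A" "\<pi> (\<sigma> s) = \<pi> p" using *(5) by blast
    then show "\<exists>s\<in>A'. \<pi> (\<sigma> (m s)) = \<pi> p" using lA ml by (intro bexI[of _ "l s"]) auto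
    show "transversal T A' (\<lambda>y. \<sigma> (m y))"
      unfolding transversal_def
    proof (intro conjI ballI impI)
      show "plot P T A' (\<lambda>y. \<sigma> (m y))"
        by (rule plot_compose[OF charted_P pl RA' smooth_on_linear_map[OF RA' lb(2)]]) (auto simp: A'_def)
      show "inj_on (\<lambda>s. \<pi> (\<sigma> (m s))) A'"
      proof (rule inj_onI)
        fix x y assume xy: "x \<in> A'" "y \<in> A'" "\<pi> (\<sigma> (m x)) = \<pi> (\<sigma> (m y))"
        then have "m x = m y" using inj_onD[OF inj] by (simp add: A'_def)
        then have "l (m x) = l (m y)" by simp
        then show "x = y" using lm(6) xy unfolding A'_def by simp
      qed
      fix y s assume y: "y \<in> E" and s: "s \<in> A'" "\<pi> (\<sigma> (m s)) = \<pi> y"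
      have "m s \<in> A" using s unfolding A'_def by blast
      from retr[OF y this s(2)] obtain V and r :: "'p \<Rightarrow> 'e" where Vr: "y \<in> V" "smooth_on_open P V r"
        "\<And>z. z \<in> V \<Longrightarrow> r z \<in> A \<and> \<pi> (\<sigma> (r z)) = \<pi> z" by blast
      have "smooth_on_open P V (\<lambda>z. l (r z))"
      proof (rule smooth_on_openI[OF P])
        show "openin (mtop P) V" using Vr(2) by (simp add: smooth_on_open_def)
        fix B and k :: "'e \<Rightarrow> 'p" assume k: "plot P S B k" "k ` B \<subseteq> V"
        show "smooth_on S B (\<lambda>w. l (r (k w)))"
          by (rule smooth_on_linear[OF plotD(1)[OF k(1)] lb(1) plot_smooth_on_open[OF charted_P Vr(2) k]])
      qed
      moreover have "l (r z) \<in> A' \<and> \<pi> (\<sigma> (m (l (r z)))) = \<pi> z" if "z \<in> V" for z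
        using Vr(3)[OF that] lA ml by auto
      ultimately show "\<exists>V r. y \<in> V \<and> smooth_on_open P V (r :: 'p \<Rightarrow> 'e) \<and> (\<forall>z\<in>V. r z \<in> A' \<and> \<pi> (\<sigma> (m (r z))) = \<pi> z)"
        using Vr(1) by blast
    qed
  qed
qed

end

section \<open>Charts of the orbit manifold\<close>

lemma smooth_on_open_preimage:
  fixes r :: "'p \<Rightarrow> 'b::real_normed_vector"
  assumes M: "charted M" and r: "smooth_on_open M V r" and B: "open B"
  shows "openin (mtop M) {x \<in> V. r x \<in> B}"
proof -
  have V: "openin (mtop M) V" using r by (simp add: smooth_on_open_def)
  have *: "openin (mtop M) {x \<in> U \<inter> V. r x \<in> B}" if C: "(U, \<phi>) \<in> atlas M" for U \<phi>
  proof -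
    note ch = charted_chart[OF M C]
    have R: "open_in_subspace (model M) (\<phi> ` (U \<inter> V))" by (rule top_chart_open_image[OF ch charted_subspace[OF M] V])
    have "smooth_on (model M) (\<phi> ` (U \<inter> V)) (\<lambda>y. r (inv_into U \<phi> y))"
      using r C by (auto simp: smooth_on_open_def)
    then have "continuous_on (\<phi> ` (U \<inter> V)) (\<lambda>y. r (inv_into U \<phi> y))" by (rule smooth_on_continuous)
    then have "openin (top_of_set (\<phi> ` (U \<inter> V))) (\<phi> ` (U \<inter> V) \<inter> (\<lambda>y. r (inv_into U \<phi> y)) -` B)"
      using B by (rule continuous_openin_preimage_gen)
    then have "open_in_subspace (model M) (\<phi> ` (U \<inter> V) \<inter> (\<lambda>y. r (inv_into U \<phi> y)) -` B)"
      using open_in_subspace_subset[OF R] by blast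
    from top_chart_open_preimage[OF ch charted_subspace[OF M] this]
    have "openin (mtop M) {x \<in> U. \<phi> x \<in> \<phi> ` (U \<inter> V) \<inter> (\<lambda>y. r (inv_into U \<phi> y)) -` B}" .
    moreover have "{x \<in> U. \<phi> x \<in> \<phi> ` (U \<inter> V) \<inter> (\<lambda>y. r (inv_into U \<phi> y)) -` B} = {x \<in> U \<inter> V. r x \<in> B}"
    proof (intro equalityI subsetI)
      fix x assume "x \<in> {x \<in> U. \<phi> x \<in> \<phi> ` (U \<inter> V) \<inter> (\<lambda>y. r (inv_into U \<phi> y)) -` B}"
      then obtain z where z: "z \<in> U" "z \<in> V" "\<phi> x = \<phi> z" and x: "x \<in> U" "r (inv_into U \<phi> (\<phi> x)) \<in> B" by blast
      have "x = z" by (rule inj_onD[OF top_chart_inj_on[OF ch] z(3) x(1) z(1)])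
      then show "x \<in> {x \<in> U \<inter> V. r x \<in> B}" using x z top_chart_inv(2)[OF ch x(1)] by simp
    qed (use top_chart_inv(2)[OF ch] in auto)
    ultimately show ?thesis by simp
  qed
  have "{x \<in> V. r x \<in> B} = (\<Union>C\<in>atlas M. {x \<in> fst C \<inter> V. r x \<in> B})"
    using M openin_subset[OF V] unfolding charted_def by auto
  moreover have "openin (mtop M) (\<Union>C\<in>atlas M. {x \<in> fst C \<inter> V. r x \<in> B})"
    using * by (intro openin_Union) auto
  ultimately show ?thesis by simp
qed

context free_proper_action begin

lemma mtop_QM: "mtop QM = Q" and model_QM: "model QM = T"
  and atlas_QM: "atlas QM = {C. top_chart Q T C \<and> submersive_chart G P \<alpha> T C}"
  unfolding orbit_manifold_def by (simp_all add: Let_def)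

lemma submersive_chartD:
  assumes "(V, \<psi>) \<in> atlas QM"
  shows "top_chart Q T (V, \<psi>)"
    "smooth_on_open P {x \<in> E. \<pi> x \<in> V} (\<lambda>x. \<psi> (\<pi> x))"
    "\<And>U \<phi> y. (U, \<phi>) \<in> atlas P \<Longrightarrow> y \<in> \<phi> ` {x \<in> U. \<pi> x \<in> V} \<Longrightarrow>
      frechet_derivative (\<lambda>y. \<psi> (\<pi> (inv_into U \<phi> y))) (at y within \<phi> ` {x \<in> U. \<pi> x \<in> V}) ` S = T"
proof -
  show t: "top_chart Q T (V, \<psi>)" using assms unfolding atlas_QM by blast
  have "openin Q V" using top_chartD(1)[OF t] .
  then have o: "openin (mtop P) {x \<in> E. \<pi> x \<in> V}" by (rule openin_continuous_map_preimage[OF orbit_continuous])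
  have s: "submersive_chart G P \<alpha> T (V, \<psi>)" using assms unfolding atlas_QM by blast
  show "smooth_on_open P {x \<in> E. \<pi> x \<in> V} (\<lambda>x. \<psi> (\<pi> x))"
  proof (rule smooth_on_open_chartI[OF o])
    fix U \<phi> assume C: "(U, \<phi>) \<in> atlas P"
    have "U \<inter> {x \<in> E. \<pi> x \<in> V} = {x \<in> U. \<pi> x \<in> V}" using top_chartD(4)[OF charted_chart[OF charted_P C]] by auto
    then show "smooth_on S (\<phi> ` (U \<inter> {x \<in> E. \<pi> x \<in> V})) (\<lambda>y. \<psi> (\<pi> (inv_into U \<phi> y)))"
      using s C unfolding submersive_chart_def Let_def by (auto simp: o_def)
  qed
  show "frechet_derivative (\<lambda>y. \<psi> (\<pi> (inv_into U \<phi> y))) (at y within \<phi> ` {x \<in> U. \<pi> x \<in> V}) ` S = T"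
    if "(U, \<phi>) \<in> atlas P" "y \<in> \<phi> ` {x \<in> U. \<pi> x \<in> V}" for U \<phi> y
    using s that unfolding submersive_chart_def Let_def prod.case o_def by blast
qed

text \<open>\<open>cdom\<close> and \<open>cmap\<close> form the chart of the orbit space given by a
  slice: the coordinate of an orbit is the parameter of its single point on the slice.\<close>

definition cdom :: "'e set \<Rightarrow> ('e \<Rightarrow> 'p) \<Rightarrow> 'p set set" where
  "cdom A \<sigma> = (\<lambda>s. \<pi> (\<sigma> s)) ` A"

definition cmap :: "'e set \<Rightarrow> ('e \<Rightarrow> 'p) \<Rightarrow> 'p set \<Rightarrow> 'e" where
  "cmap A \<sigma> = inv_into A (\<lambda>s. \<pi> (\<sigma> s))"

context
  fixes A \<sigma>
  assumes tr: "transversal T A \<sigma>"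
begin

lemma tr_plot: "plot P T A \<sigma>" and tr_inj: "inj_on (\<lambda>s. \<pi> (\<sigma> s)) A"
  using tr unfolding transversal_def by blast+

lemma tr_rel_open: "open_in_subspace T A" by (rule plotD(1)[OF tr_plot])

lemma tr_E: "s \<in> A \<Longrightarrow> \<sigma> s \<in> E" by (rule plotD(4)[OF tr_plot])

lemma cmap_quot: "s \<in> A \<Longrightarrow> cmap A \<sigma> (\<pi> (\<sigma> s)) = s"
  unfolding cmap_def by (rule inv_into_f_f[OF tr_inj])

lemma quot_cmap: "q \<in> cdom A \<sigma> \<Longrightarrow> \<pi> (\<sigma> (cmap A \<sigma> q)) = q"
  unfolding cmap_def cdom_def by (simp add: f_inv_into_f[where f="\<lambda>s. \<pi> (\<sigma> s)"])

lemma cmap_in: "q \<in> cdom A \<sigma> \<Longrightarrow> cmap A \<sigma> q \<in> A"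
  unfolding cmap_def cdom_def by (rule inv_into_into)

lemma quot_in: "s \<in> A \<Longrightarrow> \<pi> (\<sigma> s) \<in> cdom A \<sigma>"
  unfolding cdom_def by blast

lemma cmap_image: "cmap A \<sigma> ` cdom A \<sigma> = A"
  using cmap_in cmap_quot quot_in by (auto simp: image_iff) metis

lemma inv_cmap: "s \<in> A \<Longrightarrow> inv_into (cdom A \<sigma>) (cmap A \<sigma>) s = \<pi> (\<sigma> s)"
  by (rule inv_into_f_eq) (auto intro: inj_on_inverseI[of _ "\<lambda>s. \<pi> (\<sigma> s)"] simp: quot_cmap quot_in cmap_quot)

lemma tr_local:
  assumes "y \<in> E" "\<pi> y \<in> cdom A \<sigma>"
  obtains V r where "y \<in> V" "smooth_on_open P V (r :: 'p \<Rightarrow> 'e)"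
    "\<forall>z\<in>V. \<pi> z \<in> cdom A \<sigma> \<and> r z = cmap A \<sigma> (\<pi> z)"
proof -
  obtain s where "s \<in> A" "\<pi> (\<sigma> s) = \<pi> y" using assms(2) unfolding cdom_def by auto
  then obtain V and r :: "'p \<Rightarrow> 'e" where Vr: "y \<in> V" "smooth_on_open P V r" "\<forall>z\<in>V. r z \<in> A \<and> \<pi> (\<sigma> (r z)) = \<pi> z"
    using tr assms(1) unfolding transversal_def by blast
  show thesis
    by (rule that[OF Vr(1,2)]) (metis Vr(3) quot_in cmap_quot)
qed

lemma cdom_preimage_open: "openin (mtop P) {x \<in> E. \<pi> x \<in> cdom A \<sigma>}"
proof (subst openin_subopen, intro ballI)
  fix y assume "y \<in> {x \<in> E. \<pi> x \<in> cdom A \<sigma>}"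
  then have y: "y \<in> E" "\<pi> y \<in> cdom A \<sigma>" by auto
  obtain V and r :: "'p \<Rightarrow> 'e" where Vr: "y \<in> V" "smooth_on_open P V r"
    "\<forall>z\<in>V. \<pi> z \<in> cdom A \<sigma> \<and> r z = cmap A \<sigma> (\<pi> z)"
    by (rule tr_local[OF y])
  then have "openin (mtop P) V" by (simp add: smooth_on_open_def)
  then show "\<exists>V. openin (mtop P) V \<and> y \<in> V \<and> V \<subseteq> {x \<in> E. \<pi> x \<in> cdom A \<sigma>}"
    using Vr openin_subset by (intro exI[of _ V]) auto
qed

lemma cmap_smooth: "smooth_on_open P {x \<in> E. \<pi> x \<in> cdom A \<sigma>} (\<lambda>x. cmap A \<sigma> (\<pi> x))"
proof (rule smooth_on_openI[OF P cdom_preimage_open])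
  fix W and k :: "'e \<Rightarrow> 'p"
  assume k: "plot P S W k" "k ` W \<subseteq> {x \<in> E. \<pi> x \<in> cdom A \<sigma>}"
  show "smooth_on S W (\<lambda>w. cmap A \<sigma> (\<pi> (k w)))"
  proof (rule smooth_on_local_rel[OF plotD(1)[OF k(1)]])
    fix w assume w: "w \<in> W"
    then have y: "k w \<in> E" "\<pi> (k w) \<in> cdom A \<sigma>" using k(2) by auto
    obtain V and r :: "'p \<Rightarrow> 'e" where Vr: "k w \<in> V" "smooth_on_open P V r"
      "\<forall>z\<in>V. \<pi> z \<in> cdom A \<sigma> \<and> r z = cmap A \<sigma> (\<pi> z)"
      by (rule tr_local[OF y])
    let ?W = "{w \<in> W. k w \<in> V}"
    have R: "open_in_subspace S ?W" by (rule plot_preimage[OF k(1)]) (use Vr(2) in \<open>simp add: smooth_on_open_def\<close>)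
    have "smooth_on S ?W (\<lambda>w. r (k w))"
      by (rule plot_smooth_on_open[OF charted_P Vr(2) plot_subset[OF charted_P k(1) R]]) auto
    then have "smooth_on S ?W (\<lambda>w. cmap A \<sigma> (\<pi> (k w)))"
      by (rule smooth_on_cong_imp) (use Vr(3) in simp)
    then show "\<exists>V. w \<in> V \<and> open_in_subspace S V \<and> smooth_on S V (\<lambda>w. cmap A \<sigma> (\<pi> (k w)))"
      using R w Vr(1) by (intro exI[of _ ?W]) auto
  qed
qed

lemma quot_open_image:
  assumes A': "open_in_subspace T A'" "A' \<subseteq> A"
  shows "openin Q ((\<lambda>s. \<pi> (\<sigma> s)) ` A')"
proof -
  obtain B where B: "open B" "A' = T \<inter> B" using open_in_subspaceD(2)[OF A'(1)] by (auto simp: openin_open)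
  have AT: "A \<subseteq> T" using open_in_subspaceD(3)[OF tr_rel_open] .
  have "{x \<in> E. \<pi> x \<in> (\<lambda>s. \<pi> (\<sigma> s)) ` A'} = {x \<in> {x \<in> E. \<pi> x \<in> cdom A \<sigma>}. cmap A \<sigma> (\<pi> x) \<in> B}"
  proof (intro equalityI subsetI)
    fix x assume "x \<in> {x \<in> E. \<pi> x \<in> (\<lambda>s. \<pi> (\<sigma> s)) ` A'}"
    then obtain s where "x \<in> E" "s \<in> A'" "\<pi> x = \<pi> (\<sigma> s)" by auto
    then show "x \<in> {x \<in> {x \<in> E. \<pi> x \<in> cdom A \<sigma>}. cmap A \<sigma> (\<pi> x) \<in> B}"
      using A'(2) B(2) cmap_quot quot_in by auto
  next
    fix x assume x: "x \<in> {x \<in> {x \<in> E. \<pi> x \<in> cdom A \<sigma>}. cmap A \<sigma> (\<pi> x) \<in> B}"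
    then have "cmap A \<sigma> (\<pi> x) \<in> A'" using cmap_in AT B(2) by blast
    moreover have "\<pi> x = \<pi> (\<sigma> (cmap A \<sigma> (\<pi> x)))" using x quot_cmap by simp
    ultimately show "x \<in> {x \<in> E. \<pi> x \<in> (\<lambda>s. \<pi> (\<sigma> s)) ` A'}" using x by blast
  qed
  moreover have "openin (mtop P) {x \<in> {x \<in> E. \<pi> x \<in> cdom A \<sigma>}. cmap A \<sigma> (\<pi> x) \<in> B}"
    by (rule smooth_on_open_preimage[OF charted_P cmap_smooth B(1)])
  ultimately show ?thesis
    unfolding openin_orbit_topology using tr_E A'(2) by auto
qed

lemma quot_continuous: "continuous_map (top_of_set A) Q (\<lambda>s. \<pi> (\<sigma> s))"
  using continuous_map_compose[OF plotD(2)[OF tr_plot] orbit_continuous] by (simp add: o_def)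

lemma cdom_open: "openin Q (cdom A \<sigma>)"
  unfolding cdom_def using quot_open_image[OF tr_rel_open] by simp

lemma cdom_subset: "cdom A \<sigma> \<subseteq> topspace Q" using openin_subset[OF cdom_open] .

lemma cmap_top_chart: "top_chart Q T (cdom A \<sigma>, cmap A \<sigma>)"
proof -
  have ts: "topspace (subtopology Q (cdom A \<sigma>)) = cdom A \<sigma>" using cdom_subset by auto
  have "continuous_map (subtopology Q (cdom A \<sigma>)) (top_of_set A) (cmap A \<sigma>)"
    unfolding continuous_map_def ts
  proof (intro conjI allI impI)
    show "cmap A \<sigma> \<in> cdom A \<sigma> \<rightarrow> topspace (top_of_set A)" using cmap_in by auto
    fix A' assume A': "openin (top_of_set A) A'"
    then have sub: "A' \<subseteq> A" and R: "open_in_subspace T A'" using openin_imp_subset open_in_subspace_subset[OF tr_rel_open] by auto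
    have "{q \<in> cdom A \<sigma>. cmap A \<sigma> q \<in> A'} = (\<lambda>s. \<pi> (\<sigma> s)) ` A'"
    proof (intro equalityI subsetI)
      fix q assume "q \<in> {q \<in> cdom A \<sigma>. cmap A \<sigma> q \<in> A'}"
      then show "q \<in> (\<lambda>s. \<pi> (\<sigma> s)) ` A'" using quot_cmap[of q] by (intro image_eqI[of _ _ "cmap A \<sigma> q"]) auto
    qed (use sub quot_in cmap_quot in auto)
    then show "openin (subtopology Q (cdom A \<sigma>)) {q \<in> cdom A \<sigma>. cmap A \<sigma> q \<in> A'}"
      using quot_open_image[OF R sub] cdom_open by (metis (no_types, lifting) openin_open_subtopology mem_Collect_eq subsetI)
  qed
  moreover have "continuous_map (top_of_set A) (subtopology Q (cdom A \<sigma>)) (\<lambda>s. \<pi> (\<sigma> s))"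
    using quot_continuous quot_in by (auto simp: continuous_map_in_subtopology)
  ultimately have "homeomorphic_maps (subtopology Q (cdom A \<sigma>)) (top_of_set A) (cmap A \<sigma>) (\<lambda>s. \<pi> (\<sigma> s))"
    unfolding homeomorphic_maps_def ts using quot_cmap cmap_quot by simp
  then have "homeomorphic_map (subtopology Q (cdom A \<sigma>)) (top_of_set A) (cmap A \<sigma>)"
    by (rule homeomorphic_maps_imp_map)
  then show ?thesis
    unfolding top_chart_def prod.case cmap_image using cdom_open open_in_subspaceD(2)[OF tr_rel_open] by blast
qed

text \<open>A translate of the slice by a group element passes through any given point over the
  chart, and in coordinates it is a right inverse of the projection. By the chain rule the
  derivative of the projection has a right inverse on \<open>T\<close>, hence is onto.\<close>

lemma cmap_submersive: "submersive_chart G P \<alpha> T (cdom A \<sigma>, cmap A \<sigma>)"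
  unfolding submersive_chart_def prod.case Let_def
proof (intro ballI, clarify, intro conjI ballI)
  fix U \<phi> assume C: "(U, \<phi>) \<in> atlas P"
  note ch = charted_chart[OF charted_P C]
  let ?V = "{x \<in> E. \<pi> x \<in> cdom A \<sigma>}"
  let ?W = "\<phi> ` {x \<in> U. \<pi> x \<in> cdom A \<sigma>}"
  have eq: "?W = \<phi> ` (U \<inter> ?V)" using top_chartD(4)[OF ch] by auto
  have RW: "open_in_subspace S ?W" unfolding eq by (rule top_chart_open_image[OF ch charted_subspace[OF charted_P] cdom_preimage_open])
  let ?h = "cmap A \<sigma> \<circ> \<pi> \<circ> inv_into U \<phi>"
  show sm: "smooth_on S ?W ?h"
    using cmap_smooth C unfolding smooth_on_open_def eq by (auto simp: o_def)
  fix y assume y: "y \<in> ?W"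
  then obtain x where x: "x \<in> U" "\<pi> x \<in> cdom A \<sigma>" "y = \<phi> x" by auto
  have xE: "x \<in> E" using x(1) top_chartD(4)[OF ch] by auto
  define s where "s = cmap A \<sigma> (\<pi> x)"
  have s: "s \<in> A" "\<pi> (\<sigma> s) = \<pi> x" using cmap_in[OF x(2)] quot_cmap[OF x(2)] by (auto simp: s_def)
  obtain g where g: "g \<in> carrier G" "x = \<alpha> g (\<sigma> s)" using orbit_eq_iff[OF tr_E[OF s(1)] xE] s(2) by blast
  let ?A = "{t \<in> A. \<alpha> g (\<sigma> t) \<in> U}"
  have pg: "plot P T A (\<lambda>t. \<alpha> g (\<sigma> t))" by (rule plot_act[OF g(1) tr_plot])
  have RA: "open_in_subspace T ?A" by (rule plot_preimage[OF pg top_chartD(1)[OF ch]])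
  have sA: "s \<in> ?A" using s g x by simp
  have kW: "\<phi> (\<alpha> g (\<sigma> t)) \<in> ?W" "?h (\<phi> (\<alpha> g (\<sigma> t))) = t" if "t \<in> ?A" for t
    using that quot_in[of t] tr_E[of t] g(1) top_chart_inv(2)[OF ch] cmap_quot[of t] by auto
  let ?k = "\<lambda>t. \<phi> (\<alpha> g (\<sigma> t))"
  have smk: "smooth_on T ?A ?k" using plotD(3)[OF pg C] .
  define Dh where "Dh = frechet_derivative ?h (at y within ?W)"
  define Dk where "Dk = frechet_derivative ?k (at s within ?A)"
  have Dk: "(?k has_derivative Dk) (at s within ?A)" unfolding Dk_def by (rule smooth_on_has_derivative[OF smk sA])
  have ys: "?k s = y" using g(2) x(3) by simp
  have Dh: "(?h has_derivative Dh) (at y within ?W)" unfolding Dh_def by (rule smooth_on_has_derivative[OF sm y])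
  have im: "?k ` ?A \<subseteq> ?W" using kW(1) by blast
  have "(?h has_derivative Dh) (at (?k s) within ?k ` ?A)" unfolding ys by (rule has_derivative_subset[OF Dh im])
  from has_derivative_in_compose[OF Dk this]
  have "((\<lambda>t. ?h (?k t)) has_derivative (\<lambda>v. Dh (Dk v))) (at s within ?A)" .
  then have id: "((\<lambda>t. t) has_derivative (\<lambda>v. Dh (Dk v))) (at s within ?A)"
    by (rule has_derivative_transform[OF sA, rotated]) (simp only: kW(2))
  have inv: "Dh (Dk v) = v" if "v \<in> T" for v
    by (rule has_derivative_rel_unique[OF RA sA id has_derivative_ident that])
  have WS: "?W \<subseteq> S" by (rule open_in_subspaceD(3)[OF RW])
  have DkS: "Dk v \<in> S" if "v \<in> T" for v
    by (rule derivative_in_subspace[OF RA sA Dk _ charted_subspace[OF charted_P] that]) (use im WS in blast)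
  have "Dh ` S = T"
  proof (intro equalityI subsetI)
    fix v assume v: "v \<in> T"
    show "v \<in> Dh ` S" using imageI[OF DkS[OF v], of Dh] unfolding inv[OF v] .
  next
    have hT: "?h ` ?W \<subseteq> T"
    proof
      fix z assume "z \<in> ?h ` ?W"
      then obtain x where "x \<in> U" "\<pi> x \<in> cdom A \<sigma>" "z = cmap A \<sigma> (\<pi> x)"
        using top_chart_inv(2)[OF ch] by auto
      then show "z \<in> T" using cmap_in open_in_subspaceD(3)[OF tr_rel_open] by blast
    qed
    fix v assume "v \<in> Dh ` S"
    then obtain w where w: "w \<in> S" and v: "v = Dh w" by (rule imageE)
    show "v \<in> T" unfolding v by (rule derivative_in_subspace[OF RW y Dh hT orbit_model(1) w])
  qed
  then show "frechet_derivative ?h (at y within ?W) ` S = T" unfolding Dh_def .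
qed

lemma cmap_atlas: "(cdom A \<sigma>, cmap A \<sigma>) \<in> atlas QM"
  unfolding atlas_QM using cmap_top_chart cmap_submersive by blast

context
  fixes V2 \<psi>2
  assumes D: "(V2, \<psi>2) \<in> atlas QM"
begin

lemma cmap_image_Int: "cmap A \<sigma> ` (cdom A \<sigma> \<inter> V2) = {s \<in> A. \<pi> (\<sigma> s) \<in> V2}"
proof (intro equalityI subsetI)
  fix s assume "s \<in> {s \<in> A. \<pi> (\<sigma> s) \<in> V2}"
  then show "s \<in> cmap A \<sigma> ` (cdom A \<sigma> \<inter> V2)" using cmap_quot quot_in by (metis (mono_tags, lifting) IntI image_eqI mem_Collect_eq)
qed (use cmap_in quot_cmap in auto)

lemma overlap_rel_open: "open_in_subspace T {s \<in> A. \<pi> (\<sigma> s) \<in> V2}"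
  by (rule open_in_subspace_continuous_preimage[OF tr_rel_open quot_continuous top_chartD(1)[OF submersive_chartD(1)[OF D]]])

lemma overlap_smooth: "smooth_on T {s \<in> A. \<pi> (\<sigma> s) \<in> V2} (\<lambda>s. \<psi>2 (\<pi> (\<sigma> s)))"
  by (rule plot_smooth_on_open[OF charted_P submersive_chartD(2)[OF D] plot_subset[OF charted_P tr_plot overlap_rel_open]])
     (use tr_E in auto)

lemma transition_from: "smooth_transition T (cdom A \<sigma>, cmap A \<sigma>) (V2, \<psi>2)"
  unfolding smooth_transition_def prod.case cmap_image_Int
  by (rule smooth_on_cong_imp[OF overlap_smooth]) (simp add: inv_cmap)

text \<open>A chart of the atlas comes without a section to compose with, so this transition is
  obtained by inverting the other one, \<tau>. The derivative of the submersion \<psi>2 \<pi>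
  factors through that of \<tau> and is onto \<open>T\<close>; hence that of \<tau> is onto
  \<open>T\<close>, and bijective on \<open>T\<close> by dimension.\<close>

lemma transition_to: "smooth_transition T (V2, \<psi>2) (cdom A \<sigma>, cmap A \<sigma>)"
  unfolding smooth_transition_def prod.case
proof (rule smooth_on_local_rel)
  note d = submersive_chartD(1)[OF D]
  show R3: "open_in_subspace T (\<psi>2 ` (V2 \<inter> cdom A \<sigma>))"
    by (rule top_chart_open_image[OF d orbit_model(1) cdom_open])
  let ?A = "{s \<in> A. \<pi> (\<sigma> s) \<in> V2}"
  let ?\<tau> = "\<lambda>s. \<psi>2 (\<pi> (\<sigma> s))"
  have \<tau>T: "?\<tau> ` ?A \<subseteq> T" using open_in_subspaceD(3)[OF top_chart_rel_open[OF d orbit_model(1)]] by blast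
  fix y assume "y \<in> \<psi>2 ` (V2 \<inter> cdom A \<sigma>)"
  then obtain q where q: "q \<in> V2" "q \<in> cdom A \<sigma>" "y = \<psi>2 q" by auto
  define s where "s = cmap A \<sigma> q"
  have s: "s \<in> A" "\<pi> (\<sigma> s) = q" using cmap_in[OF q(2)] quot_cmap[OF q(2)] by (auto simp: s_def)
  have sA: "s \<in> ?A" using s q by simp
  obtain U \<phi> where C: "(U, \<phi>) \<in> atlas P" "\<sigma> s \<in> U" using charted_cover[OF charted_P tr_E[OF s(1)]] by blast
  note ch = charted_chart[OF charted_P C(1)]
  define W where "W = \<phi> ` {x \<in> U. \<pi> x \<in> V2 \<and> \<pi> x \<in> cdom A \<sigma>}"
  let ?W2 = "\<phi> ` {x \<in> U. \<pi> x \<in> V2}"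
  let ?W1 = "\<phi> ` {x \<in> U. \<pi> x \<in> cdom A \<sigma>}"
  have eqs: "?W2 = \<phi> ` (U \<inter> {x \<in> E. \<pi> x \<in> V2})" "?W1 = \<phi> ` (U \<inter> {x \<in> E. \<pi> x \<in> cdom A \<sigma>})"
    "W = \<phi> ` (U \<inter> ({x \<in> E. \<pi> x \<in> V2} \<inter> {x \<in> E. \<pi> x \<in> cdom A \<sigma>}))"
    using top_chartD(4)[OF ch] unfolding W_def by auto
  have oV2: "openin (mtop P) {x \<in> E. \<pi> x \<in> V2}" by (rule openin_continuous_map_preimage[OF orbit_continuous top_chartD(1)[OF d]])
  have RW2: "open_in_subspace S ?W2" unfolding eqs(1) by (rule top_chart_open_image[OF ch charted_subspace[OF charted_P] oV2])
  have RW1: "open_in_subspace S ?W1" unfolding eqs(2) by (rule top_chart_open_image[OF ch charted_subspace[OF charted_P] cdom_preimage_open])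
  have RW: "open_in_subspace S W" unfolding eqs(3)
    by (rule top_chart_open_image[OF ch charted_subspace[OF charted_P] openin_Int[OF oV2 cdom_preimage_open]])
  have WW: "W \<subseteq> ?W2" "W \<subseteq> ?W1" unfolding W_def by auto
  define x where "x = \<phi> (\<sigma> s)"
  have xW: "x \<in> W" unfolding x_def W_def using C(2) s q by auto
  let ?h2 = "\<lambda>y. \<psi>2 (\<pi> (inv_into U \<phi> y))"
  let ?h1 = "\<lambda>y. cmap A \<sigma> (\<pi> (inv_into U \<phi> y))"
  have sm2: "smooth_on S ?W2 ?h2" using submersive_chartD(2)[OF D] C(1) unfolding smooth_on_open_def eqs by auto
  have sm1: "smooth_on S ?W1 ?h1" using cmap_smooth C(1) unfolding smooth_on_open_def eqs by auto
  define D2 where "D2 = frechet_derivative ?h2 (at x within ?W2)"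
  define D1 where "D1 = frechet_derivative ?h1 (at x within ?W1)"
  define D\<tau> where "D\<tau> = frechet_derivative ?\<tau> (at s within ?A)"
  have D2: "(?h2 has_derivative D2) (at x within W)"
    unfolding D2_def using has_derivative_subset[OF smooth_on_has_derivative[OF sm2] WW(1)] xW WW by blast
  have D1: "(?h1 has_derivative D1) (at x within W)"
    unfolding D1_def using has_derivative_subset[OF smooth_on_has_derivative[OF sm1] WW(2)] xW WW by blast
  have D\<tau>: "(?\<tau> has_derivative D\<tau>) (at s within ?A)" unfolding D\<tau>_def by (rule smooth_on_has_derivative[OF overlap_smooth sA])
  have h1: "?h1 z \<in> ?A" "?\<tau> (?h1 z) = ?h2 z" if "z \<in> W" for z
    using that top_chart_inv(2)[OF ch] cmap_in quot_cmap unfolding W_def by auto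
  have h1x: "?h1 x = s" unfolding x_def using top_chart_inv(2)[OF ch C(2)] cmap_quot[OF s(1)] by simp
  have "?h1 ` W \<subseteq> ?A" using h1(1) by blast
  then have "(?\<tau> has_derivative D\<tau>) (at (?h1 x) within ?h1 ` W)" unfolding h1x by (rule has_derivative_subset[OF D\<tau>])
  from has_derivative_in_compose[OF D1 this]
  have "((\<lambda>z. ?\<tau> (?h1 z)) has_derivative (\<lambda>v. D\<tau> (D1 v))) (at x within W)" .
  then have D2': "(?h2 has_derivative (\<lambda>v. D\<tau> (D1 v))) (at x within W)"
    by (rule has_derivative_transform[OF xW, rotated]) (simp only: h1(2))
  have h1T: "?h1 ` W \<subseteq> T" using h1(1) open_in_subspaceD(3)[OF tr_rel_open] by blast
  have D2e: "D2 v = D\<tau> (D1 v)" if "v \<in> S" for v by (rule has_derivative_rel_unique[OF RW xW D2 D2' that])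
  have D1T: "D1 v \<in> T" if "v \<in> S" for v by (rule derivative_in_subspace[OF RW xW D1 h1T orbit_model(1) that])
  have D2S: "D2 ` S = T" unfolding D2_def using submersive_chartD(3)[OF D C(1)] xW WW(1) by blast
  have "T \<subseteq> D\<tau> ` T"
  proof
    fix v assume "v \<in> T"
    then obtain w where w: "w \<in> S" and v: "v = D2 w" unfolding D2S[symmetric] by (rule imageE)
    show "v \<in> D\<tau> ` T" unfolding v D2e[OF w] using D1T[OF w] by (rule imageI)
  qed
  moreover have "D\<tau> ` T \<subseteq> T"
  proof
    fix v assume "v \<in> D\<tau> ` T"
    then obtain w where w: "w \<in> T" and v: "v = D\<tau> w" by (rule imageE)
    show "v \<in> T" unfolding v by (rule derivative_in_subspace[OF overlap_rel_open sA D\<tau> \<tau>T orbit_model(1) w])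
  qed
  ultimately have onto: "D\<tau> ` T = T" by blast
  have inj: "inj_on D\<tau> T"
    by (rule linear_inj_on_if_dim_le[OF has_derivative_linear[OF D\<tau>] orbit_model(1)]) (simp only: onto order_refl)
  obtain Wn Vn g where IFT: "open_in_subspace T Wn" "Wn \<subseteq> ?A" "s \<in> Wn" "open_in_subspace T Vn" "homeomorphism Wn Vn ?\<tau> g" "smooth_on T Vn g"
    by (rule smooth_inverse_rel[OF overlap_rel_open orbit_model(1) overlap_smooth \<tau>T sA D\<tau> inj onto])
  have yV: "y \<in> Vn" using IFT(3,5) s q(3) unfolding homeomorphism_def by auto
  have "smooth_on T Vn (cmap A \<sigma> \<circ> inv_into V2 \<psi>2)"
  proof (rule smooth_on_cong_imp[OF IFT(6)])
    fix z assume "z \<in> Vn"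
    then have z: "g z \<in> ?A" "?\<tau> (g z) = z" using IFT(2,5) unfolding homeomorphism_def by auto
    then have "inv_into V2 \<psi>2 z = \<pi> (\<sigma> (g z))" using top_chart_inv(2)[OF d] by (metis (mono_tags, lifting) mem_Collect_eq)
    then show "g z = (cmap A \<sigma> \<circ> inv_into V2 \<psi>2) z" using cmap_quot z(1) by simp
  qed
  then show "\<exists>V. y \<in> V \<and> open_in_subspace T V \<and> smooth_on T V (cmap A \<sigma> \<circ> inv_into V2 \<psi>2)"
    using yV IFT(4) by blast
qed

end

text \<open>Admits slice charts in Whitney neighbourhoods, whose charts come from the maximal
  atlas.\<close>

lemma cmap_maximal: "(cdom A \<sigma>, cmap A \<sigma>) \<in> maximal_atlas QM"
  unfolding maximal_atlas_def mtop_QM model_QM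
  using cmap_top_chart transition_from transition_to by auto

end

end

section \<open>Smooth functions on the orbit manifold\<close>

lemma smooth_funI:
  assumes "\<And>U \<phi>. (U, \<phi>) \<in> atlas M \<Longrightarrow> smooth_on (model M) (\<phi> ` U) (\<lambda>y. f (inv_into U \<phi> y))"
  shows "smooth_fun M f"
  using assms unfolding smooth_fun_def o_def by blast

lemma smooth_funD:
  assumes "smooth_fun M f" "(U, \<phi>) \<in> atlas M"
  shows "smooth_on (model M) (\<phi> ` U) (\<lambda>y. f (inv_into U \<phi> y))"
  using assms unfolding smooth_fun_def o_def by blast

lemma charted_rel_open: "charted M \<Longrightarrow> (U, \<phi>) \<in> atlas M \<Longrightarrow> open_in_subspace (model M) (\<phi> ` U)"
  using top_chart_rel_open charted_chart charted_subspace by blast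

lemma smooth_fun_cong:
  assumes M: "charted M" and f: "smooth_fun M f" and eq: "\<And>x. x \<in> topspace (mtop M) \<Longrightarrow> f x = g x"
  shows "smooth_fun M g"
proof (rule smooth_funI)
  fix U \<phi> assume C: "(U, \<phi>) \<in> atlas M"
  note ch = charted_chart[OF M C]
  show "smooth_on (model M) (\<phi> ` U) (\<lambda>y. g (inv_into U \<phi> y))"
    by (rule smooth_on_cong_imp[OF smooth_funD[OF f C]])
       (use top_chart_inv(3)[OF ch] top_chartD(4)[OF ch] eq in blast)
qed

lemma smooth_fun_add: "charted M \<Longrightarrow> smooth_fun M f \<Longrightarrow> smooth_fun M g \<Longrightarrow> smooth_fun M (\<lambda>x. f x + g x)"
  by (rule smooth_funI, rule smooth_on_add[OF charted_rel_open]) (auto intro: smooth_funD)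

lemma smooth_fun_mult: "charted M \<Longrightarrow> smooth_fun M f \<Longrightarrow> smooth_fun M g \<Longrightarrow> smooth_fun M (\<lambda>x. f x * g x)"
  by (rule smooth_funI, rule smooth_on_mult[OF charted_rel_open]) (auto intro: smooth_funD)

lemma smooth_fun_const: "charted M \<Longrightarrow> smooth_fun M (\<lambda>x. c)"
  by (rule smooth_funI, rule smooth_on_const[OF charted_rel_open])

lemma smooth_fun_sum:
  "charted M \<Longrightarrow> (\<And>i. i \<in> I \<Longrightarrow> smooth_fun M (f i)) \<Longrightarrow> smooth_fun M (\<lambda>x. \<Sum>i\<in>I. f i x)"
  by (rule smooth_funI, rule smooth_on_sum[OF charted_rel_open]) (auto intro: smooth_funD)

text \<open>Serves \<open>X_orbit\<close>, where two functions agree on the manifold but possibly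
  not outside it, because \<alpha> g is unrestricted there.\<close>

lemma derivation_at_cong:
  assumes M: "charted M" and D: "derivation_at M p D" and p: "p \<in> topspace (mtop M)"
    and f: "smooth_fun M f" and g: "smooth_fun M g" and eq: "\<And>x. x \<in> topspace (mtop M) \<Longrightarrow> f x = g x"
  shows "D f = D g"
proof -
  define h where "h = (\<lambda>x. f x + (-1) * g x)"
  define e where "e = (\<lambda>x. if x \<in> topspace (mtop M) then 0 else 1 :: real)"
  have ng: "smooth_fun M (\<lambda>x. (-1) * g x)" by (rule smooth_fun_mult[OF M smooth_fun_const[OF M] g])
  have h: "smooth_fun M h" unfolding h_def by (rule smooth_fun_add[OF M f ng])
  have e: "smooth_fun M e" by (rule smooth_fun_cong[OF M smooth_fun_const[OF M, of 0]]) (simp add: e_def)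
  have he: "h = (\<lambda>x. h x * e x)" using eq by (auto simp: h_def e_def)
  have "D h = D (\<lambda>x. h x * e x)" using he by simp
  also have "\<dots> = h p * D e + e p * D h" using D h e unfolding derivation_at_def by blast
  also have "\<dots> = 0" using p eq by (simp add: h_def e_def)
  finally have "D h = 0" .
  moreover have "D h = D f + D (\<lambda>x. (-1) * g x)" unfolding h_def using D f ng unfolding derivation_at_def by blast
  moreover have "D (\<lambda>x. (-1) * g x) = (-1) * D g" using D g unfolding derivation_at_def by blast
  ultimately show ?thesis by simp
qed

context free_proper_action begin

lemma chart_cover:
  assumes "q \<in> topspace Q"
  obtains A \<sigma> where "transversal T A \<sigma>" "q \<in> cdom A \<sigma>"
proof -
  obtain x where x: "x \<in> E" "q = \<pi> x" using assms unfolding topspace_Q orbits_def by auto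
  obtain A \<sigma> where "transversal T A \<sigma>" "\<exists>s\<in>A. \<pi> (\<sigma> s) = \<pi> x" by (rule slice[OF x(1)])
  then show thesis using that x(2) unfolding cdom_def by blast
qed

lemma charted_QM: "charted QM"
  unfolding charted_def mtop_QM model_QM
proof (intro conjI orbit_model ballI)
  show "top_chart Q T C" if "C \<in> atlas QM" for C using that unfolding atlas_QM by blast
  show "(\<Union>C\<in>atlas QM. fst C) = topspace Q"
  proof (intro equalityI subsetI)
    fix q assume "q \<in> topspace Q"
    then obtain A \<sigma> where A: "transversal T A \<sigma>" "q \<in> cdom A \<sigma>" by (rule chart_cover)
    show "q \<in> (\<Union>C\<in>atlas QM. fst C)" by (rule UN_I[OF cmap_atlas[OF A(1)]]) (use A(2) in simp)
  next
    fix q assume "q \<in> (\<Union>C\<in>atlas QM. fst C)"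
    then obtain V \<psi> where C: "(V, \<psi>) \<in> atlas QM" "q \<in> V" by fastforce
    then show "q \<in> topspace Q" using top_chartD(4)[OF submersive_chartD(1)[OF C(1)]] by blast
  qed
qed

lemma smooth_fun_QM_chart:
  assumes u: "smooth_fun QM u" and tr: "transversal T A \<sigma>"
  shows "smooth_on T A (\<lambda>s. u (\<pi> (\<sigma> s)))"
proof -
  have "smooth_on T A (\<lambda>y. u (inv_into (cdom A \<sigma>) (cmap A \<sigma>) y))"
    using smooth_funD[OF u cmap_atlas[OF tr]] unfolding model_QM cmap_image[OF tr] .
  then show ?thesis by (rule smooth_on_cong_imp) (simp add: inv_cmap[OF tr])
qed

text \<open>Locally \<pi> is the slice coordinate followed by \<pi> \<sigma>, so the pullback is
  \<open>u\<close> in a slice chart composed with the smooth slice coordinate.\<close>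

lemma smooth_fun_pullback:
  assumes u: "smooth_fun QM u"
  shows "smooth_fun P (\<lambda>x. u (\<pi> x))"
  unfolding smooth_fun_iff_open[OF charted_P]
proof (rule smooth_on_openI[OF P openin_topspace])
  fix W and k :: "'e \<Rightarrow> 'p"
  assume k: "plot P S W k"
  show "smooth_on S W (\<lambda>w. u (\<pi> (k w)))"
  proof (rule smooth_on_local_rel[OF plotD(1)[OF k]])
    fix w assume w: "w \<in> W"
    have kE: "k w \<in> E" using plotD(4)[OF k w] .
    then have "\<pi> (k w) \<in> topspace Q" unfolding topspace_Q by simp
    then obtain A \<sigma> where tr: "transversal T A \<sigma>" and q: "\<pi> (k w) \<in> cdom A \<sigma>" by (rule chart_cover)
    let ?W = "{w \<in> W. k w \<in> {x \<in> E. \<pi> x \<in> cdom A \<sigma>}}"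
    have R: "open_in_subspace S ?W" by (rule plot_preimage[OF k cdom_preimage_open[OF tr]])
    have 1: "smooth_on S ?W (\<lambda>w. cmap A \<sigma> (\<pi> (k w)))"
      by (rule plot_smooth_on_open[OF charted_P cmap_smooth[OF tr] plot_subset[OF charted_P k R]]) auto
    have "smooth_on S ?W (\<lambda>w. u (\<pi> (\<sigma> (cmap A \<sigma> (\<pi> (k w))))))"
      by (rule smooth_on_compose[OF R tr_rel_open[OF tr] _ 1 smooth_fun_QM_chart[OF u tr]])
         (auto simp: cmap_in[OF tr])
    then have "smooth_on S ?W (\<lambda>w. u (\<pi> (k w)))"
      by (rule smooth_on_cong_imp) (simp add: quot_cmap[OF tr])
    then show "\<exists>V. w \<in> V \<and> open_in_subspace S V \<and> smooth_on S V (\<lambda>w. u (\<pi> (k w)))"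
      using R w kE q by (intro exI[of _ ?W]) auto
  qed
qed

text \<open>\<open>smooth_fun\<close> refers to the atlas, the Whitney topology to the maximal
  atlas. Near each point the change of charts goes through a slice chart.\<close>

lemma smooth_fun_maximal:
  assumes u: "smooth_fun QM u" and C: "(U, \<phi>) \<in> maximal_atlas QM"
  shows "open_in_subspace T (\<phi> ` U)" "smooth_on T (\<phi> ` U) (\<lambda>y. u (inv_into U \<phi> y))"
proof -
  have ch: "top_chart Q T (U, \<phi>)" using C unfolding maximal_atlas_def mtop_QM model_QM by blast
  show R: "open_in_subspace T (\<phi> ` U)" by (rule top_chart_rel_open[OF ch orbit_model(1)])
  show "smooth_on T (\<phi> ` U) (\<lambda>y. u (inv_into U \<phi> y))"
  proof (rule smooth_on_local_rel[OF R])
    fix y assume y: "y \<in> \<phi> ` U"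
    let ?q = "inv_into U \<phi> y"
    have q: "?q \<in> U" "\<phi> ?q = y" using top_chart_inv(3,4)[OF ch y] by auto
    then have "?q \<in> topspace Q" using top_chartD(4)[OF ch] by blast
    then obtain A \<sigma> where tr: "transversal T A \<sigma>" and qA: "?q \<in> cdom A \<sigma>" by (rule chart_cover)
    let ?W = "\<phi> ` (U \<inter> cdom A \<sigma>)"
    have RW: "open_in_subspace T ?W" by (rule top_chart_open_image[OF ch orbit_model(1) cdom_open[OF tr]])
    have 1: "smooth_on T ?W (\<lambda>y. cmap A \<sigma> (inv_into U \<phi> y))"
      using C cmap_atlas[OF tr] unfolding maximal_atlas_def smooth_transition_def model_QM by (fastforce simp: o_def)
    have iW: "inv_into U \<phi> z \<in> cdom A \<sigma>" if "z \<in> ?W" for z using that top_chart_inv(2)[OF ch] by auto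
    have "smooth_on T ?W (\<lambda>y. u (\<pi> (\<sigma> (cmap A \<sigma> (inv_into U \<phi> y)))))"
      by (rule smooth_on_compose[OF RW tr_rel_open[OF tr] _ 1 smooth_fun_QM_chart[OF u tr]])
         (use iW cmap_in[OF tr] in blast)
    then have sm: "smooth_on T ?W (\<lambda>y. u (inv_into U \<phi> y))"
      by (rule smooth_on_cong_imp) (simp add: quot_cmap[OF tr] iW)
    have "\<phi> ?q \<in> ?W" by (rule imageI) (use q(1) qA in blast)
    then have yW: "y \<in> ?W" unfolding q(2) .
    show "\<exists>V. y \<in> V \<and> open_in_subspace T V \<and> smooth_on T V (\<lambda>y. u (inv_into U \<phi> y))"
      by (rule exI[of _ ?W], rule conjI[OF yW conjI[OF RW sm]])
  qed
qed

lemma quot_compact: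
  assumes tr: "transversal T A \<sigma>" and K: "compact K" "K \<subseteq> A"
  shows "compactin Q ((\<lambda>s. \<pi> (\<sigma> s)) ` K)"
proof -
  have "compactin (top_of_set A) K" using K by (simp add: compactin_subtopology)
  then show ?thesis using image_compactin quot_continuous[OF tr] by blast
qed

text \<open>The image of \<open>K\<close> is compact, hence closed because the orbit space is
  Hausdorff. Off it the function is locally zero, so that the extension is smooth at the edge of the
  chart.\<close>

lemma smooth_fun_extend:
  assumes tr: "transversal T A \<sigma>" and w: "smooth_on T A w" and K: "compact K" "K \<subseteq> A"
    and z: "\<And>y. y \<in> A \<Longrightarrow> y \<notin> K \<Longrightarrow> w y = 0"
  shows "smooth_fun QM (\<lambda>q. if q \<in> cdom A \<sigma> then w (cmap A \<sigma> q) else 0)" (is "smooth_fun QM ?u")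
proof (rule smooth_funI, unfold model_QM)
  fix V \<psi> assume D: "(V, \<psi>) \<in> atlas QM"
  note ch = submersive_chartD(1)[OF D]
  have R: "open_in_subspace T (\<psi> ` V)" by (rule top_chart_rel_open[OF ch orbit_model(1)])
  let ?K = "(\<lambda>s. \<pi> (\<sigma> s)) ` K"
  have "closedin Q ?K" by (rule compactin_imp_closedin[OF Hausdorff_Q quot_compact[OF tr K]])
  then have oK: "openin Q (topspace Q - ?K)" by blast
  show "smooth_on T (\<psi> ` V) (\<lambda>y. ?u (inv_into V \<psi> y))"
  proof (rule smooth_on_local_rel[OF R])
    fix y assume y: "y \<in> \<psi> ` V"
    let ?q = "inv_into V \<psi> y"
    have q: "?q \<in> V" "\<psi> ?q = y" using top_chart_inv(3,4)[OF ch y] by auto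
    show "\<exists>W. y \<in> W \<and> open_in_subspace T W \<and> smooth_on T W (\<lambda>y. ?u (inv_into V \<psi> y))"
    proof (cases "?q \<in> cdom A \<sigma>")
      case True
      let ?W = "\<psi> ` (V \<inter> cdom A \<sigma>)"
      have RW: "open_in_subspace T ?W" by (rule top_chart_open_image[OF ch orbit_model(1) cdom_open[OF tr]])
      have iW: "inv_into V \<psi> z \<in> cdom A \<sigma>" if "z \<in> ?W" for z using that top_chart_inv(2)[OF ch] by auto
      have 1: "smooth_on T ?W (\<lambda>y. cmap A \<sigma> (inv_into V \<psi> y))"
        using transition_to[OF tr D] unfolding smooth_transition_def prod.case o_def .
      have "smooth_on T ?W (\<lambda>y. w (cmap A \<sigma> (inv_into V \<psi> y)))"
        by (rule smooth_on_compose[OF RW tr_rel_open[OF tr] _ 1 w]) (use iW cmap_in[OF tr] in blast)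
      then have sm: "smooth_on T ?W (\<lambda>y. ?u (inv_into V \<psi> y))"
        by (rule smooth_on_cong_imp) (simp add: iW)
      have "\<psi> ?q \<in> ?W" by (rule imageI) (use q(1) True in blast)
      then have yW: "y \<in> ?W" unfolding q(2) .
      show ?thesis by (rule exI[of _ ?W], rule conjI[OF yW conjI[OF RW sm]])
    next
      case False
      let ?W = "\<psi> ` (V \<inter> (topspace Q - ?K))"
      have RW: "open_in_subspace T ?W" by (rule top_chart_open_image[OF ch orbit_model(1) oK])
      have "?K \<subseteq> cdom A \<sigma>" using K(2) quot_in[OF tr] by blast
      then have "?q \<in> topspace Q - ?K" using False q(1) top_chartD(4)[OF ch] by blast
      then have "\<psi> ?q \<in> ?W" using q(1) by (intro imageI) blast
      then have yW: "y \<in> ?W" unfolding q(2) .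
      have "?u (inv_into V \<psi> z) = 0" if z': "z \<in> ?W" for z
      proof -
        have "inv_into V \<psi> z \<notin> ?K" using z' top_chart_inv(2)[OF ch] by auto
        then have "cmap A \<sigma> (inv_into V \<psi> z) \<notin> K" if "inv_into V \<psi> z \<in> cdom A \<sigma>"
          using quot_cmap[OF tr that] by (metis imageI)
        then show ?thesis using z cmap_in[OF tr] by simp
      qed
      then have sm: "smooth_on T ?W (\<lambda>y. ?u (inv_into V \<psi> y))"
        by (intro smooth_on_cong_imp[OF smooth_on_const[OF RW, of 0]]) simp
      show ?thesis by (rule exI[of _ ?W], rule conjI[OF yW conjI[OF RW sm]])
    qed
  qed
qed

section \<open>Descent of invariant functions\<close>

lemma descend_orbit:
  assumes F: "F \<in> invariant_functions G P \<alpha>" and x: "x \<in> E"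
  shows "descend G P \<alpha> F (\<pi> x) = F x"
proof -
  have "(SOME p. p \<in> \<pi> x) \<in> \<pi> x" using orbit_some[OF x] .
  then obtain g where "g \<in> carrier G" "(SOME p. p \<in> \<pi> x) = \<alpha> g x" unfolding orbit_def by auto
  then show ?thesis using F x unfolding descend_def invariant_functions_def by simp
qed

text \<open>Surjectivity carries density from the orbit manifold to the pulled back topology: an
  open set met downstairs is met by a function upstairs.\<close>

lemma descend_surj:
  assumes f: "f \<in> smooth_functions QM"
  obtains F where "F \<in> invariant_functions G P \<alpha>" "descend G P \<alpha> F = f"
proof
  let ?F = "restrict (\<lambda>x. f (\<pi> x)) E"
  have sf: "smooth_fun QM f" and ext: "f \<in> extensional (orbits G E \<alpha>)"
    using f unfolding smooth_functions_def mtop_QM topspace_Q by auto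
  have "smooth_fun P ?F" by (rule smooth_fun_cong[OF charted_P smooth_fun_pullback[OF sf]]) simp
  then show F: "?F \<in> invariant_functions G P \<alpha>"
    unfolding invariant_functions_def smooth_functions_def by auto
  show "descend G P \<alpha> ?F = f"
  proof
    fix q
    show "descend G P \<alpha> ?F q = f q"
    proof (cases "q \<in> orbits G E \<alpha>")
      case True
      then obtain x where x: "x \<in> E" "q = \<pi> x" unfolding orbits_def by auto
      then show ?thesis using descend_orbit[OF F x(1)] by simp
    next
      case False
      then show ?thesis using ext by (simp add: descend_def extensional_def)
    qed
  qed
qed

end

section \<open>The induced field and projected solutions\<close>

locale invariant_field = free_proper_action P G L \<alpha>
  for P :: "('p, 'e::euclidean_space) manifold" and G :: "('g, 'r) monoid_scheme" (structure)
    and L :: "('g, 'f::euclidean_space) manifold" and \<alpha> :: "'g \<Rightarrow> 'p \<Rightarrow> 'p" +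
  fixes X :: "'p vector_field"
  assumes X: "smooth_vector_field P X" and X_inv: "invariant_vector_field G P \<alpha> X"
begin

text \<open>Invariance replaces \<open>u \<circ> \<pi>\<close> by its composition with \<alpha> g,
  which is the same function on the manifold. It also makes the choice of representative in
  \<open>induced_vector_field\<close> immaterial.\<close>

lemma X_orbit:
  assumes u: "smooth_fun QM u" and x: "x \<in> E" and y: "y \<in> E" and xy: "\<pi> x = \<pi> y"
  shows "X x (\<lambda>x. u (\<pi> x)) = X y (\<lambda>x. u (\<pi> x))"
proof -
  obtain g where g: "g \<in> carrier G" "y = \<alpha> g x" using orbit_eq_iff[OF x y] xy by blast
  note s = smooth_fun_pullback[OF u]
  have s2: "smooth_fun P ((\<lambda>x. u (\<pi> x)) \<circ> \<alpha> g)"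
    by (rule smooth_fun_cong[OF charted_P s]) (use g in simp)
  have "X y (\<lambda>x. u (\<pi> x)) = X x ((\<lambda>x. u (\<pi> x)) \<circ> \<alpha> g)"
    using X_inv g x s unfolding invariant_vector_field_def by blast
  also have "\<dots> = X x (\<lambda>x. u (\<pi> x))"
    by (rule derivation_at_cong[OF charted_P _ x s2 s]) (use X x g in \<open>auto simp: smooth_vector_field_def\<close>)
  finally show ?thesis by simp
qed

lemma integral_curve_E:
  assumes c: "integral_curve P X J c" and t: "t \<in> J"
  shows "c t \<in> E"
  using c t continuous_map_image_subset_topspace[of "top_of_set J" "mtop P" c] unfolding integral_curve_def by auto

lemma integral_curve_orbit:
  assumes c: "integral_curve P X J c"
  shows "integral_curve QM (induced_vector_field G \<alpha> X) J (\<pi> \<circ> c)"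
  unfolding integral_curve_def mtop_QM
proof (intro conjI ballI allI impI)
  have cc: "continuous_map (top_of_set J) (mtop P) c" using c by (simp add: integral_curve_def)
  show "open J" "is_interval J" "J \<noteq> {}" using c by (auto simp: integral_curve_def)
  show "continuous_map (top_of_set J) Q (\<pi> \<circ> c)" by (rule continuous_map_compose[OF cc orbit_continuous])
  fix t u assume t: "t \<in> J" and u: "smooth_fun QM u"
  have ct: "c t \<in> E" by (rule integral_curve_E[OF c t])
  have some: "(SOME p. p \<in> \<pi> (c t)) \<in> \<pi> (c t)" by (rule orbit_some[OF ct])
  have "((\<lambda>x. u (\<pi> x)) \<circ> c has_real_derivative X (c t) (\<lambda>x. u (\<pi> x))) (at t)"
    using c t smooth_fun_pullback[OF u] unfolding integral_curve_def by blast
  moreover have "X (c t) (\<lambda>x. u (\<pi> x)) = X (SOME p. p \<in> \<pi> (c t)) (\<lambda>x. u (\<pi> x))"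
    by (rule X_orbit[OF u ct]) (use orbit_subset[OF ct some] in auto)
  ultimately show "((u \<circ> (\<pi> \<circ> c)) has_real_derivative induced_vector_field G \<alpha> X ((\<pi> \<circ> c) t) u) (at t)"
    unfolding induced_vector_field_def by (simp add: o_def)
qed

end

section \<open>Iterated Lie derivatives\<close>

definition lie_deriv :: "'e::euclidean_space set \<Rightarrow> ('e \<Rightarrow> 'e) \<Rightarrow> ('e \<Rightarrow> real) \<Rightarrow> 'e \<Rightarrow> real" where
  "lie_deriv W \<eta> h = (\<lambda>y. frechet_derivative h (at y within W) (\<eta> y))"

lemma dirderiv_expand:
  fixes f :: "'a::euclidean_space \<Rightarrow> 'b::real_normed_vector"
  assumes f: "smooth_on T W f" and y: "y \<in> W"
    and B: "(\<Sum>b\<in>B. (v \<bullet> b) *\<^sub>R b) = v"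
  shows "frechet_derivative f (at y within W) v = (\<Sum>b\<in>B. (v \<bullet> b) *\<^sub>R dirderiv W b f y)"
proof -
  have lin: "linear (frechet_derivative f (at y within W))"
    using smooth_on_has_derivative[OF f y] has_derivative_linear by blast
  have "frechet_derivative f (at y within W) v = frechet_derivative f (at y within W) (\<Sum>b\<in>B. (v \<bullet> b) *\<^sub>R b)"
    using B by simp
  also have "\<dots> = (\<Sum>b\<in>B. (v \<bullet> b) *\<^sub>R dirderiv W b f y)"
    by (simp add: linear_sum[OF lin] linear_scale[OF lin])
  finally show ?thesis .
qed

section \<open>Linearity, continuity and bounds of iterated directional derivatives\<close>

lemma iter_deriv_lincomb:
  fixes f :: "'i \<Rightarrow> 'e::euclidean_space \<Rightarrow> real"
  assumes W: "open_in_subspace T W" and f: "\<And>i. i \<in> I \<Longrightarrow> smooth_on T W (f i)" and vs: "set vs \<subseteq> T" and x: "x \<in> W"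
  shows "iter_deriv W vs (\<lambda>x. \<Sum>i\<in>I. c i * f i x) x = (\<Sum>i\<in>I. c i * iter_deriv W vs (f i) x)"
  using f vs
proof (induction vs arbitrary: f)
  case (Cons v vs)
  have v: "v \<in> T" using Cons.prems(2) by simp
  have "dirderiv W v (\<lambda>x. \<Sum>i\<in>I. c i * f i x) y = (\<Sum>i\<in>I. c i * dirderiv W v (f i) y)" if y: "y \<in> W" for y
  proof (rule dirderiv_eq[OF W y _ v])
    show "((\<lambda>x. \<Sum>i\<in>I. c i * f i x) has_derivative (\<lambda>v. \<Sum>i\<in>I. c i * dirderiv W v (f i) y)) (at y within W)"
      by (intro has_derivative_sum has_derivative_mult_right smooth_on_has_derivative[OF Cons.prems(1) y])
  qed
  then have "iter_deriv W vs (dirderiv W v (\<lambda>x. \<Sum>i\<in>I. c i * f i x)) x =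
      iter_deriv W vs (\<lambda>x. \<Sum>i\<in>I. c i * dirderiv W v (f i) x) x"
    using x by (rule iter_deriv_cong)
  also have "\<dots> = (\<Sum>i\<in>I. c i * iter_deriv W vs (dirderiv W v (f i)) x)"
    using Cons.prems by (intro Cons.IH smooth_on_dirderiv v) auto
  finally show ?case by simp
qed simp

lemma iter_deriv_add_lincomb:
  fixes f :: "'i \<Rightarrow> 'e::euclidean_space \<Rightarrow> real"
  assumes W: "open_in_subspace T W" and fin: "finite I" and f: "\<And>i. i \<in> I \<Longrightarrow> smooth_on T W (f i)"
    and g: "smooth_on T W g" and vs: "set vs \<subseteq> T" and x: "x \<in> W"
  shows "iter_deriv W vs (\<lambda>x. g x + (\<Sum>i\<in>I. c i * f i x)) x = iter_deriv W vs g x + (\<Sum>i\<in>I. c i * iter_deriv W vs (f i) x)"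
proof -
  \<comment> \<open>The extra summand \<open>g\<close> becomes the term with index
    \<open>None\<close> and coefficient 1, which reduces the claim to
    \<open>iter_deriv_lincomb\<close>.\<close>
  let ?f = "\<lambda>j. case j of None \<Rightarrow> g | Some i \<Rightarrow> f i"
  let ?c = "\<lambda>j. case j of None \<Rightarrow> 1 | Some i \<Rightarrow> c i"
  let ?I = "insert None (Some ` I)"
  have s: "(\<Sum>j\<in>?I. h j) = h None + (\<Sum>i\<in>I. h (Some i))" for h :: "'i option \<Rightarrow> real"
    using fin by (subst sum.insert) (auto simp: sum.reindex)
  have "iter_deriv W vs (\<lambda>x. \<Sum>j\<in>?I. ?c j * ?f j x) x = (\<Sum>j\<in>?I. ?c j * iter_deriv W vs (?f j) x)"
    by (rule iter_deriv_lincomb[OF W _ vs x]) (use f g in auto)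
  then show ?thesis unfolding s by simp
qed

lemma iter_deriv_snoc: "iter_deriv W (vs @ [v]) f = dirderiv W v (iter_deriv W vs f)"
  by (induction vs arbitrary: f) auto

text \<open>Continuity holds jointly in the base point and in the directions: each direction is
  expanded in a fixed basis, leaving coefficients times derivatives along fixed vectors.\<close>

lemma continuous_on_iter_deriv:
  fixes f :: "'e::euclidean_space \<Rightarrow> real"
  assumes W: "open_in_subspace T W" and f: "smooth_on T W f" and g: "continuous_on Z g" "g ` Z \<subseteq> W"
    and vs: "\<And>v. v \<in> set vs \<Longrightarrow> continuous_on Z v \<and> v ` Z \<subseteq> T"
  shows "continuous_on Z (\<lambda>z. iter_deriv W (map (\<lambda>v. v z) vs) f (g z))"
proof -
  obtain B where "finite B" "B \<subseteq> T" "\<forall>b\<in>B. norm b = 1" "\<forall>v\<in>T. (\<Sum>b\<in>B. (v \<bullet> b) *\<^sub>R b) = v"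
    by (rule subspace_basis[OF open_in_subspaceD(1)[OF W]])
  then have B: "finite B" "B \<subseteq> T" "\<And>b. b \<in> B \<Longrightarrow> norm b = 1" "\<And>v. v \<in> T \<Longrightarrow> (\<Sum>b\<in>B. (v \<bullet> b) *\<^sub>R b) = v"
    by blast+
  show ?thesis using f vs
  proof (induction vs arbitrary: f)
    case Nil
    then show ?case using continuous_on_compose2[OF smooth_on_continuous g(1,2)] by simp
  next
    case (Cons v vs)
    have v: "continuous_on Z v" "v ` Z \<subseteq> T" and vs: "\<And>u. u \<in> set vs \<Longrightarrow> continuous_on Z u \<and> u ` Z \<subseteq> T"
      using Cons.prems(2) by auto
    have "continuous_on Z (\<lambda>z. \<Sum>b\<in>B. (v z \<bullet> b) * iter_deriv W (map (\<lambda>v. v z) vs) (dirderiv W b f) (g z))"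
      using B(2) v vs Cons.prems(1)
      by (intro continuous_on_sum continuous_on_mult continuous_on_inner continuous_on_const Cons.IH smooth_on_dirderiv) auto
    moreover have "iter_deriv W (map (\<lambda>v. v z) (v # vs)) f (g z)
       = (\<Sum>b\<in>B. (v z \<bullet> b) * iter_deriv W (map (\<lambda>v. v z) vs) (dirderiv W b f) (g z))" if z: "z \<in> Z" for z
    proof -
      have gz: "g z \<in> W" using g(2) z by blast
      have vT: "v z \<in> T" using v(2) z by blast
      have vsT: "set (map (\<lambda>v. v z) vs) \<subseteq> T" using vs z by auto
      have "iter_deriv W (map (\<lambda>v. v z) vs) (dirderiv W (v z) f) (g z)
        = iter_deriv W (map (\<lambda>v. v z) vs) (\<lambda>x. \<Sum>b\<in>B. (v z \<bullet> b) * dirderiv W b f x) (g z)"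
        by (rule iter_deriv_cong[OF _ gz])
           (use dirderiv_expand[OF Cons.prems(1) _ B(4)[OF vT]] in simp)
      also have "\<dots> = (\<Sum>b\<in>B. (v z \<bullet> b) * iter_deriv W (map (\<lambda>v. v z) vs) (dirderiv W b f) (g z))"
        using B(2) Cons.prems(1) by (intro iter_deriv_lincomb[OF W _ vsT gz] smooth_on_dirderiv) auto
      finally show ?thesis by simp
    qed
    ultimately show ?case by (metis (no_types, lifting) continuous_on_cong)
  qed
qed

text \<open>The values are a continuous image of a compact set of base points and directions.
  Compactness serves twice: it bounds the derivatives, and it leaves a margin below a strict
  inequality.\<close>

lemma compact_iter_deriv_values:
  fixes f :: "'e::euclidean_space \<Rightarrow> real"
  assumes W: "open_in_subspace T W" and f: "smooth_on T W f" and K: "compact K" "K \<subseteq> W"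
  shows "compact {iter_deriv W vs f x | vs x. x \<in> K \<and> set vs \<subseteq> T \<inter> cball 0 1 \<and> length vs \<le> r}"
proof -
  let ?D = "T \<inter> cball 0 1"
  have cD: "compact ?D" using closed_subspace[OF open_in_subspaceD(1)[OF W]] by (simp add: closed_Int_compact)
  have comp: "compact {iter_deriv W vs f x | vs x. x \<in> K \<and> set vs \<subseteq> ?D \<and> length vs = l}" for l
  proof -
    \<comment> \<open>Lists of \<open>l\<close> directions are coded as sequences whose later
      entries are pinned to 0, so that they form a product of compact sets.\<close>
    let ?S = "PiE UNIV (\<lambda>i. if i < l then ?D else {0}) :: (nat \<Rightarrow> 'e) set"
    have "compactin (product_topology (\<lambda>i. euclidean) UNIV) ?S"
      unfolding compactin_PiE using cD by auto
    then have cS: "compact ?S" unfolding euclidean_product_topology compactin_euclidean_iff .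
    let ?vs = "map (\<lambda>i z. snd z i) [0..<l] :: (('e \<times> (nat \<Rightarrow> 'e)) \<Rightarrow> 'e) list"
    let ?F = "\<lambda>z. iter_deriv W (map (\<lambda>v. v z) ?vs) f (fst z)"
    have "continuous_on (K \<times> ?S) ?F"
    proof (rule continuous_on_iter_deriv[OF W f])
      show "continuous_on (K \<times> ?S) fst" by (intro continuous_intros)
      show "fst ` (K \<times> ?S) \<subseteq> W" using K by auto
      fix v assume "v \<in> set ?vs"
      then obtain i where i: "i < l" "v = (\<lambda>z. snd z i)" by auto
      have "continuous_on (K \<times> ?S) (\<lambda>z. snd z i)"
        by (rule continuous_on_compose2[OF continuous_on_product_coordinates]) (auto intro: continuous_intros)
      moreover have "snd z i \<in> T" if z: "z \<in> K \<times> ?S" for z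
      proof -
        have "snd z \<in> ?S" using z by auto
        then have "snd z i \<in> (if i < l then ?D else {0})" unfolding PiE_iff by blast
        then show ?thesis using i(1) by simp
      qed
      ultimately show "continuous_on (K \<times> ?S) v \<and> v ` (K \<times> ?S) \<subseteq> T" unfolding i(2) by blast
    qed
    then have "compact (?F ` (K \<times> ?S))" using compact_Times[OF K(1) cS] compact_continuous_image by blast
    moreover have "?F ` (K \<times> ?S) = {iter_deriv W vs f x | vs x. x \<in> K \<and> set vs \<subseteq> ?D \<and> length vs = l}"
    proof (intro equalityI subsetI)
      fix t assume "t \<in> ?F ` (K \<times> ?S)"
      then obtain x v where xv: "x \<in> K" "v \<in> ?S" "t = iter_deriv W (map v [0..<l]) f x" by (auto simp: o_def)
      have "v i \<in> ?D" if "i < l" for i using xv(2) that by (auto simp: PiE_iff split: if_splits dest: spec[of _ i])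
      then have "set (map v [0..<l]) \<subseteq> ?D" by auto
      then show "t \<in> {iter_deriv W vs f x | vs x. x \<in> K \<and> set vs \<subseteq> ?D \<and> length vs = l}" using xv by fastforce
    next
      fix t assume "t \<in> {iter_deriv W vs f x | vs x. x \<in> K \<and> set vs \<subseteq> ?D \<and> length vs = l}"
      then obtain vs x where xv: "x \<in> K" "set vs \<subseteq> ?D" "length vs = l" "t = iter_deriv W vs f x" by auto
      let ?v = "\<lambda>i. if i < l then vs ! i else 0"
      have "vs ! i \<in> ?D" if "i < l" for i using xv(2,3) that nth_mem by blast
      then have vS: "?v \<in> ?S" by (auto simp: PiE_iff)
      have "map ?v [0..<l] = vs" using xv(3) by (intro nth_equalityI) auto
      then have "t = ?F (x, ?v)" using xv(4) by (simp add: o_def)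
      then show "t \<in> ?F ` (K \<times> ?S)" using xv(1) vS by blast
    qed
    ultimately show ?thesis by simp
  qed
  have "{iter_deriv W vs f x | vs x. x \<in> K \<and> set vs \<subseteq> ?D \<and> length vs \<le> r}
     = (\<Union>l\<in>{..r}. {iter_deriv W vs f x | vs x. x \<in> K \<and> set vs \<subseteq> ?D \<and> length vs = l})" by auto
  then show ?thesis using comp by (simp add: compact_UN)
qed

lemma iter_deriv_bounded:
  fixes f :: "'e::euclidean_space \<Rightarrow> real"
  assumes "open_in_subspace T W" "smooth_on T W f" "compact K" "K \<subseteq> W"
  obtains C where "C > 0" "\<And>vs x. x \<in> K \<Longrightarrow> set vs \<subseteq> T \<inter> cball 0 1 \<Longrightarrow> length vs \<le> r \<Longrightarrow> \<bar>iter_deriv W vs f x\<bar> \<le> C"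
proof -
  have "bounded {iter_deriv W vs f x | vs x. x \<in> K \<and> set vs \<subseteq> T \<inter> cball 0 1 \<and> length vs \<le> r}"
    using compact_iter_deriv_values[OF assms] by (rule compact_imp_bounded)
  then obtain C where "C > 0" "\<forall>t\<in>{iter_deriv W vs f x | vs x. x \<in> K \<and> set vs \<subseteq> T \<inter> cball 0 1 \<and> length vs \<le> r}. norm t \<le> C"
    unfolding bounded_pos by blast
  then show thesis using that[of C] by fastforce
qed

text \<open>The finitely many orders and compactly many arguments attain their supremum, so
  pointwise strict inequalities hold with a common gap. Perturbations fit into that gap.\<close>

lemma iter_deriv_slack:
  fixes f :: "'e::euclidean_space \<Rightarrow> real"
  assumes "open_in_subspace T W" "smooth_on T W f" "compact K" "K \<subseteq> W"
    and less: "\<And>vs x. x \<in> K \<Longrightarrow> set vs \<subseteq> T \<inter> cball 0 1 \<Longrightarrow> length vs \<le> r \<Longrightarrow> \<bar>iter_deriv W vs f x\<bar> < \<epsilon>"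
  obtains s where "s < \<epsilon>" "\<And>vs x. x \<in> K \<Longrightarrow> set vs \<subseteq> T \<inter> cball 0 1 \<Longrightarrow> length vs \<le> r \<Longrightarrow> \<bar>iter_deriv W vs f x\<bar> \<le> s"
proof -
  let ?Z = "{iter_deriv W vs f x | vs x. x \<in> K \<and> set vs \<subseteq> T \<inter> cball 0 1 \<and> length vs \<le> r}"
  have Z: "compact (abs ` ?Z)"
    using compact_iter_deriv_values[OF assms(1-4)] by (intro compact_continuous_image continuous_intros)
  show thesis
  proof (cases "?Z = {}")
    case True
    show thesis by (rule that[of "\<epsilon> - 1"]) (use True in \<open>auto, blast?\<close>)
  next
    case False
    then obtain s where s: "s \<in> abs ` ?Z" "\<forall>t\<in>abs ` ?Z. t \<le> s"
      using compact_attains_sup[OF Z] by blast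
    show thesis
    proof (rule that[of s])
      show "s < \<epsilon>" using s(1) less by auto
      fix vs x assume *: "x \<in> K" "set vs \<subseteq> T \<inter> cball 0 1" "length vs \<le> r"
      then have "iter_deriv W vs f x \<in> ?Z" by blast
      then show "\<bar>iter_deriv W vs f x\<bar> \<le> s" using s(2) by blast
    qed
  qed
qed

section \<open>Iterates of a Lie derivative\<close>

context
  fixes T W :: "'e::euclidean_space set" and \<eta> :: "'e \<Rightarrow> 'e"
  assumes W: "open_in_subspace T W" and \<eta>: "smooth_on T W \<eta>" and \<eta>T: "\<eta> ` W \<subseteq> T"
begin

lemma lie_deriv_eq:
  assumes "(h has_derivative D) (at y within W)" "y \<in> W"
  shows "lie_deriv W \<eta> h y = D (\<eta> y)"
  unfolding lie_deriv_def using dirderiv_eq[OF W assms(2,1)] assms(2) \<eta>T by blast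

lemma lie_deriv_smooth:
  assumes h: "smooth_on T W h"
  shows "smooth_on T W (lie_deriv W \<eta> h)"
proof -
  obtain B where "finite B" "B \<subseteq> T" "\<forall>b\<in>B. norm b = 1" "\<forall>v\<in>T. (\<Sum>b\<in>B. (v \<bullet> b) *\<^sub>R b) = v"
    by (rule subspace_basis[OF open_in_subspaceD(1)[OF W]])
  then have B: "finite B" "B \<subseteq> T" "\<And>b. b \<in> B \<Longrightarrow> norm b = 1" "\<And>v. v \<in> T \<Longrightarrow> (\<Sum>b\<in>B. (v \<bullet> b) *\<^sub>R b) = v"
    by blast+
  have "smooth_on T W (\<lambda>y. \<Sum>b\<in>B. (\<eta> y \<bullet> b) * dirderiv W b h y)"
    using B(2) by (intro smooth_on_sum[OF W] smooth_on_mult[OF W] smooth_on_inner_left[OF W \<eta>] smooth_on_dirderiv[OF h]) auto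
  then show ?thesis
    by (rule smooth_on_cong_imp)
       (use dirderiv_expand[OF h _ B(4)] \<eta>T in \<open>simp add: lie_deriv_def image_subset_iff\<close>)
qed

lemma lie_iter_smooth:
  assumes h: "smooth_on T W h"
  shows "smooth_on T W ((lie_deriv W \<eta> ^^ j) h)"
  by (induction j) (simp_all add: h lie_deriv_smooth)

lemma lie_deriv_cong:
  assumes "\<And>y. y \<in> W \<Longrightarrow> f y = g y" "y \<in> W"
  shows "lie_deriv W \<eta> f y = lie_deriv W \<eta> g y"
  unfolding lie_deriv_def using frechet_within_cong[OF assms(2), of f g] assms(1) by simp

lemma lie_iter_cong:
  assumes "\<And>y. y \<in> W \<Longrightarrow> f y = g y" "y \<in> W"
  shows "(lie_deriv W \<eta> ^^ j) f y = (lie_deriv W \<eta> ^^ j) g y"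
  using assms(2)
proof (induction j arbitrary: y)
  case (Suc j)
  then show ?case using lie_deriv_cong[of "(lie_deriv W \<eta> ^^ j) f" "(lie_deriv W \<eta> ^^ j) g"] by simp
qed (use assms in simp)

lemma lie_iter_add_poly:
  assumes b: "\<And>y. y \<in> W \<Longrightarrow> \<eta> y \<bullet> b = 1" and f: "smooth_on T W f" and y: "y \<in> W"
  shows "(lie_deriv W \<eta> ^^ j) (\<lambda>y. f y + poly p (y \<bullet> b)) y = (lie_deriv W \<eta> ^^ j) f y + poly ((pderiv ^^ j) p) (y \<bullet> b)"
  using y
proof (induction j arbitrary: y)
  case (Suc j)
  let ?g = "(lie_deriv W \<eta> ^^ j) f" and ?q = "(pderiv ^^ j) p"
  have "lie_deriv W \<eta> ((lie_deriv W \<eta> ^^ j) (\<lambda>y. f y + poly p (y \<bullet> b))) y = lie_deriv W \<eta> (\<lambda>y. ?g y + poly ?q (y \<bullet> b)) y"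
    by (rule lie_deriv_cong[OF Suc.IH Suc.prems])
  also have "\<dots> = lie_deriv W \<eta> ?g y + poly (pderiv ?q) (y \<bullet> b)"
  proof -
    have "((\<lambda>y. poly ?q (y \<bullet> b)) has_derivative (\<lambda>v. (v \<bullet> b) * poly (pderiv ?q) (y \<bullet> b))) (at y within W)"
      by (rule DERIV_compose_FDERIV[OF poly_DERIV]) (intro bounded_linear_imp_has_derivative bounded_linear_inner_left)
    from has_derivative_add[OF smooth_on_has_derivative[OF lie_iter_smooth[OF f] Suc.prems] this]
    have "lie_deriv W \<eta> (\<lambda>y. ?g y + poly ?q (y \<bullet> b)) y =
      frechet_derivative ?g (at y within W) (\<eta> y) + (\<eta> y \<bullet> b) * poly (pderiv ?q) (y \<bullet> b)"
      by (rule lie_deriv_eq[OF _ Suc.prems])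
    then show ?thesis using b[OF Suc.prems] by (simp add: lie_deriv_def)
  qed
  finally show ?case by simp
qed simp

text \<open>The Whitney topology controls \<open>iter_deriv\<close> and not Lie derivatives. The
  coefficients and directions found here are the same for all \<open>h\<close>, so that smallness of
  the former gives smallness of the latter uniformly.\<close>

lemma lie_iter_repr:
  obtains cs where "\<And>c bs. (c, bs) \<in> set cs \<Longrightarrow> smooth_on T W c \<and> set bs \<subseteq> T \<inter> cball 0 1 \<and> length bs \<le> j"
    "\<And>h y. smooth_on T W h \<Longrightarrow> y \<in> W \<Longrightarrow>
      (lie_deriv W \<eta> ^^ j) h y = (\<Sum>(c, bs)\<leftarrow>cs. c y * iter_deriv W bs h y)"
proof -
  obtain B where "finite B" "B \<subseteq> T" "\<forall>b\<in>B. norm b = 1" "\<forall>v\<in>T. (\<Sum>b\<in>B. (v \<bullet> b) *\<^sub>R b) = v"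
    by (rule subspace_basis[OF open_in_subspaceD(1)[OF W]])
  then have B: "finite B" "B \<subseteq> T" "\<And>b. b \<in> B \<Longrightarrow> norm b = 1" "\<And>v. v \<in> T \<Longrightarrow> (\<Sum>b\<in>B. (v \<bullet> b) *\<^sub>R b) = v"
    by blast+
  obtain Bl where Bl: "set Bl = B" "distinct Bl" using finite_distinct_list[OF B(1)] by blast
  let ?P = "\<lambda>j cs. (\<forall>(c, bs)\<in>set cs. smooth_on T W c \<and> set bs \<subseteq> T \<inter> cball 0 1 \<and> length bs \<le> j) \<and>
    (\<forall>h. smooth_on T W h \<longrightarrow> (\<forall>y\<in>W. (lie_deriv W \<eta> ^^ j) h y = (\<Sum>(c, bs)\<leftarrow>cs. c y * iter_deriv W bs h y)))"
  have "\<exists>cs. ?P j cs"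
  proof (induction j)
    case 0
    show ?case by (rule exI[of _ "[(\<lambda>y. 1, [])]"]) (simp add: smooth_on_const[OF W])
  next
    case (Suc j)
    then obtain cs where cs: "\<And>c bs. (c, bs) \<in> set cs \<Longrightarrow> smooth_on T W c \<and> set bs \<subseteq> T \<inter> cball 0 1 \<and> length bs \<le> j"
      and eq: "\<And>h y. smooth_on T W h \<Longrightarrow> y \<in> W \<Longrightarrow> (lie_deriv W \<eta> ^^ j) h y = (\<Sum>(c, bs)\<leftarrow>cs. c y * iter_deriv W bs h y)"
      by blast
    \<comment> \<open>Product rule: the next Lie derivative falls on the coefficient, or on the
      derivative of \<open>h\<close>, where \<eta> is expanded in the basis. The new direction is
      the outermost one and so comes last in the list (\<open>iter_deriv_snoc\<close>).\<close>
    let ?f = "\<lambda>(c, bs). (lie_deriv W \<eta> c, bs) # map (\<lambda>b. (\<lambda>y. c y * (\<eta> y \<bullet> b), bs @ [b])) Bl"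
    let ?cs = "concat (map ?f cs)"
    have 1: "smooth_on T W c \<and> set bs \<subseteq> T \<inter> cball 0 1 \<and> length bs \<le> Suc j" if m: "(c, bs) \<in> set ?cs" for c bs
    proof -
      obtain c' bs' where c': "(c', bs') \<in> set cs" "(c, bs) \<in> set (?f (c', bs'))" using m by auto
      note s = cs[OF c'(1)]
      consider "c = lie_deriv W \<eta> c'" "bs = bs'" | b where "b \<in> B" "c = (\<lambda>y. c' y * (\<eta> y \<bullet> b))" "bs = bs' @ [b]"
        using c'(2) Bl by auto
      then show ?thesis
      proof cases
        case 1
        then show ?thesis using s lie_deriv_smooth by auto
      next
        case 2
        have "smooth_on T W c" unfolding 2(2) using s
          by (intro smooth_on_mult[OF W] smooth_on_inner_left[OF W \<eta>]) blast
        moreover have "set bs \<subseteq> T \<inter> cball 0 1" using 2 s B(2,3) by auto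
        moreover have "length bs \<le> Suc j" using 2 s by auto
        ultimately show ?thesis by blast
      qed
    qed
    have 2: "(lie_deriv W \<eta> ^^ Suc j) h y = (\<Sum>(c, bs)\<leftarrow>?cs. c y * iter_deriv W bs h y)"
      if h: "smooth_on T W h" and y: "y \<in> W" for h y
    proof -
      have D: "((\<lambda>y. c y * iter_deriv W bs h y) has_derivative
          (\<lambda>v. c y * dirderiv W v (iter_deriv W bs h) y + dirderiv W v c y * iter_deriv W bs h y)) (at y within W)"
        if "(c, bs) \<in> set cs" for c bs
        using cs[OF that] y h by (intro has_derivative_mult smooth_on_has_derivative smooth_on_iter_deriv) auto
      have D2: "((\<lambda>y. \<Sum>(c, bs)\<leftarrow>cs'. c y * iter_deriv W bs h y) has_derivative
          (\<lambda>v. \<Sum>(c, bs)\<leftarrow>cs'. c y * dirderiv W v (iter_deriv W bs h) y + dirderiv W v c y * iter_deriv W bs h y)) (at y within W)"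
        if "set cs' \<subseteq> set cs" for cs' using that
      proof (induction cs')
        case (Cons a cs')
        obtain c bs where "a = (c, bs)" by fastforce
        then show ?case using Cons D[of c bs] by (auto intro!: has_derivative_add)
      qed simp
      have "(lie_deriv W \<eta> ^^ Suc j) h y = lie_deriv W \<eta> (\<lambda>y. \<Sum>(c, bs)\<leftarrow>cs. c y * iter_deriv W bs h y) y"
        using lie_deriv_cong[of "(lie_deriv W \<eta> ^^ j) h", OF eq[OF h] y] by simp
      also have "\<dots> = (\<Sum>(c, bs)\<leftarrow>cs. c y * dirderiv W (\<eta> y) (iter_deriv W bs h) y + dirderiv W (\<eta> y) c y * iter_deriv W bs h y)"
        by (rule lie_deriv_eq[OF D2 y]) simp
      also have "\<dots> = (\<Sum>(c, bs)\<leftarrow>?cs. c y * iter_deriv W bs h y)"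
      proof -
        have "c y * dirderiv W (\<eta> y) (iter_deriv W bs h) y + dirderiv W (\<eta> y) c y * iter_deriv W bs h y
            = (\<Sum>(c, bs)\<leftarrow>?f (c, bs). c y * iter_deriv W bs h y)" if "(c, bs) \<in> set cs" for c bs
        proof -
          have sm: "smooth_on T W (iter_deriv W bs h)" using cs[OF that] by (intro smooth_on_iter_deriv h) auto
          have vT: "\<eta> y \<in> T" using \<eta>T y by blast
          have "dirderiv W (\<eta> y) (iter_deriv W bs h) y = (\<Sum>b\<in>B. (\<eta> y \<bullet> b) * iter_deriv W (bs @ [b]) h y)"
            using dirderiv_expand[OF sm y B(4)[OF vT]] by (simp add: iter_deriv_snoc)
          then show ?thesis
            by (simp add: lie_deriv_def o_def sum_distrib_left mult.assoc Bl sum_list_distinct_conv_sum_set[OF Bl(2)])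
        qed
        then show ?thesis
        proof (induction cs)
          case (Cons a cs)
          obtain c bs where "a = (c, bs)" by fastforce
          then show ?case using Cons by simp
        qed simp
      qed
      finally show ?thesis .
    qed
    show ?case using 1 2 by blast
  qed
  then show thesis using that by blast
qed

end

section \<open>Taylor's formula and polynomial perturbations\<close>

lemma pderiv_sum: "pderiv (sum f A) = (\<Sum>x\<in>A. pderiv (f x))"
  using higher_pderiv_sum[of 1 f A] by simp

text \<open>By induction both sides have the same derivative; their difference is constant, and it
  vanishes at \<open>u\<close>.\<close>

lemma poly_taylor:
  fixes q :: "real poly"
  assumes "\<And>i. i \<ge> m \<Longrightarrow> coeff q i = 0"
  shows "q = (\<Sum>j<m. smult (poly ((pderiv ^^ j) q) u / fact j) ([:- u, 1:] ^ j))"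
  using assms
proof (induction m arbitrary: q)
  case 0
  then show ?case by (simp add: poly_eq_iff)
next
  case (Suc m)
  let ?c = "\<lambda>q j. poly ((pderiv ^^ j) q) u / fact j"
  let ?R = "\<lambda>q m. \<Sum>j<m. smult (?c q j) ([:- u, 1:] ^ j)"
  have "pderiv q = ?R (pderiv q) m" by (rule Suc.IH) (simp add: coeff_pderiv Suc.prems)
  moreover have "pderiv (?R q (Suc m)) = ?R (pderiv q) m"
  proof -
    have "pderiv (?R q (Suc m)) = (\<Sum>j<Suc m. smult (?c q j) (pderiv ([:- u, 1:] ^ j)))"
      by (simp only: pderiv_sum pderiv_smult)
    also have "\<dots> = (\<Sum>j<m. smult (?c q (Suc j)) (pderiv ([:- u, 1:] ^ Suc j)))"
      by (subst sum.lessThan_Suc_shift) simp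
    also have "\<dots> = ?R (pderiv q) m"
    proof (rule sum.cong[OF refl])
      fix j
      have "pderiv ([:- u, 1:] ^ Suc j) = smult (of_nat (Suc j)) ([:- u, 1:] ^ j)"
        unfolding pderiv_power_Suc by (simp add: pderiv_pCons)
      moreover have "?c q (Suc j) * of_nat (Suc j) = ?c (pderiv q) j"
        by (simp add: funpow_Suc_right del: funpow.simps of_nat_Suc) 
      ultimately show "smult (?c q (Suc j)) (pderiv ([:- u, 1:] ^ Suc j)) = smult (?c (pderiv q) j) ([:- u, 1:] ^ j)"
        by (simp only: smult_smult)
    qed
    finally show ?thesis .
  qed
  ultimately have "pderiv (q - ?R q (Suc m)) = 0" by (simp add: pderiv_diff)
  then obtain h where h: "q - ?R q (Suc m) = [:h:]" using pderiv_iszero by blast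
  have "poly (?R q (Suc m)) u = poly q u"
    by (subst sum.lessThan_Suc_shift) (simp add: poly_sum)
  then have "poly [:h:] u = 0" unfolding h[symmetric] by simp
  then show ?case using h by simp
qed

text \<open>The coordinates of \<open>a\<close> are the coefficients of \<open>q a\<close>, numbered
  by \<iota>, and the perturbing polynomial \<open>p a\<close> is its antiderivative without
  constant term; hence the factors \<open>1 / real (Suc (\<iota> \<beta>))\<close>. The derivatives
  of \<open>p a\<close> of order 1 to \<open>?M\<close> are those of \<open>q a\<close> of order
  below \<open>?M\<close>, and these determine \<open>q a\<close>.\<close>

lemma generic_perturbation:
  fixes T W K :: "'e::euclidean_space set" and f :: "'e \<Rightarrow> real"
    and \<iota> :: "'e \<times> real \<Rightarrow> nat"
  assumes W: "open_in_subspace T W" and \<eta>: "smooth_on T W \<eta>" and \<eta>T: "\<eta> ` W \<subseteq> T"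
    and b: "\<And>y. y \<in> W \<Longrightarrow> \<eta> y \<bullet> b = 1" and f: "smooth_on T W f" and KW: "K \<subseteq> W"
    and \<iota>: "bij_betw \<iota> Basis {..<DIM('e \<times> real)}"
  shows "negligible {a :: 'e \<times> real. \<exists>y\<in>K. \<forall>j<DIM('e \<times> real).
    (lie_deriv W \<eta> ^^ Suc j) (\<lambda>y. f y + (\<Sum>\<beta>\<in>Basis. (a \<bullet> \<beta>) * ((y \<bullet> b) ^ Suc (\<iota> \<beta>) / real (Suc (\<iota> \<beta>))))) y = 0}"
    (is "negligible ?N")
proof -
  let ?M = "DIM('e \<times> real)"
  define p where "p = (\<lambda>a :: 'e \<times> real. \<Sum>\<beta>\<in>Basis. monom ((a \<bullet> \<beta>) / real (Suc (\<iota> \<beta>))) (Suc (\<iota> \<beta>)))"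
  define q where "q = (\<lambda>a :: 'e \<times> real. \<Sum>\<beta>\<in>Basis. monom (a \<bullet> \<beta>) (\<iota> \<beta>))"
  have pq: "pderiv (p a) = q a" for a
    unfolding p_def q_def pderiv_sum pderiv_monom by (intro sum.cong) auto
  have poly_p: "poly (p a) x = (\<Sum>\<beta>\<in>Basis. (a \<bullet> \<beta>) * (x ^ Suc (\<iota> \<beta>) / real (Suc (\<iota> \<beta>))))" for a x
    unfolding p_def by (simp add: poly_sum poly_monom)
  have inj: "\<iota> \<beta> = \<iota> \<gamma> \<longleftrightarrow> \<beta> = \<gamma>" if "\<beta> \<in> Basis" "\<gamma> \<in> Basis" for \<beta> \<gamma>
    using \<iota> that unfolding bij_betw_def inj_on_def by blast
  have coeff_q: "coeff (q a) (\<iota> \<gamma>) = a \<bullet> \<gamma>" if g: "\<gamma> \<in> Basis" for a \<gamma>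
  proof -
    have "coeff (q a) (\<iota> \<gamma>) = (\<Sum>\<beta>\<in>Basis. if \<beta> = \<gamma> then a \<bullet> \<beta> else 0)"
      unfolding q_def coeff_sum coeff_monom using inj g by (intro sum.cong) auto
    then show ?thesis using g by simp
  qed
  have coeff_q0: "coeff (q a) i = 0" if "i \<ge> ?M" for a i
  proof -
    have "\<iota> \<beta> < ?M" if "\<beta> \<in> Basis" for \<beta> using \<iota> that unfolding bij_betw_def by blast
    then show ?thesis unfolding q_def coeff_sum coeff_monom using that by (intro sum.neutral) (metis leD)
  qed
  let ?g = "\<lambda>j. (lie_deriv W \<eta> ^^ Suc j) f"
  \<comment> \<open>The vector of coefficients of the polynomial of degree below \<open>?M\<close>
    whose derivatives at \<open>y \<bullet> b\<close> are the negatives of the Lie derivatives of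
    \<open>f\<close> at \<open>y\<close>: the only parameter that can fail at
    \<open>y\<close>.\<close>
  define \<Phi> where "\<Phi> = (\<lambda>y. \<Sum>\<beta>\<in>Basis. (\<Sum>j<?M. (- ?g j y) * (coeff ([:- (y \<bullet> b), 1:] ^ j) (\<iota> \<beta>) / fact j)) *\<^sub>R (\<beta> :: 'e \<times> real))"
  have sm_coeff: "smooth_on T W (\<lambda>y. coeff ([:- (y \<bullet> b), 1:] ^ j) i / fact j)" for j i
  proof (cases "i \<le> j")
    case True
    have "smooth_on T W (\<lambda>y. (of_nat (j choose i) / fact j) * (- (y \<bullet> b)) ^ (j - i))"
      by (intro smooth_on_mult[OF W] smooth_on_const[OF W] smooth_on_power[OF W] smooth_on_minus[OF W]
         smooth_on_inner_left[OF W smooth_on_id[OF W]])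
    then show ?thesis by (rule smooth_on_cong_imp) (simp add: coeff_linear_poly_power[OF True])
  next
    case False
    have "coeff ([:- (y \<bullet> b), 1:] ^ j) i = 0" for y
      by (rule coeff_eq_0) (use False degree_power_le[of "[:- (y \<bullet> b), 1:]" j] in simp)
    then show ?thesis using smooth_on_const[OF W] by simp
  qed
  have "smooth_on T W \<Phi>"
    unfolding \<Phi>_def
    by (intro smooth_on_sum[OF W] smooth_on_scaleR[OF W] smooth_on_mult[OF W] smooth_on_minus[OF W]
        smooth_on_const[OF W] sm_coeff lie_iter_smooth[OF W \<eta> \<eta>T f])
  then have "\<Phi> differentiable_on W" using smooth_on_iff by blast
  then have "\<Phi> differentiable_on K" by (rule differentiable_on_subset[OF _ KW])
  \<comment> \<open>\<Phi> goes from the ambient type \<open>'e\<close> to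
    \<open>'e \<times> real\<close>; the factor \<open>real\<close> raises the dimension by one,
    whatever the dimension of \<open>T\<close>.\<close>
  then have neg: "negligible (\<Phi> ` K)" by (intro negligible_differentiable_image_lowdim) simp_all
  have "?N \<subseteq> \<Phi> ` K"
  proof
    fix a assume "a \<in> ?N"
    then obtain y where y: "y \<in> K" and z: "\<And>j. j < ?M \<Longrightarrow> (lie_deriv W \<eta> ^^ Suc j) (\<lambda>y. f y + poly (p a) (y \<bullet> b)) y = 0"
      unfolding poly_p by blast
    have yW: "y \<in> W" using y KW by blast
    have g: "poly ((pderiv ^^ j) (q a)) (y \<bullet> b) = - ?g j y" if "j < ?M" for j
    proof -
      have "?g j y + poly ((pderiv ^^ Suc j) (p a)) (y \<bullet> b) = 0"
        using z[OF that] lie_iter_add_poly[OF W \<eta> \<eta>T b f yW, of "Suc j" "p a"] by (simp only:)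
      moreover have "(pderiv ^^ Suc j) (p a) = (pderiv ^^ j) (q a)" by (simp only: funpow_Suc_right o_apply pq)
      ultimately show ?thesis by simp
    qed
    have "q a = (\<Sum>j<?M. smult (poly ((pderiv ^^ j) (q a)) (y \<bullet> b) / fact j) ([:- (y \<bullet> b), 1:] ^ j))"
      by (rule poly_taylor[OF coeff_q0])
    also have "\<dots> = (\<Sum>j<?M. smult (- ?g j y / fact j) ([:- (y \<bullet> b), 1:] ^ j))"
      by (rule sum.cong[OF refl]) (simp only: g lessThan_iff)
    finally have qa: "q a = (\<Sum>j<?M. smult (- ?g j y / fact j) ([:- (y \<bullet> b), 1:] ^ j))" .
    have "a \<bullet> \<beta> = (\<Sum>j<?M. (- ?g j y) * (coeff ([:- (y \<bullet> b), 1:] ^ j) (\<iota> \<beta>) / fact j))" if "\<beta> \<in> Basis" for \<beta>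
      unfolding coeff_q[OF that, symmetric] by (subst qa) (simp add: coeff_sum)
    then have "\<Phi> y = (\<Sum>\<beta>\<in>Basis. (a \<bullet> \<beta>) *\<^sub>R \<beta>)" unfolding \<Phi>_def by simp
    then have "a = \<Phi> y" by (simp only: euclidean_representation)
    then show "a \<in> \<Phi> ` K" using y by blast
  qed
  then show ?thesis using neg negligible_subset by blast
qed

section \<open>Nondegenerate functions in the Whitney topology\<close>

lemma lie_iter_add:
  assumes W: "open_in_subspace T W" and \<eta>: "smooth_on T W \<eta>" and \<eta>T: "\<eta> ` W \<subseteq> T"
    and f: "smooth_on T W f" and g: "smooth_on T W g" and y: "y \<in> W"
  shows "(lie_deriv W \<eta> ^^ j) (\<lambda>y. f y + g y) y = (lie_deriv W \<eta> ^^ j) f y + (lie_deriv W \<eta> ^^ j) g y"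
  using y
proof (induction j arbitrary: y)
  case (Suc j)
  let ?f = "(lie_deriv W \<eta> ^^ j) f" and ?g = "(lie_deriv W \<eta> ^^ j) g"
  have "lie_deriv W \<eta> ((lie_deriv W \<eta> ^^ j) (\<lambda>y. f y + g y)) y = lie_deriv W \<eta> (\<lambda>y. ?f y + ?g y) y"
    by (rule lie_deriv_cong[OF W \<eta> \<eta>T Suc.IH Suc.prems])
  also have "\<dots> = lie_deriv W \<eta> ?f y + lie_deriv W \<eta> ?g y"
    using lie_deriv_eq[OF W \<eta> \<eta>T has_derivative_add[OF
        smooth_on_has_derivative[OF lie_iter_smooth[OF W \<eta> \<eta>T f] Suc.prems]
        smooth_on_has_derivative[OF lie_iter_smooth[OF W \<eta> \<eta>T g] Suc.prems]] Suc.prems]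
    by (simp add: lie_deriv_def)
  finally show ?case by simp
qed simp

text \<open>The coefficients of \<open>lie_iter_repr\<close> are bounded on \<open>K\<close>, and
  \<open>C\<close> adds up their bounds. It does not depend on \<open>h\<close>.\<close>

lemma lie_iter_bound:
  assumes W: "open_in_subspace T W" and \<eta>: "smooth_on T W \<eta>" and \<eta>T: "\<eta> ` W \<subseteq> T" and K: "compact K" "K \<subseteq> W"
  shows "\<exists>C\<ge>0. \<forall>h y \<epsilon>. smooth_on T W h \<longrightarrow> y \<in> K \<longrightarrow>
    (\<forall>bs. set bs \<subseteq> T \<inter> cball 0 1 \<and> length bs \<le> j \<longrightarrow> \<bar>iter_deriv W bs h y\<bar> \<le> \<epsilon>) \<longrightarrow>
    \<bar>(lie_deriv W \<eta> ^^ j) h y\<bar> \<le> C * \<epsilon>"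
proof -
  obtain cs where cs: "\<And>c bs. (c, bs) \<in> set cs \<Longrightarrow> smooth_on T W c \<and> set bs \<subseteq> T \<inter> cball 0 1 \<and> length bs \<le> j"
    and eq: "\<And>h y. smooth_on T W h \<Longrightarrow> y \<in> W \<Longrightarrow>
      (lie_deriv W \<eta> ^^ j) h y = (\<Sum>(c, bs)\<leftarrow>cs. c y * iter_deriv W bs h y)"
    using lie_iter_repr[OF W \<eta> \<eta>T, of j] by metis
  have "\<exists>C\<ge>0. \<forall>h y \<epsilon>. y \<in> K \<longrightarrow>
    (\<forall>bs. set bs \<subseteq> T \<inter> cball 0 1 \<and> length bs \<le> j \<longrightarrow> \<bar>iter_deriv W bs h y\<bar> \<le> \<epsilon>) \<longrightarrow>
    \<bar>\<Sum>(c, bs)\<leftarrow>cs'. c y * iter_deriv W bs h y\<bar> \<le> C * \<epsilon>" if "set cs' \<subseteq> set cs" for cs'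
    using that
  proof (induction cs')
    case Nil
    show ?case by (rule exI[of _ 0]) simp
  next
    case (Cons a cs')
    obtain c bs where a: "a = (c, bs)" by fastforce
    have ca: "smooth_on T W c" "set bs \<subseteq> T \<inter> cball 0 1" "length bs \<le> j" using cs Cons.prems a by auto
    obtain C where C: "C \<ge> 0" "\<And>h y \<epsilon>. y \<in> K \<Longrightarrow>
      (\<forall>bs. set bs \<subseteq> T \<inter> cball 0 1 \<and> length bs \<le> j \<longrightarrow> \<bar>iter_deriv W bs h y\<bar> \<le> \<epsilon>) \<Longrightarrow>
      \<bar>\<Sum>(c, bs)\<leftarrow>cs'. c y * iter_deriv W bs h y\<bar> \<le> C * \<epsilon>" using Cons by auto
    have "bounded (c ` K)"
      using K continuous_on_subset[OF smooth_on_continuous[OF ca(1)] K(2)] compact_continuous_image compact_imp_bounded by blast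
    then obtain C' where C': "C' > 0" "\<And>y. y \<in> K \<Longrightarrow> \<bar>c y\<bar> \<le> C'" unfolding bounded_pos by auto
    show ?case
    proof (intro exI[of _ "C + C'"] conjI allI impI)
      show "0 \<le> C + C'" using C C' by simp
      fix h :: "'a \<Rightarrow> real" and y \<epsilon>
      assume y: "y \<in> K" and h: "\<forall>bs. set bs \<subseteq> T \<inter> cball 0 1 \<and> length bs \<le> j \<longrightarrow> \<bar>iter_deriv W bs h y\<bar> \<le> \<epsilon>"
      have "\<bar>c y * iter_deriv W bs h y\<bar> \<le> C' * \<epsilon>"
        unfolding abs_mult by (rule mult_mono) (use C' y h ca in auto)
      then show "\<bar>\<Sum>(c, bs)\<leftarrow>a # cs'. c y * iter_deriv W bs h y\<bar> \<le> (C + C') * \<epsilon>"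
        using C(2)[OF y h] by (simp add: a distrib_right)
    qed
  qed
  from this[OF order_refl] obtain C where "C \<ge> 0" "\<And>h y \<epsilon>. y \<in> K \<Longrightarrow>
    (\<forall>bs. set bs \<subseteq> T \<inter> cball 0 1 \<and> length bs \<le> j \<longrightarrow> \<bar>iter_deriv W bs h y\<bar> \<le> \<epsilon>) \<Longrightarrow>
    \<bar>\<Sum>(c, bs)\<leftarrow>cs. c y * iter_deriv W bs h y\<bar> \<le> C * \<epsilon>" by auto
  then show ?thesis using eq K(2) by (intro exI[of _ C]) auto
qed

context free_proper_action begin

text \<open>\<open>DIM('e \<times> real)\<close> is the number m of the overview: it exceeds the
  dimension of the ambient space, hence that of \<open>T\<close>.\<close>

definition nondegenerate :: "'e set \<Rightarrow> ('e \<Rightarrow> 'p) \<Rightarrow> 'e set \<Rightarrow> ('e \<Rightarrow> 'e) \<Rightarrow> 'e set \<Rightarrow> ('p set \<Rightarrow> real) set" where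
  "nondegenerate A \<sigma> W \<eta> K = {u \<in> smooth_functions QM.
     \<forall>y\<in>K. \<exists>j<DIM('e \<times> real). (lie_deriv W \<eta> ^^ Suc j) (\<lambda>y. u (\<pi> (\<sigma> y))) y \<noteq> 0}"

lemma smooth_functionsD:
  assumes "u \<in> smooth_functions QM"
  shows "smooth_fun QM u" "u \<in> extensional (topspace Q)"
  using assms unfolding smooth_functions_def mtop_QM by auto

lemma whitney_open:
  assumes "f \<in> smooth_functions QM"
    "\<forall>i\<in>I. C i \<in> maximal_atlas QM \<and> compactin Q (K i) \<and> K i \<subseteq> fst (C i) \<and> 0 < \<epsilon> i"
    "\<forall>x\<in>topspace Q. \<exists>N. openin Q N \<and> x \<in> N \<and> finite {i \<in> I. fst (C i) \<inter> N \<noteq> {}}"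
  shows "openin (whitney_topology QM) (whitney_nbhd QM r I C K \<epsilon> f)"
  unfolding whitney_topology_def mtop_QM by (rule topology_generated_by_Basis) (use assms in blast)

text \<open>On the compact \<open>K\<close> the sum of the absolute Lie derivatives of
  \<open>u\<close> has a positive lower bound. Where all those of \<open>g\<close> vanish, those of
  \<open>u\<close> equal, up to sign, those of \<open>g - u\<close>, which are small near
  \<open>u\<close>. A neighbourhood using a single chart suffices.\<close>

lemma nondegenerate_open:
  assumes tr: "transversal T A \<sigma>" and W: "open_in_subspace T W" "W \<subseteq> A"
    and \<eta>: "smooth_on T W \<eta>" and \<eta>T: "\<eta> ` W \<subseteq> T" and K: "compact K" "K \<subseteq> W"
  shows "openin (whitney_topology QM) (nondegenerate A \<sigma> W \<eta> K)"
proof (subst openin_subopen, intro ballI)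
  fix u assume u: "u \<in> nondegenerate A \<sigma> W \<eta> K"
  define M where "M = DIM('e \<times> real)"
  define L where "L j = lie_deriv W \<eta> ^^ Suc j" for j
  let ?q = "\<lambda>y. \<pi> (\<sigma> y)"
  have nondegenerate: "g \<in> nondegenerate A \<sigma> W \<eta> K \<longleftrightarrow>
    g \<in> smooth_functions QM \<and> (\<forall>y\<in>K. \<exists>j<M. L j (\<lambda>y. g (?q y)) y \<noteq> 0)" for g
    unfolding nondegenerate_def M_def L_def by (rule mem_Collect_eq)
  have uS: "u \<in> smooth_functions QM" using u unfolding nondegenerate by blast
  have smA: "smooth_on T A (\<lambda>y. g (?q y))" if "g \<in> smooth_functions QM" for g
    by (rule smooth_fun_QM_chart[OF smooth_functionsD(1)[OF that] tr])
  have smW: "smooth_on T W (\<lambda>y. g (?q y))" if "g \<in> smooth_functions QM" for g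
    by (rule smooth_on_subset_rel[OF smA[OF that] tr_rel_open[OF tr] W])
  let ?m = "\<lambda>y. \<Sum>j<M. \<bar>L j (\<lambda>y. u (?q y)) y\<bar>"
  have cm: "continuous_on K ?m"
  proof (rule continuous_on_sum)
    fix j
    note sm = lie_iter_smooth[OF W(1) \<eta> \<eta>T smW[OF uS], of "Suc j", folded L_def]
    have "continuous_on K (L j (\<lambda>y. u (?q y)))"
      by (rule continuous_on_subset[OF smooth_on_continuous[OF sm] K(2)])
    then show "continuous_on K (\<lambda>y. \<bar>L j (\<lambda>y. u (?q y)) y\<bar>)"
      by (rule continuous_on_rabs)
  qed
  have pm: "?m y > 0" if yK: "y \<in> K" for y
  proof -
    obtain j where j: "j < M" "L j (\<lambda>y. u (?q y)) y \<noteq> 0" using u yK unfolding nondegenerate by blast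
    show ?thesis by (rule sum_pos2[of _ j]) (use j in auto)
  qed
  obtain \<delta> where \<delta>: "\<delta> > 0" "\<And>y. y \<in> K \<Longrightarrow> ?m y \<ge> \<delta>"
  proof (cases "K = {}")
    case False
    then obtain y0 where "y0 \<in> K" "\<And>y. y \<in> K \<Longrightarrow> ?m y0 \<le> ?m y"
      using continuous_attains_inf[OF K(1) _ cm] by blast
    then show thesis using that[of "?m y0"] pm by blast
  qed (rule that[of 1], auto)
  have "\<forall>j. \<exists>C\<ge>0. \<forall>h y \<epsilon>. smooth_on T W h \<longrightarrow> y \<in> K \<longrightarrow>
    (\<forall>bs. set bs \<subseteq> T \<inter> cball 0 1 \<and> length bs \<le> Suc j \<longrightarrow> \<bar>iter_deriv W bs h y\<bar> \<le> \<epsilon>) \<longrightarrow>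
    \<bar>L j h y\<bar> \<le> C * \<epsilon>"
    unfolding L_def by (rule allI, rule lie_iter_bound[OF W(1) \<eta> \<eta>T K])
  then obtain C where C: "\<And>j. C j \<ge> 0" "\<And>j h y \<epsilon>. smooth_on T W h \<Longrightarrow> y \<in> K \<Longrightarrow>
    (\<forall>bs. set bs \<subseteq> T \<inter> cball 0 1 \<and> length bs \<le> Suc j \<longrightarrow> \<bar>iter_deriv W bs h y\<bar> \<le> \<epsilon>) \<Longrightarrow>
    \<bar>L j h y\<bar> \<le> C j * \<epsilon>" by metis
  define B where "B = (\<Sum>j<M. C j)"
  have B0: "B \<ge> 0" unfolding B_def using C(1) by (simp add: sum_nonneg)
  \<comment> \<open>The summand 1 keeps the denominator positive and makes
    \<open>B * \<epsilon> < \<delta>\<close> strict even if \<open>B\<close> is 0.\<close>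
  define \<epsilon> where "\<epsilon> = \<delta> / (B + 1)"
  have \<epsilon>: "\<epsilon> > 0" unfolding \<epsilon>_def using \<delta> B0 by simp
  have B\<epsilon>: "B * \<epsilon> < \<delta>" unfolding \<epsilon>_def using \<delta>(1) B0 by (simp add: field_simps)
  \<comment> \<open>Order \<open>M\<close> is needed, as \<open>L j\<close> for \<open>j < M\<close>
    involves up to \<open>M\<close> derivatives.\<close>
  let ?N = "whitney_nbhd QM M {0} (\<lambda>_. (cdom A \<sigma>, cmap A \<sigma>)) (\<lambda>_. ?q ` K) (\<lambda>_. \<epsilon>) u"
  have KA: "K \<subseteq> A" using K W by blast
  have "openin (whitney_topology QM) ?N"
  proof (rule whitney_open[OF uS])
    show "\<forall>i\<in>{0}. (cdom A \<sigma>, cmap A \<sigma>) \<in> maximal_atlas QM \<and> compactin Q (?q ` K) \<and> ?q ` K \<subseteq> fst (cdom A \<sigma>, cmap A \<sigma>) \<and> 0 < \<epsilon>"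
      using cmap_maximal[OF tr] quot_compact[OF tr K(1) KA] quot_in[OF tr] KA \<epsilon> by auto
    show "\<forall>x\<in>topspace Q. \<exists>N. openin Q N \<and> x \<in> N \<and> finite {i \<in> {0::nat}. fst (cdom A \<sigma>, cmap A \<sigma>) \<inter> N \<noteq> {}}"
      by (intro ballI exI[of _ "topspace Q"]) simp
  qed
  moreover have "u \<in> ?N"
  proof -
    have "iter_deriv V vs (\<lambda>y. 0 :: real) y = 0" if "open_in_subspace T V" "set vs \<subseteq> T" "y \<in> V" for V vs y
      using iter_deriv_lincomb[OF that(1) _ that(2,3), of "{} :: nat set" "\<lambda>_ _. 0" "\<lambda>_. 0"] by simp
    then show ?thesis
      unfolding whitney_nbhd_def model_QM prod.case cmap_image[OF tr]
      using uS \<epsilon> tr_rel_open[OF tr] KA by (auto simp: cmap_quot[OF tr] subset_iff)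
  qed
  moreover have "?N \<subseteq> nondegenerate A \<sigma> W \<eta> K"
  proof
    fix g assume g: "g \<in> ?N"
    have gS: "g \<in> smooth_functions QM" using g by (simp add: whitney_nbhd_def)
    let ?d = "\<lambda>y. g (?q y) + - u (?q y)"
    have mu: "smooth_on T W (\<lambda>y. - u (?q y))" by (rule smooth_on_minus[OF W(1) smW[OF uS]])
    have smd: "smooth_on T W ?d" by (rule smooth_on_add[OF W(1) smW[OF gS] mu])
    have small: "\<bar>iter_deriv W bs ?d y\<bar> \<le> \<epsilon>" if y: "y \<in> K" and bs: "set bs \<subseteq> T \<inter> cball 0 1" "length bs \<le> M" for y bs
    proof -
      have yA: "y \<in> A" using y KA by blast
      have "\<bar>iter_deriv A bs (\<lambda>y. g (inv_into (cdom A \<sigma>) (cmap A \<sigma>) y) - u (inv_into (cdom A \<sigma>) (cmap A \<sigma>) y)) (cmap A \<sigma> (?q y))\<bar> < \<epsilon>"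
        using g y bs unfolding whitney_nbhd_def model_QM prod.case cmap_image[OF tr] by blast
      also have "iter_deriv A bs (\<lambda>y. g (inv_into (cdom A \<sigma>) (cmap A \<sigma>) y) - u (inv_into (cdom A \<sigma>) (cmap A \<sigma>) y)) (cmap A \<sigma> (?q y))
        = iter_deriv A bs ?d y"
        unfolding cmap_quot[OF tr yA] by (rule iter_deriv_cong[OF _ yA]) (simp add: inv_cmap[OF tr])
      also have "\<dots> = iter_deriv W bs ?d y"
        by (rule iter_deriv_subset[OF open_in_subspace_openin[OF tr_rel_open[OF tr] W]]) (use y K in blast)
      finally show ?thesis by simp
    qed
    have "\<exists>j<M. L j (\<lambda>y. g (?q y)) y \<noteq> 0" if y: "y \<in> K" for y
    proof (rule ccontr)
      assume "\<not> ?thesis"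
      then have z: "L j (\<lambda>y. g (?q y)) y = 0" if "j < M" for j using that by blast
      have yW: "y \<in> W" using y K by blast
      have "\<bar>L j (\<lambda>y. u (?q y)) y\<bar> \<le> C j * \<epsilon>" if j: "j < M" for j
      proof -
        have "L j (\<lambda>y. g (?q y)) y = L j (\<lambda>y. ?d y + u (?q y)) y" by simp
        also have "\<dots> = L j ?d y + L j (\<lambda>y. u (?q y)) y"
          unfolding L_def by (rule lie_iter_add[OF W(1) \<eta> \<eta>T smd smW[OF uS] yW])
        finally have "\<bar>L j (\<lambda>y. u (?q y)) y\<bar> = \<bar>L j ?d y\<bar>" using z[OF j] by linarith
        moreover have "\<bar>L j ?d y\<bar> \<le> C j * \<epsilon>"
          by (rule C(2)[OF smd y]) (use small[OF y] j in auto)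
        ultimately show ?thesis by linarith
      qed
      then have "?m y \<le> (\<Sum>j<M. C j * \<epsilon>)" by (intro sum_mono) auto
      also have "\<dots> = B * \<epsilon>" unfolding B_def by (simp only: sum_distrib_right)
      finally show False using \<delta>(2)[OF y] B\<epsilon> by linarith
    qed
    then show "g \<in> nondegenerate A \<sigma> W \<eta> K" unfolding nondegenerate using gS by blast
  qed
  ultimately show "\<exists>N. openin (whitney_topology QM) N \<and> u \<in> N \<and> N \<subseteq> nondegenerate A \<sigma> W \<eta> K" by blast
qed

section \<open>Small perturbations with compact support\<close>

lemma locally_finite_compact:
  assumes K: "compactin Q K"
    and lf: "\<forall>x\<in>topspace Q. \<exists>N. openin Q N \<and> x \<in> N \<and> finite {i \<in> I. B i \<inter> N \<noteq> {}}"
  shows "finite {i \<in> I. B i \<inter> K \<noteq> {}}"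
proof -
  let ?U = "{N. openin Q N \<and> finite {i \<in> I. B i \<inter> N \<noteq> {}}}"
  have "K \<subseteq> \<Union>?U" using lf compactin_subset_topspace[OF K] by blast
  then obtain F where F: "finite F" "F \<subseteq> ?U" "K \<subseteq> \<Union>F"
    using K unfolding compactin_def by (metis (no_types, lifting) mem_Collect_eq)
  have "{i \<in> I. B i \<inter> K \<noteq> {}} \<subseteq> (\<Union>N\<in>F. {i \<in> I. B i \<inter> N \<noteq> {}})" using F(3) by blast
  moreover have "finite (\<Union>N\<in>F. {i \<in> I. B i \<inter> N \<noteq> {}})" using F(1,2) by blast
  ultimately show ?thesis by (rule finite_subset)
qed

text \<open>Linear in a finite-dimensional parameter, so that density becomes a question of measure
  in a Euclidean space. Restriction keeps the result extensional, as \<open>smooth_functions\<close>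
  demands.\<close>

definition perturb :: "('p set \<Rightarrow> real) \<Rightarrow> ('n::euclidean_space \<Rightarrow> 'p set \<Rightarrow> real) \<Rightarrow> 'n \<Rightarrow> 'p set \<Rightarrow> real" where
  "perturb f e a = restrict (\<lambda>q. f q + (\<Sum>\<beta>\<in>Basis. (a \<bullet> \<beta>) * e \<beta> q)) (topspace Q)"

lemma perturb_smooth:
  assumes f: "f \<in> smooth_functions QM" and e: "\<And>\<beta>. \<beta> \<in> Basis \<Longrightarrow> smooth_fun QM (e \<beta>)"
  shows "perturb f e a \<in> smooth_functions QM"
proof -
  have "smooth_fun QM (\<lambda>q. f q + (\<Sum>\<beta>\<in>Basis. (a \<bullet> \<beta>) * e \<beta> q))"
    by (intro smooth_fun_add[OF charted_QM] smooth_fun_sum[OF charted_QM] smooth_fun_mult[OF charted_QM]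
        smooth_fun_const[OF charted_QM] e smooth_functionsD(1)[OF f])
  then have "smooth_fun QM (perturb f e a)"
    by (rule smooth_fun_cong[OF charted_QM]) (simp add: perturb_def mtop_QM)
  then show ?thesis unfolding smooth_functions_def mtop_QM by (simp add: perturb_def)
qed

text \<open>Only finitely many charts of the locally finite family meet the compact
  \<open>Kc\<close>; in the others the perturbation changes nothing. In each of these charts the
  strict inequalities have a gap, and the derivatives of the \<open>e \<beta>\<close> are bounded.
  The function \<open>f\<close> need not be the centre \<open>f0\<close>, since subbasic sets around
  other centres have to be treated as well.\<close>

lemma perturb_nbhd:
  fixes e :: "'n::euclidean_space \<Rightarrow> 'p set \<Rightarrow> real"
  assumes e: "\<And>\<beta>. \<beta> \<in> Basis \<Longrightarrow> smooth_fun QM (e \<beta>)"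
    and Kc: "compactin Q Kc" and ez: "\<And>\<beta> q. \<beta> \<in> Basis \<Longrightarrow> q \<notin> Kc \<Longrightarrow> e \<beta> q = 0"
    and f0: "f0 \<in> smooth_functions QM"
    and C: "\<forall>i\<in>I. C i \<in> maximal_atlas QM \<and> compactin Q (K i) \<and> K i \<subseteq> fst (C i) \<and> 0 < \<epsilon> i"
    and lf: "\<forall>x\<in>topspace Q. \<exists>N. openin Q N \<and> x \<in> N \<and> finite {i \<in> I. fst (C i) \<inter> N \<noteq> {}}"
    and f: "f \<in> whitney_nbhd QM r I C K \<epsilon> f0"
  shows "\<exists>\<delta>>0. \<forall>a. norm a < \<delta> \<longrightarrow> perturb f e a \<in> whitney_nbhd QM r I C K \<epsilon> f0"
proof -
  let ?J = "{i \<in> I. fst (C i) \<inter> Kc \<noteq> {}}"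
  have finJ: "finite ?J" by (rule locally_finite_compact[OF Kc lf])
  have fS: "f \<in> smooth_functions QM" using f by (simp add: whitney_nbhd_def)
  define ok where "ok = (\<lambda>i a. \<forall>x\<in>K i. \<forall>vs. set vs \<subseteq> T \<inter> cball 0 1 \<and> length vs \<le> r \<longrightarrow>
     \<bar>iter_deriv (snd (C i) ` fst (C i)) vs (\<lambda>y. perturb f e a (inv_into (fst (C i)) (snd (C i)) y) - f0 (inv_into (fst (C i)) (snd (C i)) y)) (snd (C i) x)\<bar> < \<epsilon> i)"
  have ok_all: "perturb f e a \<in> whitney_nbhd QM r I C K \<epsilon> f0" if "\<And>i. i \<in> I \<Longrightarrow> ok i a" for a
    unfolding whitney_nbhd_def model_QM using perturb_smooth[OF fS e] that unfolding ok_def by (auto simp: case_prod_beta)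
  have each: "\<exists>\<delta>>0. \<forall>a. norm a < \<delta> \<longrightarrow> ok i a" if i: "i \<in> I" for i
  proof -
    obtain U \<phi> where Ci: "C i = (U, \<phi>)" by fastforce
    have max: "(U, \<phi>) \<in> maximal_atlas QM" and cK: "compactin Q (K i)" and KU: "K i \<subseteq> U" and \<epsilon>: "0 < \<epsilon> i"
      using bspec[OF C i] unfolding Ci by simp_all
    have ch: "top_chart Q T (U, \<phi>)" using max unfolding maximal_atlas_def mtop_QM model_QM by blast
    note R = smooth_fun_maximal(1)[OF smooth_functionsD(1)[OF fS] max]
    let ?W = "\<phi> ` U" and ?i = "inv_into U \<phi>"
    have sm: "smooth_on T ?W (\<lambda>y. g (?i y))" if "smooth_fun QM g" for g
      by (rule smooth_fun_maximal(2)[OF that max])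
    have "compactin (subtopology Q U) (K i)" using cK KU by (simp add: compactin_subtopology)
    then have cpt: "compact (\<phi> ` K i)" using image_compactin[OF _ top_chart_continuous[OF ch]] by simp
    have KW: "\<phi> ` K i \<subseteq> ?W" using KU by blast
    have smd: "smooth_on T ?W (\<lambda>y. f (?i y) - f0 (?i y))"
      by (intro smooth_on_diff[OF R] sm smooth_functionsD(1)[OF fS] smooth_functionsD(1)[OF f0])
    have less: "\<bar>iter_deriv ?W vs (\<lambda>y. f (?i y) - f0 (?i y)) x\<bar> < \<epsilon> i"
      if "x \<in> \<phi> ` K i" "set vs \<subseteq> T \<inter> cball 0 1" "length vs \<le> r" for vs x
      using f i that unfolding whitney_nbhd_def model_QM by (auto simp: Ci dest!: bspec[of _ _ i])
    have "\<exists>s<\<epsilon> i. \<forall>vs x. x \<in> \<phi> ` K i \<longrightarrow> set vs \<subseteq> T \<inter> cball 0 1 \<longrightarrow> length vs \<le> r \<longrightarrow>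
        \<bar>iter_deriv ?W vs (\<lambda>y. f (?i y) - f0 (?i y)) x\<bar> \<le> s"
      by (rule iter_deriv_slack[OF R smd cpt KW less]) blast+
    then obtain s where s: "s < \<epsilon> i" "\<And>vs x. x \<in> \<phi> ` K i \<Longrightarrow> set vs \<subseteq> T \<inter> cball 0 1 \<Longrightarrow> length vs \<le> r \<Longrightarrow>
        \<bar>iter_deriv ?W vs (\<lambda>y. f (?i y) - f0 (?i y)) x\<bar> \<le> s"
      by blast
    have "\<forall>\<beta>\<in>Basis. \<exists>B>0. \<forall>vs x. x \<in> \<phi> ` K i \<longrightarrow> set vs \<subseteq> T \<inter> cball 0 1 \<longrightarrow> length vs \<le> r \<longrightarrow>
        \<bar>iter_deriv ?W vs (\<lambda>y. e \<beta> (?i y)) x\<bar> \<le> B"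
    proof
      fix \<beta> :: 'n assume \<beta>: "\<beta> \<in> Basis"
      show "\<exists>B>0. \<forall>vs x. x \<in> \<phi> ` K i \<longrightarrow> set vs \<subseteq> T \<inter> cball 0 1 \<longrightarrow> length vs \<le> r \<longrightarrow>
        \<bar>iter_deriv ?W vs (\<lambda>y. e \<beta> (?i y)) x\<bar> \<le> B"
        by (rule iter_deriv_bounded[OF R sm[OF e[OF \<beta>]] cpt KW, of r]) blast
    qed
    from bchoice[OF this] obtain B where B: "\<And>\<beta>. \<beta> \<in> Basis \<Longrightarrow> B \<beta> > 0" "\<And>\<beta> vs x. \<beta> \<in> Basis \<Longrightarrow> x \<in> \<phi> ` K i \<Longrightarrow> set vs \<subseteq> T \<inter> cball 0 1 \<Longrightarrow> length vs \<le> r \<Longrightarrow>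
        \<bar>iter_deriv ?W vs (\<lambda>y. e \<beta> (?i y)) x\<bar> \<le> B \<beta>"
      by blast
    define S' where "S' = (\<Sum>\<beta>\<in>Basis. B \<beta>)"
    have S': "S' \<ge> 0" unfolding S'_def using B(1) by (intro sum_nonneg) (simp add: less_imp_le)
    \<comment> \<open>The gap divided by the sum of the bounds; adding 1 avoids division by zero and
      gives \<open>s + \<delta> * S' < \<epsilon> i\<close>.\<close>
    define \<delta> where "\<delta> = (\<epsilon> i - s) / (S' + 1)"
    have \<delta>: "\<delta> > 0" unfolding \<delta>_def using s(1) S' by simp
    have "ok i a" if a: "norm a < \<delta>" for a
      unfolding ok_def Ci fst_conv snd_conv
    proof (intro ballI allI impI, elim conjE)
      fix x vs assume x: "x \<in> K i" and vs: "set vs \<subseteq> T \<inter> cball 0 1" "length vs \<le> r"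
      have xW: "\<phi> x \<in> ?W" and xK: "\<phi> x \<in> \<phi> ` K i" using x KU by auto
      have vT: "set vs \<subseteq> T" using vs by blast
      have iQ: "?i y \<in> topspace Q" if "y \<in> ?W" for y
        using top_chart_inv(3)[OF ch that] top_chartD(4)[OF ch] by blast
      have "iter_deriv ?W vs (\<lambda>y. perturb f e a (?i y) - f0 (?i y)) (\<phi> x)
        = iter_deriv ?W vs (\<lambda>y. (f (?i y) - f0 (?i y)) + (\<Sum>\<beta>\<in>Basis. (a \<bullet> \<beta>) * e \<beta> (?i y))) (\<phi> x)"
        by (rule iter_deriv_cong[OF _ xW]) (simp add: perturb_def iQ)
      also have "\<dots> = iter_deriv ?W vs (\<lambda>y. f (?i y) - f0 (?i y)) (\<phi> x)
          + (\<Sum>\<beta>\<in>Basis. (a \<bullet> \<beta>) * iter_deriv ?W vs (\<lambda>y. e \<beta> (?i y)) (\<phi> x))"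
        by (rule iter_deriv_add_lincomb[OF R finite_Basis sm[OF e] smd vT xW])
      also have "\<bar>\<dots>\<bar> \<le> s + \<delta> * S'"
      proof (rule order_trans[OF abs_triangle_ineq], rule add_mono[OF s(2)[OF xK vs]])
        have "\<bar>\<Sum>\<beta>\<in>Basis. (a \<bullet> \<beta>) * iter_deriv ?W vs (\<lambda>y. e \<beta> (?i y)) (\<phi> x)\<bar> \<le> (\<Sum>\<beta>\<in>Basis. \<delta> * B \<beta>)"
        proof (rule order_trans[OF sum_abs], rule sum_mono)
          fix \<beta> :: 'n assume \<beta>: "\<beta> \<in> Basis"
          have "\<bar>a \<bullet> \<beta>\<bar> \<le> \<delta>" using Basis_le_norm[OF \<beta>, of a] a by linarith
          then show "\<bar>(a \<bullet> \<beta>) * iter_deriv ?W vs (\<lambda>y. e \<beta> (?i y)) (\<phi> x)\<bar> \<le> \<delta> * B \<beta>"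
            unfolding abs_mult using B(2)[OF \<beta> xK vs] \<delta> by (intro mult_mono) auto
        qed
        then show "\<bar>\<Sum>\<beta>\<in>Basis. (a \<bullet> \<beta>) * iter_deriv ?W vs (\<lambda>y. e \<beta> (?i y)) (\<phi> x)\<bar> \<le> \<delta> * S'"
          unfolding S'_def sum_distrib_left .
      qed
      also have "s + \<delta> * S' < \<epsilon> i"
      proof -
        have "\<delta> * (S' + 1) = \<epsilon> i - s" unfolding \<delta>_def using S' by simp
        then show ?thesis using \<delta> by (simp add: algebra_simps)
      qed
      finally show "\<bar>iter_deriv ?W vs (\<lambda>y. perturb f e a (?i y) - f0 (?i y)) (\<phi> x)\<bar> < \<epsilon> i" .
    qed
    then show ?thesis using \<delta> by blast
  qed
  have far: "ok i a" if i: "i \<in> I" "i \<notin> ?J" for i a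
  proof -
    obtain U \<phi> where Ci: "C i = (U, \<phi>)" by fastforce
    have max: "(U, \<phi>) \<in> maximal_atlas QM" and KU: "K i \<subseteq> U"
      using bspec[OF C i(1)] unfolding Ci by simp_all
    have ch: "top_chart Q T (U, \<phi>)" using max unfolding maximal_atlas_def mtop_QM model_QM by blast
    have eq: "perturb f e a (inv_into U \<phi> y) = f (inv_into U \<phi> y)" if y: "y \<in> \<phi> ` U" for y
    proof -
      have "inv_into U \<phi> y \<in> U" by (rule top_chart_inv(3)[OF ch y])
      then have "inv_into U \<phi> y \<notin> Kc" "inv_into U \<phi> y \<in> topspace Q" using i Ci top_chartD(4)[OF ch] by auto
      then show ?thesis unfolding perturb_def using ez by simp
    qed
    show ?thesis
      unfolding ok_def Ci fst_conv snd_conv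
    proof (intro ballI allI impI)
      fix x vs assume x: "x \<in> K i" and vs: "set vs \<subseteq> T \<inter> cball 0 1 \<and> length vs \<le> r"
      have "iter_deriv (\<phi> ` U) vs (\<lambda>y. perturb f e a (inv_into U \<phi> y) - f0 (inv_into U \<phi> y)) (\<phi> x)
        = iter_deriv (\<phi> ` U) vs (\<lambda>y. f (inv_into U \<phi> y) - f0 (inv_into U \<phi> y)) (\<phi> x)"
        by (rule iter_deriv_cong) (use eq x KU in auto)
      then show "\<bar>iter_deriv (\<phi> ` U) vs (\<lambda>y. perturb f e a (inv_into U \<phi> y) - f0 (inv_into U \<phi> y)) (\<phi> x)\<bar> < \<epsilon> i"
        using f i(1) x vs unfolding whitney_nbhd_def model_QM by (auto simp: Ci dest!: bspec[of _ _ i])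
    qed
  qed
  obtain d where d: "\<And>i. i \<in> I \<Longrightarrow> d i > 0" "\<And>i a. i \<in> I \<Longrightarrow> norm a < d i \<Longrightarrow> ok i a" using each by metis
  \<comment> \<open>The element 1 keeps the set nonempty when no chart meets the support.\<close>
  let ?\<delta> = "Min (insert 1 (d ` ?J))"
  have fin: "finite (insert 1 (d ` ?J))" using finJ by simp
  have "?\<delta> > 0" using fin d(1) by (subst Min_gr_iff) auto
  moreover have "ok i a" if i: "i \<in> I" and a: "norm a < ?\<delta>" for i a
  proof (cases "i \<in> ?J")
    case True
    then have "?\<delta> \<le> d i" using fin by (intro Min_le) auto
    then show ?thesis by (intro d(2)[OF i] less_le_trans[OF a])
  qed (use far i in blast)
  ultimately show ?thesis using ok_all by (intro exI[of _ ?\<delta>]) blast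
qed

text \<open>That small perturbations of each member stay in the set passes to finite intersections
  and to unions, so it has to be checked on the generating neighbourhoods only.\<close>

lemma perturb_open:
  fixes e :: "'n::euclidean_space \<Rightarrow> 'p set \<Rightarrow> real"
  assumes e: "\<And>\<beta>. \<beta> \<in> Basis \<Longrightarrow> smooth_fun QM (e \<beta>)"
    and Kc: "compactin Q Kc" and ez: "\<And>\<beta> q. \<beta> \<in> Basis \<Longrightarrow> q \<notin> Kc \<Longrightarrow> e \<beta> q = 0"
    and O: "openin (whitney_topology QM) N" and f: "f \<in> N"
  shows "\<exists>\<delta>>0. \<forall>a. norm a < \<delta> \<longrightarrow> perturb f e a \<in> N"
proof -
  have "generate_topology_on {whitney_nbhd QM r I C K \<epsilon> f | r I C K \<epsilon> f.
        f \<in> smooth_functions QM \<and>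
        (\<forall>i\<in>I. C i \<in> maximal_atlas QM \<and> compactin (mtop QM) (K i) \<and> K i \<subseteq> fst (C i) \<and> 0 < \<epsilon> i) \<and>
        (\<forall>x\<in>topspace (mtop QM). \<exists>N. openin (mtop QM) N \<and> x \<in> N \<and>
           finite {i \<in> I. fst (C i) \<inter> N \<noteq> {}})} N"
    using O unfolding whitney_topology_def by (rule openin_topology_generated_by)
  then show ?thesis using f
  proof (induction arbitrary: f rule: generate_topology_on.induct)
    case (Int a b)
    have fa: "f \<in> a" and fb: "f \<in> b" using Int.prems by blast+
    obtain d1 where d1: "d1 > 0" "\<forall>x. norm x < d1 \<longrightarrow> perturb f e x \<in> a" using Int.IH(1)[OF fa] by (elim exE conjE)
    obtain d2 where d2: "d2 > 0" "\<forall>x. norm x < d2 \<longrightarrow> perturb f e x \<in> b" using Int.IH(2)[OF fb] by (elim exE conjE)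
    show ?case using d1 d2 by (intro exI[of _ "min d1 d2"]) simp
  next
    case (UN K)
    obtain k where k: "k \<in> K" "f \<in> k" using UN.prems by (rule UnionE)
    from UN.IH[OF k] obtain d where "d > 0" "\<forall>x. norm x < d \<longrightarrow> perturb f e x \<in> k" by (elim exE conjE)
    then show ?case using k(1) by (intro exI[of _ d]) (simp, blast)
  next
    case (Basis s)
    then obtain r I C K \<epsilon> f0 where s: "s = whitney_nbhd QM r I C K \<epsilon> f0" "f0 \<in> smooth_functions QM"
      "\<forall>i\<in>I. C i \<in> maximal_atlas QM \<and> compactin Q (K i) \<and> K i \<subseteq> fst (C i) \<and> 0 < \<epsilon> i"
      "\<forall>x\<in>topspace Q. \<exists>N. openin Q N \<and> x \<in> N \<and> finite {i \<in> I. fst (C i) \<inter> N \<noteq> {}}"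
      unfolding mtop_QM by blast
    show ?case unfolding s(1) by (rule perturb_nbhd[OF e Kc ez s(2-4)]) (use Basis.prems s(1) in auto)
  qed simp
qed

text \<open>In a chart the perturbations are polynomials in one coordinate. Multiplied by \<rho>
  they extend to the whole orbit space, and as \<rho> is 1 on \<open>W\<close>, the Lie derivatives
  on \<open>W\<close> are those of the polynomials themselves.\<close>

lemma nondegenerate_dense:
  fixes \<rho> :: "'e \<Rightarrow> real"
  assumes tr: "transversal T A \<sigma>" and W: "open_in_subspace T W" "W \<subseteq> A"
    and \<eta>: "smooth_on T W \<eta>" and \<eta>T: "\<eta> ` W \<subseteq> T" and b: "\<And>y. y \<in> W \<Longrightarrow> \<eta> y \<bullet> b = 1" and K: "K \<subseteq> W"
    and \<rho>: "smooth_on T A \<rho>" "compact K\<rho>" "K\<rho> \<subseteq> A" "\<And>y. y \<in> A \<Longrightarrow> y \<notin> K\<rho> \<Longrightarrow> \<rho> y = 0" "\<And>y. y \<in> W \<Longrightarrow> \<rho> y = 1"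
  shows "(whitney_topology QM) closure_of (nondegenerate A \<sigma> W \<eta> K) = topspace (whitney_topology QM)"
  unfolding dense_intersects_open
proof (intro allI impI, elim conjE)
  fix N assume N: "openin (whitney_topology QM) N" "N \<noteq> {}"
  then obtain f where f: "f \<in> N" by blast
  have fS: "f \<in> smooth_functions QM" using f openin_subset[OF N(1)] unfolding topspace_whitney_topology by blast
  obtain \<iota> :: "'e \<times> real \<Rightarrow> nat" where \<iota>: "bij_betw \<iota> Basis {..<DIM('e \<times> real)}"
    using ex_bij_betw_finite_nat[OF finite_Basis] unfolding atLeast0LessThan by blast
  \<comment> \<open>The functions spanning the perturbations of \<open>generic_perturbation\<close>,
    times the cut-off.\<close>
  define w where "w = (\<lambda>\<beta> y. \<rho> y * ((y \<bullet> b) ^ Suc (\<iota> \<beta>) / real (Suc (\<iota> \<beta>))))"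
  define e where "e = (\<lambda>\<beta> q. if q \<in> cdom A \<sigma> then w \<beta> (cmap A \<sigma> q) else 0)"
  have RA: "open_in_subspace T A" by (rule tr_rel_open[OF tr])
  have smw: "smooth_on T A (w \<beta>)" for \<beta>
    unfolding w_def divide_inverse
    by (intro smooth_on_mult[OF RA] \<rho>(1) smooth_on_power[OF RA] smooth_on_inner_left[OF RA smooth_on_id[OF RA]] smooth_on_const[OF RA])
  have wz: "w \<beta> y = 0" if "y \<in> A" "y \<notin> K\<rho>" for \<beta> y using \<rho>(4)[OF that] by (simp add: w_def)
  have e: "smooth_fun QM (e \<beta>)" for \<beta>
    unfolding e_def by (rule smooth_fun_extend[OF tr smw \<rho>(2,3) wz])
  let ?Kc = "(\<lambda>s. \<pi> (\<sigma> s)) ` K\<rho>"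
  have ez: "e \<beta> q = 0" if q: "q \<notin> ?Kc" for \<beta> q
  proof (cases "q \<in> cdom A \<sigma>")
    case True
    have "cmap A \<sigma> q \<notin> K\<rho>" using q quot_cmap[OF tr True] by (metis imageI)
    then show ?thesis using wz cmap_in[OF tr True] by (simp add: e_def)
  qed (simp add: e_def)
  have "\<exists>\<delta>>0. \<forall>a. norm a < \<delta> \<longrightarrow> perturb f e a \<in> N"
    by (rule perturb_open[OF e quot_compact[OF tr \<rho>(2,3)] ez N(1) f])
  then obtain \<delta> where \<delta>: "\<delta> > 0" "\<And>a. norm a < \<delta> \<Longrightarrow> perturb f e a \<in> N" by blast
  let ?f = "\<lambda>y. f (\<pi> (\<sigma> y))"
  have smf: "smooth_on T W ?f"
    by (rule smooth_on_subset_rel[OF smooth_fun_QM_chart[OF smooth_functionsD(1)[OF fS] tr] RA W])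
  \<comment> \<open>Every ball of parameters contains a good one, because the bad ones form a
    negligible set.\<close>
  have "\<not> negligible (ball (0 :: 'e \<times> real) \<delta>)" using \<delta>(1) by (intro open_not_negligible) auto
  then have "\<not> ball 0 \<delta> \<subseteq> {a. \<exists>y\<in>K. \<forall>j<DIM('e \<times> real).
    (lie_deriv W \<eta> ^^ Suc j) (\<lambda>y. ?f y + (\<Sum>\<beta>\<in>Basis. (a \<bullet> \<beta>) * ((y \<bullet> b) ^ Suc (\<iota> \<beta>) / real (Suc (\<iota> \<beta>))))) y = 0}"
    using negligible_subset[OF generic_perturbation[OF W(1) \<eta> \<eta>T b smf K \<iota>]] by blast
  then obtain a where ab: "a \<in> ball 0 \<delta>" and na: "\<not> (\<exists>y\<in>K. \<forall>j<DIM('e \<times> real).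
    (lie_deriv W \<eta> ^^ Suc j) (\<lambda>y. ?f y + (\<Sum>\<beta>\<in>Basis. (a \<bullet> \<beta>) * ((y \<bullet> b) ^ Suc (\<iota> \<beta>) / real (Suc (\<iota> \<beta>))))) y = 0)"
    by blast
  have a: "norm a < \<delta>" using ab by (simp only: mem_ball_0)
  let ?u = "perturb f e a"
  have eq: "?u (\<pi> (\<sigma> y)) = ?f y + (\<Sum>\<beta>\<in>Basis. (a \<bullet> \<beta>) * ((y \<bullet> b) ^ Suc (\<iota> \<beta>) / real (Suc (\<iota> \<beta>))))" if y: "y \<in> W" for y
  proof -
    have yA: "y \<in> A" using y W by blast
    have "e \<beta> (\<pi> (\<sigma> y)) = (y \<bullet> b) ^ Suc (\<iota> \<beta>) / real (Suc (\<iota> \<beta>))" for \<beta>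
      unfolding e_def using quot_in[OF tr yA] cmap_quot[OF tr yA] \<rho>(5)[OF y] by (simp add: w_def)
    moreover have "\<pi> (\<sigma> y) \<in> topspace Q" using quot_in[OF tr yA] cdom_subset[OF tr] by blast
    ultimately show ?thesis by (simp add: perturb_def)
  qed
  have "?u \<in> nondegenerate A \<sigma> W \<eta> K"
    unfolding nondegenerate_def
  proof (intro CollectI conjI ballI perturb_smooth[OF fS e])
    fix y assume y: "y \<in> K"
    then obtain j where j: "j < DIM('e \<times> real)" "(lie_deriv W \<eta> ^^ Suc j) (\<lambda>y. ?f y + (\<Sum>\<beta>\<in>Basis. (a \<bullet> \<beta>) * ((y \<bullet> b) ^ Suc (\<iota> \<beta>) / real (Suc (\<iota> \<beta>))))) y \<noteq> 0"
      using na by blast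
    have yW: "y \<in> W" using y K by blast
    have "(lie_deriv W \<eta> ^^ Suc j) (\<lambda>y. ?u (\<pi> (\<sigma> y))) y = (lie_deriv W \<eta> ^^ Suc j)
      (\<lambda>y. ?f y + (\<Sum>\<beta>\<in>Basis. (a \<bullet> \<beta>) * ((y \<bullet> b) ^ Suc (\<iota> \<beta>) / real (Suc (\<iota> \<beta>))))) y"
      by (rule lie_iter_cong[OF W(1) \<eta> \<eta>T _ yW]) (rule eq)
    then have "(lie_deriv W \<eta> ^^ Suc j) (\<lambda>y. ?u (\<pi> (\<sigma> y))) y \<noteq> 0" using j(2) by (simp only: not_False_eq_True)
    then show "\<exists>j<DIM('e \<times> real). (lie_deriv W \<eta> ^^ Suc j) (\<lambda>y. ?u (\<pi> (\<sigma> y))) y \<noteq> 0" using j(1) by blast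
  qed
  then show "nondegenerate A \<sigma> W \<eta> K \<inter> N \<noteq> {}" using \<delta>(2)[OF a] by blast
qed

end

section \<open>Conserved functions\<close>

context invariant_field begin

text \<open>Nested sets in a slice chart, each with its task: on \<open>D\<close> solutions are
  shown to be locally constant, on the compact \<open>K\<close> nondegeneracy is imposed, on the
  open \<open>W\<close> derivatives are taken and \<rho> is 1, and outside the compact
  \<open>K\<rho>\<close> the cut-off vanishes so that functions extend by zero.\<close>

definition slice_box :: "'e set \<Rightarrow> ('e \<Rightarrow> 'p) \<Rightarrow> 'e set \<Rightarrow> 'e set \<Rightarrow> 'e set \<Rightarrow> ('e \<Rightarrow> real) \<Rightarrow> 'e set \<Rightarrow> bool" where
  "slice_box A \<sigma> D K W \<rho> K\<rho> \<longleftrightarrow> transversal T A \<sigma> \<and> open_in_subspace T D \<and> D \<subseteq> K \<and> compact K \<and> K \<subseteq> W \<and>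
     open_in_subspace T W \<and> W \<subseteq> A \<and> smooth_on T A \<rho> \<and> compact K\<rho> \<and> K\<rho> \<subseteq> A \<and>
     (\<forall>y\<in>A. y \<notin> K\<rho> \<longrightarrow> \<rho> y = 0) \<and> (\<forall>y\<in>W. \<rho> y = 1)"

lemma slice_box_exists:
  assumes p: "p \<in> E"
  obtains A \<sigma> D K W \<rho> K\<rho> where "slice_box A \<sigma> D K W \<rho> K\<rho>" "\<exists>s\<in>D. \<pi> (\<sigma> s) = \<pi> p"
proof -
  obtain A \<sigma> where tr: "transversal T A \<sigma>" and ex: "\<exists>s\<in>A. \<pi> (\<sigma> s) = \<pi> p" by (rule slice[OF p])
  obtain s where s: "s \<in> A" "\<pi> (\<sigma> s) = \<pi> p" using ex by blast
  note RA = tr_rel_open[OF tr]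
  obtain U where U: "open U" "A = T \<inter> U" using open_in_subspaceD(2)[OF RA] by (auto simp: openin_open)
  obtain d where d: "d > 0" "cball s d \<subseteq> U" using U s open_contains_cball by blast
  \<comment> \<open>The radii r, 2r and 3r = d give \<open>D\<close> and \<open>K\<close>, then
    \<open>W\<close>, then the support of \<rho>.\<close>
  define r where "r = d / 3"
  have r: "r > 0" and d3: "3 * r = d" using d(1) by (auto simp: r_def)
  obtain \<rho> :: "'e \<Rightarrow> real" where "\<forall>S W. open_in_subspace S W \<longrightarrow> smooth_on S W \<rho>"
    and "\<forall>x. dist s x \<le> 2 * r \<longrightarrow> \<rho> x = 1" and "\<forall>x. dist s x \<ge> 3 * r \<longrightarrow> \<rho> x = 0"
  proof -
    have "0 < 2 * r" "2 * r < 3 * r" using r by auto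
    then show thesis by (rule smooth_bump[of "2 * r" "3 * r" s]) (use that in blast)
  qed
  note \<rho> = this[rule_format]
  have RT: "open_in_subspace T T" using orbit_model by (simp add: open_in_subspace_def)
  have cl: "closed T" using closed_subspace orbit_model by blast
  have "slice_box A \<sigma> (T \<inter> ball s r) (T \<inter> cball s r) (T \<inter> ball s (2 * r)) \<rho> (T \<inter> cball s (3 * r))"
    unfolding slice_box_def
  proof (intro conjI tr open_in_subspace_Int_open[OF RT] open_ball ballI impI)
    show "T \<inter> ball s r \<subseteq> T \<inter> cball s r" by auto
    show "compact (T \<inter> cball s r)" "compact (T \<inter> cball s (3 * r))" using cl by (simp_all add: closed_Int_compact)
    show "T \<inter> cball s r \<subseteq> T \<inter> ball s (2 * r)" using r by auto
    have "ball s (2 * r) \<subseteq> cball s d" unfolding d3[symmetric] using r by auto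
    then show "T \<inter> ball s (2 * r) \<subseteq> A" using d(2) U(2) by blast
    show "T \<inter> cball s (3 * r) \<subseteq> A" using d(2) U(2) unfolding d3 by blast
    show "smooth_on T A \<rho>" by (rule \<rho>(1)[OF RA])
    show "\<rho> y = 0" if "y \<in> A" "y \<notin> T \<inter> cball s (3 * r)" for y
      by (rule \<rho>(3)) (use that U(2) in auto)
    show "\<rho> y = 1" if "y \<in> T \<inter> ball s (2 * r)" for y
      by (rule \<rho>(2)) (use that in auto)
  qed
  moreover have "\<exists>t\<in>T \<inter> ball s r. \<pi> (\<sigma> t) = \<pi> p" using s U(2) r by (intro bexI[of _ s]) auto
  ultimately show thesis by (rule that)
qed

lemma curve_preimage_open:
  assumes c: "integral_curve P X J c" and V: "openin Q V"
  shows "open {t \<in> J. \<pi> (c t) \<in> V}"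
proof -
  have "continuous_map (top_of_set J) Q (\<pi> \<circ> c)" and J: "open J"
    using integral_curve_orbit[OF c] unfolding integral_curve_def mtop_QM by auto
  from openin_continuous_map_preimage[OF this(1) V]
  have "openin (top_of_set J) {t \<in> J. \<pi> (c t) \<in> V}" by simp
  then show ?thesis using J openin_open_trans by blast
qed

definition cutoff_coord :: "'e set \<Rightarrow> ('e \<Rightarrow> 'p) \<Rightarrow> ('e \<Rightarrow> real) \<Rightarrow> 'e \<Rightarrow> 'p set \<Rightarrow> real" where
  "cutoff_coord A \<sigma> \<rho> b = (\<lambda>q. if q \<in> cdom A \<sigma> then \<rho> (cmap A \<sigma> q) * (cmap A \<sigma> q \<bullet> b) else 0)"

text \<open>
  The coefficients of the coeff_field induced on the orbit space, obtained by applying \<open>X\<close> to cut-off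
  coordinate functions.  That derivations act through these coefficients is only needed along
  solutions, where it is the chain rule.
\<close>

definition coeff_field :: "'e set \<Rightarrow> 'e set \<Rightarrow> ('e \<Rightarrow> 'p) \<Rightarrow> ('e \<Rightarrow> real) \<Rightarrow> 'e \<Rightarrow> 'e" where
  "coeff_field B A \<sigma> \<rho> y = (\<Sum>b\<in>B. X (\<sigma> y) (\<lambda>x. cutoff_coord A \<sigma> \<rho> b (\<pi> x)) *\<^sub>R b)"

context
  fixes A \<sigma> D K W \<rho> K\<rho> B
  assumes bx: "slice_box A \<sigma> D K W \<rho> K\<rho>"
    and B: "finite B" "B \<subseteq> T" "\<And>v. v \<in> T \<Longrightarrow> (\<Sum>b\<in>B. (v \<bullet> b) *\<^sub>R b) = v"
begin

lemma box_transversal: "transversal T A \<sigma>"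
  and box_D_rel_open: "open_in_subspace T D" and box_D_subset: "D \<subseteq> K" and box_K_compact: "compact K" and box_K_subset: "K \<subseteq> W" and box_W_rel_open: "open_in_subspace T W"
  and box_W_subset: "W \<subseteq> A" and box_cutoff: "smooth_on T A \<rho>" "compact K\<rho>" "K\<rho> \<subseteq> A"
  "\<And>y. y \<in> A \<Longrightarrow> y \<notin> K\<rho> \<Longrightarrow> \<rho> y = 0" "\<And>y. y \<in> W \<Longrightarrow> \<rho> y = 1"
  using bx unfolding slice_box_def by auto

lemma cutoff_coord_smooth: "smooth_fun QM (cutoff_coord A \<sigma> \<rho> b)"
proof -
  note RA = tr_rel_open[OF box_transversal]
  have "smooth_on T A (\<lambda>y. \<rho> y * (y \<bullet> b))"
    by (intro smooth_on_mult[OF RA] box_cutoff(1) smooth_on_inner_left[OF RA smooth_on_id[OF RA]])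
  then show ?thesis unfolding cutoff_coord_def
    by (rule smooth_fun_extend[OF box_transversal _ box_cutoff(2,3)]) (simp add: box_cutoff(4))
qed

lemma coeff_field_smooth: "smooth_on T A (coeff_field B A \<sigma> \<rho>)"
proof -
  note RA = tr_rel_open[OF box_transversal]
  have "smooth_fun P (\<lambda>p. X p (\<lambda>x. cutoff_coord A \<sigma> \<rho> b (\<pi> x)))" for b
    using X smooth_fun_pullback[OF cutoff_coord_smooth] unfolding smooth_vector_field_def by blast
  then show ?thesis unfolding coeff_field_def
    by (intro smooth_on_sum[OF RA] smooth_on_scaleR[OF RA] smooth_on_const[OF RA] plot_smooth_fun[OF charted_P _ tr_plot[OF box_transversal]])
qed

lemma coeff_field_T: "coeff_field B A \<sigma> \<rho> y \<in> T"
  unfolding coeff_field_def using B(2) orbit_model(1) by (intro subspace_sum subspace_scale) auto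

lemma quot_image_iff:
  assumes "V \<subseteq> A"
  shows "q \<in> (\<lambda>s. \<pi> (\<sigma> s)) ` V \<longleftrightarrow> q \<in> cdom A \<sigma> \<and> cmap A \<sigma> q \<in> V"
proof
  assume "q \<in> (\<lambda>s. \<pi> (\<sigma> s)) ` V"
  then obtain s where "s \<in> V" "q = \<pi> (\<sigma> s)" by blast
  then show "q \<in> cdom A \<sigma> \<and> cmap A \<sigma> q \<in> V" using assms quot_in[OF box_transversal] cmap_quot[OF box_transversal] by auto
next
  assume q: "q \<in> cdom A \<sigma> \<and> cmap A \<sigma> q \<in> V"
  show "q \<in> (\<lambda>s. \<pi> (\<sigma> s)) ` V"
    by (rule image_eqI[of _ _ "cmap A \<sigma> q"]) (use q quot_cmap[OF box_transversal] in auto)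
qed

text \<open>While the curve is over \<open>W\<close>, its coordinates are the cut-off coordinates
  along \<open>c\<close>, whose derivatives are given by \<open>X\<close> at \<open>c t\<close>. By
  \<open>X_orbit\<close> these may be evaluated at the slice point of the same orbit, where they are
  the coefficients of \<xi>.\<close>

lemma curve_velocity:
  assumes c: "integral_curve P X J c" and t: "t \<in> J" and \<pi>t: "\<pi> (c t) \<in> (\<lambda>s. \<pi> (\<sigma> s)) ` W"
  shows "((\<lambda>t. cmap A \<sigma> (\<pi> (c t))) has_vector_derivative coeff_field B A \<sigma> \<rho> (cmap A \<sigma> (\<pi> (c t)))) (at t)"
proof -
  let ?\<gamma> = "\<lambda>t. cmap A \<sigma> (\<pi> (c t))"
  let ?N = "{t \<in> J. \<pi> (c t) \<in> (\<lambda>s. \<pi> (\<sigma> s)) ` W}"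
  have oN: "open ?N" by (rule curve_preimage_open[OF c quot_open_image[OF box_transversal box_W_rel_open box_W_subset]])
  have tN: "t \<in> ?N" using t \<pi>t by blast
  have ct: "c t \<in> E" by (rule integral_curve_E[OF c t])
  have q: "\<pi> (c t) \<in> cdom A \<sigma>" using \<pi>t quot_image_iff[OF box_W_subset] by blast
  have \<sigma>E: "\<sigma> (?\<gamma> t) \<in> E" by (rule tr_E[OF box_transversal cmap_in[OF box_transversal q]])
  have d: "((\<lambda>t. ?\<gamma> t \<bullet> b) has_vector_derivative X (\<sigma> (?\<gamma> t)) (\<lambda>x. cutoff_coord A \<sigma> \<rho> b (\<pi> x))) (at t)" for b
  proof -
    have "((\<lambda>x. cutoff_coord A \<sigma> \<rho> b (\<pi> x)) \<circ> c has_real_derivative X (c t) (\<lambda>x. cutoff_coord A \<sigma> \<rho> b (\<pi> x))) (at t)"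
      using c t smooth_fun_pullback[OF cutoff_coord_smooth] unfolding integral_curve_def by blast
    also have "X (c t) (\<lambda>x. cutoff_coord A \<sigma> \<rho> b (\<pi> x)) = X (\<sigma> (?\<gamma> t)) (\<lambda>x. cutoff_coord A \<sigma> \<rho> b (\<pi> x))"
      by (rule X_orbit[OF cutoff_coord_smooth ct \<sigma>E]) (simp add: quot_cmap[OF box_transversal q])
    finally have "((\<lambda>x. cutoff_coord A \<sigma> \<rho> b (\<pi> x)) \<circ> c has_vector_derivative X (\<sigma> (?\<gamma> t)) (\<lambda>x. cutoff_coord A \<sigma> \<rho> b (\<pi> x))) (at t)"
      unfolding has_real_derivative_iff_has_vector_derivative .
    then show ?thesis
    proof (rule has_vector_derivative_transform_within_open[OF _ oN tN])
      fix s assume "s \<in> ?N"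
      then have "\<pi> (c s) \<in> cdom A \<sigma>" "?\<gamma> s \<in> W" using quot_image_iff[OF box_W_subset] by auto
      then show "((\<lambda>x. cutoff_coord A \<sigma> \<rho> b (\<pi> x)) \<circ> c) s = ?\<gamma> s \<bullet> b" by (simp add: cutoff_coord_def box_cutoff(5))
    qed
  qed
  have "((\<lambda>t. \<Sum>b\<in>B. (?\<gamma> t \<bullet> b) *\<^sub>R b) has_vector_derivative coeff_field B A \<sigma> \<rho> (?\<gamma> t)) (at t)"
    unfolding coeff_field_def
    by (intro has_vector_derivative_sum bounded_linear.has_vector_derivative[OF bounded_linear_scaleR_left d])
  then show ?thesis
  proof (rule has_vector_derivative_transform_within_open[OF _ oN tN])
    fix s assume "s \<in> ?N"
    then have "?\<gamma> s \<in> T" using quot_image_iff[OF box_W_subset] open_in_subspaceD(3)[OF box_W_rel_open] by blast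
    then show "(\<Sum>b\<in>B. (?\<gamma> s \<bullet> b) *\<^sub>R b) = ?\<gamma> s" by (rule B(3))
  qed
qed

abbreviation "\<xi> \<equiv> coeff_field B A \<sigma> \<rho>"
abbreviation "Wb b \<equiv> {y \<in> W. \<xi> y \<bullet> b \<noteq> 0}"
abbreviation "\<eta>b b \<equiv> (\<lambda>y. inverse (\<xi> y \<bullet> b) *\<^sub>R \<xi> y)"
text \<open>For varying m these compact sets exhaust the part of \<open>K\<close> where \<xi> has a
  nonzero component along \<open>b\<close>. On that part as a whole nondegeneracy would lack the
  compactness behind \<open>nondegenerate_open\<close>.\<close>

abbreviation "Kb b m \<equiv> {y \<in> K. 1 / real (Suc m) \<le> \<bar>\<xi> y \<bullet> b\<bar>}"

lemma Wb_rel_open: "open_in_subspace T (Wb b)" and \<eta>b_smooth: "smooth_on T (Wb b) (\<eta>b b)"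
  and \<eta>b_T: "\<eta>b b ` Wb b \<subseteq> T"
proof -
  note RA = tr_rel_open[OF box_transversal]
  have sm: "smooth_on T W \<xi>" by (rule smooth_on_subset_rel[OF coeff_field_smooth RA box_W_rel_open box_W_subset])
  have "continuous_on W (\<lambda>y. \<xi> y \<bullet> b)" by (rule smooth_on_continuous[OF smooth_on_inner_left[OF box_W_rel_open sm]])
  moreover have "open (- {0::real})" by (intro open_Compl) simp
  ultimately show R: "open_in_subspace T (Wb b)"
    using open_in_subspace_vimage[OF box_W_rel_open open_in_subspace_UNIV[of "- {0::real}"]] by simp
  have smb: "smooth_on T (Wb b) \<xi>" by (rule smooth_on_subset_rel[OF sm box_W_rel_open R]) auto
  show "smooth_on T (Wb b) (\<eta>b b)"
    by (intro smooth_on_scaleR[OF R] smooth_on_inverse[OF R] smooth_on_inner_left[OF R] smb) auto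
  show "\<eta>b b ` Wb b \<subseteq> T" using coeff_field_T orbit_model(1) by (auto intro: subspace_scale)
qed

lemma Kb_compact: "compact (Kb b m)" and Kb_subset: "Kb b m \<subseteq> Wb b"
proof -
  have KA: "K \<subseteq> A" using box_K_subset box_W_subset by blast
  have "continuous_on K (\<lambda>y. \<bar>\<xi> y \<bullet> b\<bar>)"
    by (intro continuous_on_rabs continuous_on_inner continuous_on_const continuous_on_subset[OF smooth_on_continuous[OF coeff_field_smooth] KA])
  then have "closedin (top_of_set K) (K \<inter> (\<lambda>y. \<bar>\<xi> y \<bullet> b\<bar>) -` {1 / real (Suc m)..})"
    by (rule continuous_closedin_preimage) simp
  then have "compact (K \<inter> (\<lambda>y. \<bar>\<xi> y \<bullet> b\<bar>) -` {1 / real (Suc m)..})" by (rule closedin_compact[OF box_K_compact])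
  moreover have "K \<inter> (\<lambda>y. \<bar>\<xi> y \<bullet> b\<bar>) -` {1 / real (Suc m)..} = Kb b m" by auto
  ultimately show "compact (Kb b m)" by simp
  show "Kb b m \<subseteq> Wb b" using box_K_subset by (auto simp: divide_le_eq)
qed

text \<open>The velocity of the projected curve is \<xi>, and \<eta>b is a multiple of it; a
  function constant along the curve is thus annihilated by \<eta>b there.\<close>

lemma lie_deriv_along_curve:
  assumes c: "integral_curve P X J c" and h: "smooth_on T (Wb b) h"
    and N: "open N" "N \<subseteq> J" "\<And>t. t \<in> N \<Longrightarrow> \<pi> (c t) \<in> (\<lambda>s. \<pi> (\<sigma> s)) ` Wb b"
    and const: "\<And>t. t \<in> N \<Longrightarrow> h (cmap A \<sigma> (\<pi> (c t))) = k" and t: "t \<in> N"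
  shows "lie_deriv (Wb b) (\<eta>b b) h (cmap A \<sigma> (\<pi> (c t))) = 0"
proof -
  let ?\<gamma> = "\<lambda>t. cmap A \<sigma> (\<pi> (c t))"
  have WbA: "Wb b \<subseteq> A" using box_W_subset by blast
  have \<gamma>W: "?\<gamma> s \<in> Wb b" if "s \<in> N" for s using N(3)[OF that] quot_image_iff[OF WbA] by blast
  have \<gamma>t: "?\<gamma> t \<in> Wb b" by (rule \<gamma>W[OF t])
  define D where "D = frechet_derivative h (at (?\<gamma> t) within Wb b)"
  have D: "(h has_derivative D) (at (?\<gamma> t) within Wb b)" unfolding D_def by (rule smooth_on_has_derivative[OF h \<gamma>t])
  have "(?\<gamma> has_vector_derivative \<xi> (?\<gamma> t)) (at t)"
    by (rule curve_velocity[OF c]) (use t N(2) N(3)[OF t] in blast)+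
  then have g: "(?\<gamma> has_derivative (\<lambda>s. s *\<^sub>R \<xi> (?\<gamma> t))) (at t within N)"
    unfolding has_vector_derivative_def by (rule has_derivative_at_withinI)
  have "?\<gamma> ` N \<subseteq> Wb b" using \<gamma>W by blast
  from has_derivative_in_compose[OF g has_derivative_subset[OF D this]]
  have "((\<lambda>s. h (?\<gamma> s)) has_derivative (\<lambda>s. D (s *\<^sub>R \<xi> (?\<gamma> t)))) (at t within N)" .
  then have "((\<lambda>s. k) has_derivative (\<lambda>s. D (s *\<^sub>R \<xi> (?\<gamma> t)))) (at t within N)"
    by (rule has_derivative_transform[OF t, rotated]) (simp add: const)
  then have "((\<lambda>s. k) has_derivative (\<lambda>s. D (s *\<^sub>R \<xi> (?\<gamma> t)))) (at t)"
    unfolding at_within_open[OF t N(1)] .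
  from has_derivative_unique[OF this has_derivative_const]
  have "D (1 *\<^sub>R \<xi> (?\<gamma> t)) = 0" by (rule fun_cong)
  then have "D (\<eta>b b (?\<gamma> t)) = 0" using linear_scale[OF has_derivative_linear[OF D]] by simp
  then show ?thesis using lie_deriv_eq[OF Wb_rel_open \<eta>b_smooth \<eta>b_T D \<gamma>t] by simp
qed

text \<open>If \<xi> were nonzero, one of its components would be, and the curve would stay for a
  while where \<eta>b is defined. Conservation then makes all iterated derivatives vanish along it,
  against nondegeneracy at time \<open>t\<close>.\<close>

lemma conserved_imp_field_zero:
  assumes f: "\<And>b m. b \<in> B \<Longrightarrow> f \<in> nondegenerate A \<sigma> (Wb b) (\<eta>b b) (Kb b m)"
    and c: "integral_curve P X J c" and const: "\<And>t. t \<in> J \<Longrightarrow> f (\<pi> (c t)) = k"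
    and t: "t \<in> J" "\<pi> (c t) \<in> (\<lambda>s. \<pi> (\<sigma> s)) ` K"
  shows "\<xi> (cmap A \<sigma> (\<pi> (c t))) = 0"
proof (rule ccontr)
  let ?\<gamma> = "\<lambda>t. cmap A \<sigma> (\<pi> (c t))"
  let ?f = "\<lambda>y. f (\<pi> (\<sigma> y))"
  assume nz: "\<xi> (?\<gamma> t) \<noteq> 0"
  have KA: "K \<subseteq> A" using box_K_subset box_W_subset by blast
  have \<gamma>K: "?\<gamma> t \<in> K" and q: "\<pi> (c t) \<in> cdom A \<sigma>" using t(2) quot_image_iff[OF KA] by auto
  obtain b where b: "b \<in> B" "\<xi> (?\<gamma> t) \<bullet> b \<noteq> 0"
  proof (rule ccontr)
    assume "\<not> thesis"
    then have "\<forall>b\<in>B. \<xi> (?\<gamma> t) \<bullet> b = 0" using that by blast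
    then have "(\<Sum>b\<in>B. (\<xi> (?\<gamma> t) \<bullet> b) *\<^sub>R b) = 0" by (intro sum.neutral) simp
    then show False using B(3)[OF coeff_field_T] nz by simp
  qed
  \<comment> \<open>Selects a compact set \<open>Kb b m\<close> containing the point.\<close>
  obtain m where m: "inverse (real (Suc m)) < \<bar>\<xi> (?\<gamma> t) \<bullet> b\<bar>" using reals_Archimedean[of "\<bar>\<xi> (?\<gamma> t) \<bullet> b\<bar>"] b(2) by auto
  have "?\<gamma> t \<in> Kb b m" using \<gamma>K m by (simp add: inverse_eq_divide)
  then obtain j where j: "(lie_deriv (Wb b) (\<eta>b b) ^^ Suc j) ?f (?\<gamma> t) \<noteq> 0"
    using f[OF b(1), of m] unfolding nondegenerate_def by blast
  have fS: "f \<in> smooth_functions QM" using f[OF b(1), of m] unfolding nondegenerate_def by blast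
  have WbA: "Wb b \<subseteq> A" using box_W_subset by blast
  have smf: "smooth_on T (Wb b) ?f"
    by (rule smooth_on_subset_rel[OF smooth_fun_QM_chart[OF smooth_functionsD(1)[OF fS] box_transversal] tr_rel_open[OF box_transversal] Wb_rel_open WbA])
  define N where "N = {t \<in> J. \<pi> (c t) \<in> (\<lambda>s. \<pi> (\<sigma> s)) ` Wb b}"
  have oN: "open N" unfolding N_def by (rule curve_preimage_open[OF c quot_open_image[OF box_transversal Wb_rel_open WbA]])
  have NJ: "N \<subseteq> J" and Nq: "\<And>t. t \<in> N \<Longrightarrow> \<pi> (c t) \<in> (\<lambda>s. \<pi> (\<sigma> s)) ` Wb b" unfolding N_def by auto
  have tN: "t \<in> N" unfolding N_def using t(1) q \<gamma>K box_K_subset b(2) quot_image_iff[OF WbA] by blast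
  have zero: "(lie_deriv (Wb b) (\<eta>b b) ^^ Suc i) ?f (?\<gamma> s) = 0" if const: "\<And>s. s \<in> N \<Longrightarrow> (lie_deriv (Wb b) (\<eta>b b) ^^ i) ?f (?\<gamma> s) = k'" and s: "s \<in> N" for i k' s
    unfolding funpow.simps o_apply
    by (rule lie_deriv_along_curve[OF c lie_iter_smooth[OF Wb_rel_open \<eta>b_smooth \<eta>b_T smf] oN NJ Nq const s])
  \<comment> \<open>Constancy, unlike vanishing, also holds at order zero, where the constant is the
    conserved value; so constancy is what the induction carries.\<close>
  have "\<exists>k'. \<forall>s\<in>N. (lie_deriv (Wb b) (\<eta>b b) ^^ i) ?f (?\<gamma> s) = k'" for i
  proof (induction i)
    case 0
    have "?f (?\<gamma> s) = k" if "s \<in> N" for s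
    proof -
      have "\<pi> (c s) \<in> cdom A \<sigma>" using Nq[OF that] quot_image_iff[OF WbA] by blast
      then show ?thesis using const[of s] NJ that quot_cmap[OF box_transversal] by auto
    qed
    then show ?case by auto
  next
    case (Suc i)
    then obtain k' where "\<And>s. s \<in> N \<Longrightarrow> (lie_deriv (Wb b) (\<eta>b b) ^^ i) ?f (?\<gamma> s) = k'" by blast
    from zero[OF this] show ?case by blast
  qed
  then obtain k' where "\<And>s. s \<in> N \<Longrightarrow> (lie_deriv (Wb b) (\<eta>b b) ^^ j) ?f (?\<gamma> s) = k'" by blast
  from zero[OF this tN] j show False by blast
qed

text \<open>As \<open>D\<close> is open, the curve remains over it for times near \<open>t\<close>;
  there its velocity is zero, so its slice coordinate and with it the orbit is constant.\<close>

lemma conserved_imp_locally_constant: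
  assumes f: "\<And>b m. b \<in> B \<Longrightarrow> f \<in> nondegenerate A \<sigma> (Wb b) (\<eta>b b) (Kb b m)"
    and c: "integral_curve P X J c" and const: "\<And>t. t \<in> J \<Longrightarrow> f (\<pi> (c t)) = k"
    and t: "t \<in> J" "\<pi> (c t) \<in> (\<lambda>s. \<pi> (\<sigma> s)) ` D"
  shows "\<forall>\<^sub>F s in at t within J. \<pi> (c t) = \<pi> (c s)"
proof -
  let ?\<gamma> = "\<lambda>t. cmap A \<sigma> (\<pi> (c t))"
  let ?N = "{t \<in> J. \<pi> (c t) \<in> (\<lambda>s. \<pi> (\<sigma> s)) ` D}"
  have DA: "D \<subseteq> A" using box_D_subset box_K_subset box_W_subset by blast
  have oN: "open ?N" by (rule curve_preimage_open[OF c quot_open_image[OF box_transversal box_D_rel_open DA]])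
  obtain d where d: "d > 0" "ball t d \<subseteq> ?N" using oN t open_contains_ball by blast
  have "(?\<gamma> has_derivative (\<lambda>h. 0)) (at s within ball t d)" if s: "s \<in> ball t d" for s
  proof -
    have sN: "s \<in> J" "\<pi> (c s) \<in> (\<lambda>s. \<pi> (\<sigma> s)) ` D" using s d(2) by auto
    then have sK: "\<pi> (c s) \<in> (\<lambda>s. \<pi> (\<sigma> s)) ` K" and sW: "\<pi> (c s) \<in> (\<lambda>s. \<pi> (\<sigma> s)) ` W" using box_D_subset box_K_subset by blast+
    have "\<xi> (?\<gamma> s) = 0" by (rule conserved_imp_field_zero[OF f c const sN(1) sK])
    then have "(?\<gamma> has_vector_derivative 0) (at s)" using curve_velocity[OF c sN(1) sW] by simp
    then show ?thesis unfolding has_vector_derivative_def by (simp add: has_derivative_at_withinI)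
  qed
  then obtain y where y: "\<And>s. s \<in> ball t d \<Longrightarrow> ?\<gamma> s = y"
    using has_derivative_zero_constant[OF convex_ball, of t d ?\<gamma>] by blast
  have "\<pi> (c t) = \<pi> (c s)" if s: "s \<in> ball t d" for s
  proof -
    have tb: "t \<in> ball t d" using d(1) by simp
    have "\<pi> (c s) \<in> cdom A \<sigma>" "\<pi> (c t) \<in> cdom A \<sigma>" using s tb d(2) quot_image_iff[OF DA] by blast+
    then have "\<pi> (c s) = \<pi> (\<sigma> (?\<gamma> s))" "\<pi> (c t) = \<pi> (\<sigma> (?\<gamma> t))" using quot_cmap[OF box_transversal] by auto
    then show ?thesis using y[OF s] y[OF tb] by simp
  qed
  then show ?thesis
    unfolding eventually_at using d(1) by (intro exI[of _ d]) (auto simp: dist_commute)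
qed

lemma nondegenerate_open_dense:
  assumes b: "b \<in> B"
  shows "openin (whitney_topology QM) (nondegenerate A \<sigma> (Wb b) (\<eta>b b) (Kb b m))"
    "(whitney_topology QM) closure_of (nondegenerate A \<sigma> (Wb b) (\<eta>b b) (Kb b m)) = topspace (whitney_topology QM)"
proof -
  have WbA: "Wb b \<subseteq> A" using box_W_subset by blast
  show "openin (whitney_topology QM) (nondegenerate A \<sigma> (Wb b) (\<eta>b b) (Kb b m))"
    by (rule nondegenerate_open[OF box_transversal Wb_rel_open WbA \<eta>b_smooth \<eta>b_T Kb_compact Kb_subset])
  show "(whitney_topology QM) closure_of (nondegenerate A \<sigma> (Wb b) (\<eta>b b) (Kb b m)) = topspace (whitney_topology QM)"
    by (rule nondegenerate_dense[OF box_transversal Wb_rel_open WbA \<eta>b_smooth \<eta>b_T _ Kb_subset box_cutoff(1,2,3,4), of b]) (auto simp: box_cutoff(5))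
qed

end

section \<open>From one slice to the whole manifold\<close>

lemma slice_box_generic:
  assumes bx: "slice_box A \<sigma> D K W \<rho> K\<rho>"
  shows "\<exists>\<U>. countable \<U> \<and>
    (\<forall>U\<in>\<U>. openin (whitney_topology QM) U \<and> (whitney_topology QM) closure_of U = topspace (whitney_topology QM)) \<and>
    (\<forall>f J c k t. f \<in> \<Inter>\<U> \<longrightarrow> integral_curve P X J c \<longrightarrow> (\<forall>t\<in>J. f (\<pi> (c t)) = k) \<longrightarrow> t \<in> J \<longrightarrow>
      \<pi> (c t) \<in> (\<lambda>s. \<pi> (\<sigma> s)) ` D \<longrightarrow> (\<forall>\<^sub>F s in at t within J. \<pi> (c t) = \<pi> (c s)))"
proof -
  obtain B where "finite B" "B \<subseteq> T" "\<forall>b\<in>B. norm b = 1" "\<forall>v\<in>T. (\<Sum>b\<in>B. (v \<bullet> b) *\<^sub>R b) = v"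
    by (rule subspace_basis[OF orbit_model(1)])
  then have B: "finite B" "B \<subseteq> T" "\<And>v. v \<in> T \<Longrightarrow> (\<Sum>b\<in>B. (v \<bullet> b) *\<^sub>R b) = v" by blast+
  define g where "g = (\<lambda>(b, m). nondegenerate A \<sigma> {y \<in> W. coeff_field B A \<sigma> \<rho> y \<bullet> b \<noteq> 0}
    (\<lambda>y. inverse (coeff_field B A \<sigma> \<rho> y \<bullet> b) *\<^sub>R coeff_field B A \<sigma> \<rho> y)
    {y \<in> K. 1 / real (Suc m) \<le> \<bar>coeff_field B A \<sigma> \<rho> y \<bullet> b\<bar>})"
  let ?U = "g ` (B \<times> UNIV)"
  have "countable ?U"
    by (intro countable_image countable_SIGMA countable_finite[OF B(1)] countableI_type)
  moreover have "openin (whitney_topology QM) U \<and> (whitney_topology QM) closure_of U = topspace (whitney_topology QM)"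
    if U: "U \<in> ?U" for U
  proof -
    obtain b m where "b \<in> B" "U = g (b, m)" using U by auto
    then show ?thesis unfolding g_def prod.case using nondegenerate_open_dense[OF bx B] by blast
  qed
  moreover have "\<forall>\<^sub>F s in at t within J. \<pi> (c t) = \<pi> (c s)"
    if f: "f \<in> \<Inter>?U" and c: "integral_curve P X J c" and k: "\<forall>t\<in>J. f (\<pi> (c t)) = k" and t: "t \<in> J"
      "\<pi> (c t) \<in> (\<lambda>s. \<pi> (\<sigma> s)) ` D" for f J c k t
  proof (rule conserved_imp_locally_constant[where f=f and k=k, OF bx B _ c _ t])
    fix b m assume "b \<in> B"
    then have "f \<in> g (b, m)" using f by blast
    then show "f \<in> nondegenerate A \<sigma> {y \<in> W. coeff_field B A \<sigma> \<rho> y \<bullet> b \<noteq> 0}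
      (\<lambda>y. inverse (coeff_field B A \<sigma> \<rho> y \<bullet> b) *\<^sub>R coeff_field B A \<sigma> \<rho> y)
      {y \<in> K. 1 / real (Suc m) \<le> \<bar>coeff_field B A \<sigma> \<rho> y \<bullet> b\<bar>}" unfolding g_def by simp
  next
    fix s assume "s \<in> J"
    then show "f (\<pi> (c s)) = k" by (rule bspec[OF k])
  qed
  ultimately show ?thesis by (intro exI[of _ ?U]) blast
qed

text \<open>Each slice contributes countably many open dense sets, one for each basis vector and
  threshold. The Lindelof property of \<open>P\<close> reduces the slices to countably many, and
  local constancy of the orbit on the connected interval \<open>J\<close> becomes constancy.\<close>

lemma generic_conserved:
  "\<exists>\<U>. countable \<U> \<and>
    (\<forall>U\<in>\<U>. openin (whitney_topology QM) U \<and> (whitney_topology QM) closure_of U = topspace (whitney_topology QM)) \<and>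
    (\<forall>f J c k. f \<in> \<Inter>\<U> \<longrightarrow> integral_curve P X J c \<longrightarrow> (\<forall>t\<in>J. f (\<pi> (c t)) = k) \<longrightarrow> (\<pi> \<circ> c) constant_on J)"
proof -
  let ?P = "\<lambda>p V \<U>. openin (mtop P) V \<and> p \<in> V \<and> countable \<U> \<and>
    (\<forall>U\<in>\<U>. openin (whitney_topology QM) U \<and> (whitney_topology QM) closure_of U = topspace (whitney_topology QM)) \<and>
    (\<forall>f J c k t. f \<in> \<Inter>\<U> \<longrightarrow> integral_curve P X J c \<longrightarrow> (\<forall>t\<in>J. f (\<pi> (c t)) = k) \<longrightarrow> t \<in> J \<longrightarrow>
      c t \<in> V \<longrightarrow> (\<forall>\<^sub>F s in at t within J. \<pi> (c t) = \<pi> (c s)))"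
  have "\<forall>p\<in>E. \<exists>V \<U>. ?P p V \<U>"
  proof
    fix p assume p: "p \<in> E"
    obtain A \<sigma> D K W \<rho> K\<rho> where bx: "slice_box A \<sigma> D K W \<rho> K\<rho>" and ex: "\<exists>s\<in>D. \<pi> (\<sigma> s) = \<pi> p"
      by (rule slice_box_exists[OF p])
    have tr: "transversal T A \<sigma>" and RD: "open_in_subspace T D" and DA: "D \<subseteq> A" using bx unfolding slice_box_def by auto
    obtain \<U> where U: "countable \<U>"
      "\<forall>U\<in>\<U>. openin (whitney_topology QM) U \<and> (whitney_topology QM) closure_of U = topspace (whitney_topology QM)"
      "\<forall>f J c k t. f \<in> \<Inter>\<U> \<longrightarrow> integral_curve P X J c \<longrightarrow> (\<forall>t\<in>J. f (\<pi> (c t)) = k) \<longrightarrow> t \<in> J \<longrightarrow>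
        \<pi> (c t) \<in> (\<lambda>s. \<pi> (\<sigma> s)) ` D \<longrightarrow> (\<forall>\<^sub>F s in at t within J. \<pi> (c t) = \<pi> (c s))"
      using slice_box_generic[OF bx] by (elim exE conjE)
    \<comment> \<open>The covering is done in \<open>P\<close> by preimages of open sets of orbits,
      so that second countability of \<open>P\<close> can be used directly.\<close>
    let ?V = "{x \<in> E. \<pi> x \<in> (\<lambda>s. \<pi> (\<sigma> s)) ` D}"
    have V: "openin (mtop P) ?V" by (rule openin_continuous_map_preimage[OF orbit_continuous quot_open_image[OF tr RD DA]])
    have pV: "p \<in> ?V" using p ex by force
    have "?P p ?V \<U>" by (intro conjI V pV U(1,2)) (use U(3) in blast)
    then show "\<exists>V \<U>. ?P p V \<U>" by blast
  qed
  from bchoice[OF this] obtain V where "\<forall>p\<in>E. \<exists>\<U>. ?P p (V p) \<U>" by blast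
  from bchoice[OF this] obtain \<U> where VU: "\<forall>p\<in>E. ?P p (V p) (\<U> p)" by blast
  have Vo: "openin (mtop P) (V p)" and pV: "p \<in> V p" and cU: "countable (\<U> p)"
    and oU: "\<forall>U\<in>\<U> p. openin (whitney_topology QM) U \<and> (whitney_topology QM) closure_of U = topspace (whitney_topology QM)"
    and gen: "\<forall>f J c k t. f \<in> \<Inter>(\<U> p) \<longrightarrow> integral_curve P X J c \<longrightarrow> (\<forall>t\<in>J. f (\<pi> (c t)) = k) \<longrightarrow> t \<in> J \<longrightarrow>
      c t \<in> V p \<longrightarrow> (\<forall>\<^sub>F s in at t within J. \<pi> (c t) = \<pi> (c s))"
    if "p \<in> E" for p
    by (rule conjunct1[OF bspec[OF VU that]], rule conjunct1[OF conjunct2[OF bspec[OF VU that]]],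
        rule conjunct1[OF conjunct2[OF conjunct2[OF bspec[OF VU that]]]],
        rule conjunct1[OF conjunct2[OF conjunct2[OF conjunct2[OF bspec[OF VU that]]]]],
        rule conjunct2[OF conjunct2[OF conjunct2[OF conjunct2[OF bspec[OF VU that]]]]])
  have "second_countable (mtop P)" using P unfolding smooth_manifold_def by blast
  then have Lin: "Lindelof_space (mtop P)" by (rule second_countable_imp_Lindelof_space)
  have cover: "\<Union>(V ` E) = E"
  proof
    show "\<Union>(V ` E) \<subseteq> E" using openin_subset[OF Vo] by blast
    show "E \<subseteq> \<Union>(V ` E)" using pV by blast
  qed
  have "\<exists>\<V>. countable \<V> \<and> \<V> \<subseteq> V ` E \<and> \<Union>\<V> = E"
  proof (rule Lindelof_spaceD[OF Lin _ cover])
    fix U assume "U \<in> V ` E"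
    then obtain p where "p \<in> E" "U = V p" by (rule imageE)
    then show "openin (mtop P) U" using Vo by simp
  qed
  then obtain \<V> where \<V>: "countable \<V>" "\<V> \<subseteq> V ` E" "\<Union>\<V> = E" by (elim exE conjE)
  have "\<exists>C. countable C \<and> C \<subseteq> E \<and> \<V> = V ` C"
    using \<V>(1,2) countable_subset_image[of \<V> V E] by blast
  then obtain C where C: "countable C" "C \<subseteq> E" "\<V> = V ` C" by (elim exE conjE)
  let ?U = "\<Union>(\<U> ` C)"
  have "countable ?U" using C(1,2) cU by (intro countable_UN) auto
  moreover have "\<forall>U\<in>?U. openin (whitney_topology QM) U \<and> (whitney_topology QM) closure_of U = topspace (whitney_topology QM)"
  proof
    fix U assume "U \<in> ?U"
    then obtain p where p: "p \<in> C" "U \<in> \<U> p" by blast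
    then have "p \<in> E" using C(2) by blast
    then show "openin (whitney_topology QM) U \<and> (whitney_topology QM) closure_of U = topspace (whitney_topology QM)"
      by (rule bspec[OF oU p(2)])
  qed
  moreover have "(\<pi> \<circ> c) constant_on J"
    if f: "f \<in> \<Inter>?U" and c: "integral_curve P X J c" and k: "\<forall>t\<in>J. f (\<pi> (c t)) = k" for f J c k
  proof -
    have "is_interval J" using c by (simp add: integral_curve_def)
    then have J: "connected J" by (simp add: is_interval_connected)
    have loc: "\<forall>\<^sub>F s in at t within J. \<pi> (c t) = \<pi> (c s)" if t: "t \<in> J" for t
    proof -
      have "c t \<in> \<Union>\<V>" using integral_curve_E[OF c t] \<V>(3) by simp
      then obtain p where p: "p \<in> C" "c t \<in> V p" using C(3) by blast
      have fp: "f \<in> \<Inter>(\<U> p)" using f p(1) by blast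
      have "p \<in> E" using p(1) C(2) by blast
      from gen[OF this, THEN spec, THEN spec, THEN spec, THEN spec, THEN spec, THEN mp, OF fp,
          THEN mp, OF c, THEN mp, OF k, THEN mp, OF t, THEN mp, OF p(2)]
      show ?thesis .
    qed
    have "\<pi> (c s) = \<pi> (c t)" if "s \<in> J" "t \<in> J" for s t
      by (rule connected_local_const[OF J that]) (use loc in blast)
    then show ?thesis unfolding constant_on_def o_def by metis
  qed
  ultimately show ?thesis by (intro exI[of _ ?U]) blast
qed

text \<open>Open sets of the pulled back topology are preimages under \<open>descend\<close>, so the
  sets of \<open>generic_conserved\<close> pull back to open ones, which are dense by
  \<open>descend_surj\<close>. The converse implication of the equivalence holds because an
  invariant function is constant on an orbit.\<close>

lemma generic_invariant_function:
  "\<exists>R. residual_in (invariant_function_topology G L P \<alpha>) R \<and>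
    (\<forall>F\<in>R. \<forall>J c. integral_curve P X J c \<longrightarrow>
       ((F \<circ> c) constant_on J \<longleftrightarrow> relative_equilibrium G L P \<alpha> X J c))"
proof -
  let ?I = "invariant_functions G P \<alpha>" and ?d = "descend G P \<alpha>"
  let ?top = "invariant_function_topology G L P \<alpha>"
  have top: "openin ?top V \<longleftrightarrow> (\<exists>U. openin (whitney_topology QM) U \<and> V = ?d -` U \<inter> ?I)" for V
    unfolding invariant_function_topology_def openin_pullback_topology ..
  have topI: "topspace ?top \<subseteq> ?I"
    unfolding invariant_function_topology_def topspace_pullback_topology by blast
  obtain \<U> where U: "countable \<U>"
    "\<And>U. U \<in> \<U> \<Longrightarrow> openin (whitney_topology QM) U \<and> (whitney_topology QM) closure_of U = topspace (whitney_topology QM)"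
    and const: "\<And>f J c k. f \<in> \<Inter>\<U> \<Longrightarrow> integral_curve P X J c \<Longrightarrow> \<forall>t\<in>J. f (\<pi> (c t)) = k \<Longrightarrow> (\<pi> \<circ> c) constant_on J"
    using generic_conserved by blast
  define R where "R = topspace ?top \<inter> {F. ?d F \<in> \<Inter>\<U>}"
  have "residual_in ?top R"
    unfolding residual_in_def
  proof (intro conjI exI[of _ "(\<lambda>U. ?d -` U \<inter> ?I) ` \<U>"] ballI)
    show "R \<subseteq> topspace ?top" unfolding R_def by blast
    show "countable ((\<lambda>U. ?d -` U \<inter> ?I) ` \<U>)" using U(1) by (rule countable_image)
    show "topspace ?top \<inter> \<Inter> ((\<lambda>U. ?d -` U \<inter> ?I) ` \<U>) \<subseteq> R" unfolding R_def by blast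
    fix V assume "V \<in> (\<lambda>U. ?d -` U \<inter> ?I) ` \<U>"
    then obtain U where V: "U \<in> \<U>" "V = ?d -` U \<inter> ?I" by blast
    show "openin ?top V" unfolding top using U(2)[OF V(1)] V(2) by blast
    show "?top closure_of V = topspace ?top"
      unfolding dense_intersects_open
    proof (intro allI impI, elim conjE)
      fix N assume N: "openin ?top N" "N \<noteq> {}"
      then obtain N' where N': "openin (whitney_topology QM) N'" "N = ?d -` N' \<inter> ?I" unfolding top by blast
      have "N' \<noteq> {}" using N(2) N'(2) by blast
      \<comment> \<open>Density downstairs yields a function on the orbit manifold, which is then
        lifted to an invariant function.\<close>
      then obtain f where f: "f \<in> U" "f \<in> N'"
        using U(2)[OF V(1)] N'(1) unfolding dense_intersects_open by blast
      have "f \<in> smooth_functions QM"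
        using f(2) openin_subset[OF N'(1)] unfolding topspace_whitney_topology by blast
      then obtain F where "F \<in> ?I" "?d F = f" by (rule descend_surj)
      then show "V \<inter> N \<noteq> {}" using f V(2) N'(2) by blast
    qed
  qed
  moreover have "(F \<circ> c) constant_on J \<longleftrightarrow> relative_equilibrium G L P \<alpha> X J c"
    if F: "F \<in> R" and c: "integral_curve P X J c" for F J c
  proof -
    have FI: "F \<in> ?I" and Fd: "?d F \<in> \<Inter>\<U>" using F topI unfolding R_def by blast+
    have eq: "?d F (\<pi> (c t)) = F (c t)" if "t \<in> J" for t
      by (rule descend_orbit[OF FI integral_curve_E[OF c that]])
    show ?thesis
    proof
      assume "(F \<circ> c) constant_on J"
      then obtain k where "\<forall>t\<in>J. ?d F (\<pi> (c t)) = k" unfolding constant_on_def using eq by auto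
      from const[OF Fd c this] show "relative_equilibrium G L P \<alpha> X J c"
        unfolding relative_equilibrium_def using c integral_curve_orbit[OF c] by blast
    next
      assume "relative_equilibrium G L P \<alpha> X J c"
      then obtain q where "\<forall>t\<in>J. \<pi> (c t) = q" unfolding relative_equilibrium_def constant_on_def by auto
      then have "\<forall>t\<in>J. (F \<circ> c) t = ?d F q" using eq by (metis o_apply)
      then show "(F \<circ> c) constant_on J" unfolding constant_on_def by blast
    qed
  qed
  ultimately show ?thesis by blast
qed

end

theorem theorem3p3:
  fixes P :: "('p, 'e::euclidean_space) manifold"
    and G :: "('g, 'r) monoid_scheme"
    and L :: "('g, 'f::euclidean_space) manifold"
    and \<alpha> :: "'g \<Rightarrow> 'p \<Rightarrow> 'p"
    and X :: "'p vector_field"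
  assumes "smooth_manifold P"
    and "lie_group G L"
    and "smooth_action G L P \<alpha>"
    and "proper_action L P \<alpha>"
    and "free_action G P \<alpha>"
    and "smooth_vector_field P X"
    and "invariant_vector_field G P \<alpha> X"
  shows "\<exists>R. residual_in (invariant_function_topology G L P \<alpha>) R \<and>
    (\<forall>F\<in>R. \<forall>J c. integral_curve P X J c \<longrightarrow>
       ((F \<circ> c) constant_on J \<longleftrightarrow> relative_equilibrium G L P \<alpha> X J c))"
proof -
  interpret invariant_field P G L \<alpha> X
    by unfold_locales (rule assms)+
  show ?thesis by (rule generic_invariant_function)
qed

end
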